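(* Let $n\ge 2$. Let $F(Y,\mathbf{X})\in\mathbb{Z}[Y,X_1,\ldots,X_n]$ be an $n$-genuine polynomial (over $\mathbb{Q}$) of total degree $D$. Then for all $B\ge 1$, $$\#\{\mathbf{x}'\in\mathbb{Z}^{n-1}\cap[-B,B]^{n-1}:\ F(Y,X_1,\mathbf{x}')\text{ splits completely over }\overline{\mathbb{Q}}\}\ll_{n,D}B^{n-2}.$$ Also, there exists a finite set $\mathcal{E}$ of exceptional primes, with $|\mathcal{E}|\ll_{n,D}\log\|F\|/\log\log\|F\|$, such that for all primes $p\notin\mathcal{E}$, $$\#\{\mathbf{x}'\in\mathbb{F}_p^{n-1}:\ F(Y,X_1,\mathbf{x}')\text{ splits completely over }\overline{\mathbb{F}}_p\}\ll_{n,D}p^{n-2}.$$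
   Context: Let $K$ be a number field and $\mathbf{X}=(X_1,\ldots,X_n)$. A finite (nontrivial) extension $M$ of $K(\mathbf{X})$ is an $n$-genuine extension if for every $G(Y,\mathbf{X})\in K[Y,X_1,\ldots,X_n]$ such that $M=K(\mathbf{X})[Y]/(G(Y,\mathbf{X}))$, the polynomial $G$ has nonzero degree in each of $X_1,\ldots,X_n$. A polynomial $G(Y,\mathbf{X})\in K[Y,X_1,\ldots,X_n]$ that is monic in $Y$ and irreducible over $K(\mathbf{X})$ is an $n$-genuine polynomial if $K(\mathbf{X})[Y]/(G(Y,\mathbf{X}))$ is an $n$-genuine extension of $K(\mathbf{X})$. Here $K=\mathbb{Q}$. For a field $\mathcal{K}$, a polynomial $f(Y,Z)\in\mathcal{K}[Y,Z]$ monic in $Y$ splits completely over $\overline{\mathcal{K}}$ if $f(Y,Z)=\prod_j(Y-Q_j(Z))$ with all $Q_j(Z)\in\overline{\mathcal{K}}[Z]$. Write $\mathbf{x}'=(x_2,\ldots,x_n)$ for values substituted for $(X_2,\ldots,X_n)$; over $\mathbb{F}_p$ the coefficients of $F$ are reduced modulo $p$. $\|F\|$ is the maximum absolute value of the coefficients of $F$. In the quantity $\log\|F\|/\log\log\|F\|$, $\|F\|$ is read as $\max(\|F\|,3)$. *)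

theory Defs
  imports
    "HOL-Algebra.Algebraic_Closure_Type"
    "HOL-Number_Theory.Residues"
    "HOL-Library.Poly_Mapping"
    Complex_Main
begin

text \<open>
  Multivariate polynomials are finitely supported functions on monomials; the variable
  \<open>X\<^sub>i\<close> has index \<open>i\<close>, so \<open>K[X\<^sub>1,\<dots>,X\<^sub>n]\<close> consists of those using
  only the indices \<open>1,\<dots>,n\<close>. An element of \<open>K[Y,X\<^sub>1,\<dots>,X\<^sub>n]\<close> is a
  univariate polynomial in \<open>Y\<close> with coefficients in \<open>K[X\<^sub>1,\<dots>,X\<^sub>n]\<close>.
\<close>

type_synonym 'a mpoly = "(nat \<Rightarrow>\<^sub>0 nat) \<Rightarrow>\<^sub>0 'a"

definition mpolys :: "nat \<Rightarrow> 'a::zero mpoly set" where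
  "mpolys n = {a. \<forall>m \<in> Poly_Mapping.keys a. Poly_Mapping.keys m \<subseteq> {1..n}}"

definition ypolys :: "nat \<Rightarrow> 'a::zero mpoly poly set" where
  "ypolys n = {G. \<forall>l. Polynomial.coeff G l \<in> mpolys n}"

text \<open>The pairs \<open>(l, m)\<close> for which the monomial \<open>Y\<^sup>l X\<^sup>m\<close> occurs in \<open>G\<close>.\<close>

definition ymonomials :: "'a::zero mpoly poly \<Rightarrow> (nat \<times> (nat \<Rightarrow>\<^sub>0 nat)) set" where
  "ymonomials G = {(l, m). Poly_Mapping.lookup (Polynomial.coeff G l) m \<noteq> 0}"

definition degree_X :: "nat \<Rightarrow> 'a::zero mpoly poly \<Rightarrow> nat" where
  "degree_X i G = Max (insert 0 ((\<lambda>(l, m). Poly_Mapping.lookup m i) ` ymonomials G))"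

definition total_degree :: "'a::zero mpoly poly \<Rightarrow> nat" where
  "total_degree G =
     Max (insert 0 ((\<lambda>(l, m). l + (\<Sum>i\<in>Poly_Mapping.keys m. Poly_Mapping.lookup m i)) ` ymonomials G))"

definition height :: "int mpoly poly \<Rightarrow> int" where
  "height F =
     Max (insert 0 ((\<lambda>(l, m). \<bar>Poly_Mapping.lookup (Polynomial.coeff F l) m\<bar>) ` ymonomials F))"

definition rat_ypoly :: "int mpoly poly \<Rightarrow> rat mpoly poly" where
  "rat_ypoly F = map_poly (Poly_Mapping.map of_int) F"


text \<open>
  The field \<open>K(X\<^sub>1,\<dots>,X\<^sub>n)\<close>, as a subfield of the fraction field of the
  polynomial ring in all the variables \<open>X\<^sub>i\<close>.
\<close>

abbreviation fract_ring :: "'k::field mpoly fract ring" where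
  "fract_ring \<equiv> ring_of_type_algebra"

definition ratfuns :: "nat \<Rightarrow> 'k::field mpoly fract set" where
  "ratfuns n = {Fract a b | a b. a \<in> mpolys n \<and> b \<in> mpolys n \<and> b \<noteq> 0}"

text \<open>
  HOL-Algebra represents univariate polynomials by coefficient lists, leading coefficient first.
\<close>

definition ratfun_poly :: "'k::field mpoly poly \<Rightarrow> 'k mpoly fract list" where
  "ratfun_poly G = rev (map to_fract (Polynomial.coeffs G))"

text \<open>
  \<open>Rupt\<close> is the quotient by the principal ideal of the given polynomial, and
  \<open>rupture_surj\<close> the projection to it.
\<close>

definition quot_field :: "nat \<Rightarrow> 'k::field mpoly poly \<Rightarrow> 'k mpoly fract list set ring" where
  "quot_field n G = Rupt\<^bsub>fract_ring\<^esub> (ratfuns n) (ratfun_poly G)"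

definition quot_embed :: "nat \<Rightarrow> 'k::field mpoly poly \<Rightarrow> 'k mpoly fract \<Rightarrow> 'k mpoly fract list set" where
  "quot_embed n G c =
     ring.rupture_surj fract_ring (ratfuns n) (ratfun_poly G) (ring.poly_of_const fract_ring c)"

text \<open>
  An extension \<open>M\<close> of \<open>K(X\<^sub>1,\<dots>,X\<^sub>n)\<close> is given with its embedding
  \<open>\<iota>\<close>, and \<open>M = K(X\<^sub>1,\<dots>,X\<^sub>n)[Y]/(G)\<close> means isomorphic as extensions
  of \<open>K(X\<^sub>1,\<dots>,X\<^sub>n)\<close>.
\<close>

definition finite_extension :: "nat \<Rightarrow> 'm ring \<Rightarrow> ('k::field mpoly fract \<Rightarrow> 'm) \<Rightarrow> bool" where
  "finite_extension n M \<iota> \<longleftrightarrow>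
     field M \<and>
     \<iota> \<in> ring_hom (fract_ring\<lparr>carrier := ratfuns n\<rparr>) M \<and>
     ring.finite_dimension M (\<iota> ` ratfuns n) (carrier M)"

definition extension_eq_quot ::
    "nat \<Rightarrow> 'm ring \<Rightarrow> ('k::field mpoly fract \<Rightarrow> 'm) \<Rightarrow> 'k mpoly poly \<Rightarrow> bool" where
  "extension_eq_quot n M \<iota> G \<longleftrightarrow>
     (\<exists>\<phi> \<in> ring_iso M (quot_field n G). \<forall>c \<in> ratfuns n. \<phi> (\<iota> c) = quot_embed n G c)"

definition genuine_extension :: "nat \<Rightarrow> 'm ring \<Rightarrow> ('k::field mpoly fract \<Rightarrow> 'm) \<Rightarrow> bool" where
  "genuine_extension n M \<iota> \<longleftrightarrow>
     finite_extension n M \<iota> \<and>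
     \<iota> ` ratfuns n \<noteq> carrier M \<and>
     (\<forall>G \<in> ypolys n. extension_eq_quot n M \<iota> G \<longrightarrow> (\<forall>i \<in> {1..n}. degree_X i G \<noteq> 0))"

definition genuine_poly :: "nat \<Rightarrow> 'k::field mpoly poly \<Rightarrow> bool" where
  "genuine_poly n G \<longleftrightarrow>
     G \<in> ypolys n \<and>
     Polynomial.lead_coeff G = 1 \<and>
     pirreducible\<^bsub>fract_ring\<^esub> (ratfuns n) (ratfun_poly G) \<and>
     genuine_extension n (quot_field n G) (quot_embed n G)"


text \<open>
  \<open>F(Y, X\<^sub>1, x\<^sub>2,\<dots>,x\<^sub>n)\<close> over the commutative ring \<open>R\<close>, with the integer
  coefficients of \<open>F\<close> mapped to \<open>R\<close>: the value at \<open>i\<close>, \<open>j\<close> is the coefficient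
  of \<open>Y\<^sup>i X\<^sub>1\<^sup>j\<close>. This is an element of \<open>UP (UP R)\<close>, where the elements of
  \<open>UP R\<close> are coefficient functions.
\<close>

definition specialize ::
    "('a, 'b) ring_scheme \<Rightarrow> nat \<Rightarrow> int mpoly poly \<Rightarrow> (nat \<Rightarrow> 'a) \<Rightarrow> nat \<Rightarrow> nat \<Rightarrow> 'a" where
  "specialize R n F x i j =
     (\<Oplus>\<^bsub>R\<^esub> m \<in> {m \<in> Poly_Mapping.keys (Polynomial.coeff F i). Poly_Mapping.lookup m 1 = j}.
        ([Poly_Mapping.lookup (Polynomial.coeff F i) m] \<cdot>\<^bsub>R\<^esub> \<one>\<^bsub>R\<^esub>) \<otimes>\<^bsub>R\<^esub>
        (\<Otimes>\<^bsub>R\<^esub> k \<in> {2..n}. x k [^]\<^bsub>R\<^esub> Poly_Mapping.lookup m k))"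

text \<open>
  Here \<open>f i j\<close> is the coefficient of \<open>Y\<^sup>i Z\<^sup>j\<close>, and \<open>ring.indexed_const R\<close> is the
  embedding of \<open>R\<close> in its algebraic closure \<open>field.alg_closure R\<close>.
\<close>

definition splits_completely :: "'a ring \<Rightarrow> (nat \<Rightarrow> nat \<Rightarrow> 'a) \<Rightarrow> bool" where
  "splits_completely R f \<longleftrightarrow>
     (let L = field.alg_closure R; S = UP (UP L) in
      \<exists>d Q. (\<forall>j<d. Q j \<in> carrier (UP L)) \<and>
        (\<lambda>i j. ring.indexed_const R (f i j)) =
          (\<Otimes>\<^bsub>S\<^esub> j \<in> {..<d::nat}. up_ring.monom S \<one>\<^bsub>UP L\<^esub> 1 \<ominus>\<^bsub>S\<^esub> up_ring.monom S (Q j) 0))"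

end

theory Submission
  imports Defs "Jordan_Normal_Form.Char_Poly" "HOL-Library.Nat_Bijection"
begin

text \<open>
  Let \<open>k\<close> be the field of rational functions in \<open>X\<^sub>2, \<dots>, X\<^sub>n\<close>, let \<open>d\<close> be the degree of \<open>F\<close> in \<open>Y\<close>,
  and let \<open>\<alpha>\<close> be a root of \<open>F\<close> over \<open>k(X\<^sub>1)\<close>. The derivation \<open>d/dX\<^sub>1\<close> extends to \<open>k(X\<^sub>1)(\<alpha>)\<close>, and
  repeated differentiation of \<open>F(\<alpha>) = 0\<close> writes the \<open>m\<close>-th derivative of \<open>\<alpha>\<close> as
  \<open>N\<^sub>m(\<alpha>) / F\<^sub>Y(\<alpha>)\<^sup>2\<^sup>m\<close>, where \<open>N\<^sub>m\<close> (called \<open>jet F m\<close> below) is given by a universal formula in the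
  coefficients of \<open>F\<close>.

  Suppose that a specialization of \<open>X\<^sub>2, \<dots>, X\<^sub>n\<close> in any field makes \<open>F\<close> split completely. Its roots
  are then polynomials in \<open>X\<^sub>1\<close> of degree at most \<open>D\<close>, their derivatives of order \<open>D + 1\<close> vanish, so
  each root is a zero of \<open>N\<^sub>D\<^sub>+\<^sub>1\<close> and \<open>F\<close> divides the \<open>d\<close>-th power of \<open>N\<^sub>D\<^sub>+\<^sub>1\<close>. Dividing this power by \<open>F\<close> for
  indeterminate coefficients gives a remainder whose coefficients are finitely many integer
  polynomials, the splitting relations; they depend only on \<open>d\<close> and \<open>D\<close>, and they vanish at the
  coefficients of every such specialization (\<open>splitting_relation_product\<close>,
  \<open>relation_vanishes_if_splits\<close>). Since the relations are universal, their values at the coefficients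
  of \<open>F\<close> are polynomials \<open>P(X\<^sub>2, \<dots>, X\<^sub>n)\<close> of bounded degree whose coefficients are bounded by a constant
  times a fixed power of \<open>max(\<parallel>F\<parallel>, 3)\<close>.

  For a genuine \<open>F\<close> one of these \<open>P\<close> is not zero (\<open>genuine_relation_nonzero\<close>). Otherwise the
  derivative of \<open>\<alpha>\<close> of order \<open>D + 1\<close> is zero, so that the Taylor sum
  \<open>\<beta>\<^sub>t = \<Sum>\<^sub>j \<alpha>\<^sup>(\<^sup>j\<^sup>) (t - X\<^sub>1)\<^sup>j / j!\<close> over \<open>j \<le> D\<close> has derivative zero for every integer \<open>t\<close>. The
  coordinates of \<open>1, \<beta>\<^sub>t, \<dots>, \<beta>\<^sub>t\<^sup>d\<^sup>-\<^sup>1\<close> in the basis of powers of \<open>\<alpha>\<close> are polynomials in \<open>t\<close>; their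
  determinant is \<open>1\<close> at \<open>t = X\<^sub>1\<close>, where \<open>\<beta>\<^sub>t = \<alpha>\<close>, hence it is nonzero for some integer \<open>t\<close>, and
  then \<open>\<beta>\<^sub>t\<close> generates the extension. A polynomial relation for \<open>\<beta>\<^sub>t\<close> of degree \<open>d\<close> remains a relation
  when its coefficients are differentiated, and the last nonzero derivative is a relation without
  \<open>X\<^sub>1\<close>. So the extension is defined by a polynomial without \<open>X\<^sub>1\<close>, against genuineness.

  It remains to count the zeros of one nonzero \<open>P\<close>. Over the integers and modulo a prime there are
  \<open>O(|S|\<^sup>n\<^sup>-\<^sup>2)\<close> of them in \<open>S\<^sup>n\<^sup>-\<^sup>1\<close> (\<open>card_zeros_mod_le\<close>), provided that the prime does not divide a
  chosen nonzero coefficient \<open>c\<close> of \<open>P\<close>. The exceptional primes are the prime divisors of \<open>c\<close>: if there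
  are \<open>r\<close> of them then \<open>r! \<le> |c|\<close>, which bounds \<open>r\<close> by the estimate for \<open>|c|\<close>
  (\<open>card_prime_divisors_le\<close>).
\<close>

abbreviation lookup where "lookup \<equiv> Poly_Mapping.lookup"
abbreviation keys where "keys \<equiv> Poly_Mapping.keys"
abbreviation single where "single \<equiv> Poly_Mapping.single"
abbreviation coeff where "coeff \<equiv> Polynomial.coeff"
abbreviation degree where "degree \<equiv> Polynomial.degree"
abbreviation lead_coeff where "lead_coeff p \<equiv> Polynomial.lead_coeff p"

section \<open>Evaluating integer polynomials in commutative rings\<close>

lemma mpoly_induct [case_names single add]:
  fixes p :: "'a \<Rightarrow>\<^sub>0 'b::comm_monoid_add"
  assumes "\<And>m a. P (single m a)"
    and "\<And>p q. P p \<Longrightarrow> P q \<Longrightarrow> P (p + q)"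
  shows "P p"
proof (induction p rule: Poly_Mapping.update_induct)
  case const
  show ?case using assms(1)[of undefined 0] by simp
next
  case (update f a b)
  have "Poly_Mapping.update a b f = f + single a b"
    using update(1) by (intro poly_mapping_eqI)
      (auto simp: lookup_update lookup_add lookup_single when_def in_keys_iff)
  then show ?case using assms(1)[of a b] assms(2) update by metis
qed

definition mon_eval :: "('a, 'b) ring_scheme \<Rightarrow> (nat \<Rightarrow> 'a) \<Rightarrow> (nat \<Rightarrow>\<^sub>0 nat) \<Rightarrow> 'a" where
  "mon_eval R x m = (\<Otimes>\<^bsub>R\<^esub> k \<in> keys m. x k [^]\<^bsub>R\<^esub> lookup m k)"

text \<open>
  The rings in which the specialized polynomials live are records, and the prime of a residue ring is a
  term, not a type. Hence the evaluation is defined for an arbitrary ring record; \<open>teval\<close> below is the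
  special case of a type class ring.
\<close>

definition meval :: "('a, 'b) ring_scheme \<Rightarrow> (nat \<Rightarrow> 'a) \<Rightarrow> int mpoly \<Rightarrow> 'a" where
  "meval R x p =
     (\<Oplus>\<^bsub>R\<^esub> m \<in> keys p. ([lookup p m] \<cdot>\<^bsub>R\<^esub> \<one>\<^bsub>R\<^esub>) \<otimes>\<^bsub>R\<^esub> mon_eval R x m)"

context cring
begin

lemma int_scalar_zero [simp]: "[(0::int)] \<cdot> \<one> = \<zero>"
  by (simp add: add_pow_def)

lemma int_scalar_add: "[(a + b::int)] \<cdot> \<one> = [a] \<cdot> \<one> \<oplus> [b] \<cdot> \<one>"
  by (simp add: add.int_pow_mult)

lemma int_scalar_mult: "[(a * b::int)] \<cdot> \<one> = ([a] \<cdot> \<one>) \<otimes> ([b] \<cdot> \<one>)"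
  by (simp add: add_pow_ldistr_int add.int_pow_pow mult.commute)

lemma mon_eval_closed [simp]:
  assumes "\<And>k. x k \<in> carrier R"
  shows "mon_eval R x m \<in> carrier R"
  unfolding mon_eval_def using assms by (intro finprod_closed) auto

lemma mon_eval_superset:
  assumes "\<And>k. x k \<in> carrier R" "finite A" "keys m \<subseteq> A"
  shows "mon_eval R x m = (\<Otimes>k\<in>A. x k [^] lookup m k)"
  unfolding mon_eval_def using assms
  by (intro finprod_mono_neutral_cong_left) (auto simp: in_keys_iff)

lemma mon_eval_add:
  assumes "\<And>k. x k \<in> carrier R"
  shows "mon_eval R x (m + m') = mon_eval R x m \<otimes> mon_eval R x m'"
proof -
  let ?A = "keys m \<union> keys m'"
  have "keys (m + m') \<subseteq> ?A" by (rule Poly_Mapping.keys_add)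
  then have "mon_eval R x (m + m') = (\<Otimes>k\<in>?A. x k [^] lookup (m + m') k)"
    using assms by (intro mon_eval_superset) auto
  also have "\<dots> = (\<Otimes>k\<in>?A. x k [^] lookup m k \<otimes> x k [^] lookup m' k)"
    using assms by (intro finprod_cong') (auto simp: lookup_add nat_pow_mult)
  also have "\<dots> = (\<Otimes>k\<in>?A. x k [^] lookup m k) \<otimes> (\<Otimes>k\<in>?A. x k [^] lookup m' k)"
    using assms by (intro finprod_multf) auto
  also have "(\<Otimes>k\<in>?A. x k [^] lookup m k) = mon_eval R x m"
    using assms by (intro mon_eval_superset[symmetric]) auto
  also have "(\<Otimes>k\<in>?A. x k [^] lookup m' k) = mon_eval R x m'"
    using assms by (intro mon_eval_superset[symmetric]) auto
  finally show ?thesis .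
qed

lemma meval_closed [simp]:
  assumes "\<And>k. x k \<in> carrier R"
  shows "meval R x p \<in> carrier R"
  unfolding meval_def using assms by (intro finsum_closed) auto

lemma meval_superset:
  assumes "\<And>k. x k \<in> carrier R" "finite A" "keys p \<subseteq> A"
  shows "meval R x p = (\<Oplus>m\<in>A. ([lookup p m] \<cdot> \<one>) \<otimes> mon_eval R x m)"
  unfolding meval_def using assms
  by (intro add.finprod_mono_neutral_cong_left) (auto simp: in_keys_iff)

lemma meval_single:
  assumes "\<And>k. x k \<in> carrier R"
  shows "meval R x (single m a) = ([a] \<cdot> \<one>) \<otimes> mon_eval R x m"
  using meval_superset[of x "{m}" "single m a"] assms by simp

lemma meval_add:
  assumes x: "\<And>k. x k \<in> carrier R"
  shows "meval R x (p + q) = meval R x p \<oplus> meval R x q"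
proof -
  let ?A = "keys p \<union> keys q"
  have "keys (p + q) \<subseteq> ?A" by (rule Poly_Mapping.keys_add)
  then have "meval R x (p + q) = (\<Oplus>m\<in>?A. ([lookup (p + q) m] \<cdot> \<one>) \<otimes> mon_eval R x m)"
    using assms by (intro meval_superset) auto
  also have "\<dots> = (\<Oplus>m\<in>?A. ([lookup p m] \<cdot> \<one>) \<otimes> mon_eval R x m
                  \<oplus> ([lookup q m] \<cdot> \<one>) \<otimes> mon_eval R x m)"
    using assms by (intro finsum_cong') (auto simp: lookup_add int_scalar_add l_distr)
  also have "\<dots> = (\<Oplus>m\<in>?A. ([lookup p m] \<cdot> \<one>) \<otimes> mon_eval R x m)
                  \<oplus> (\<Oplus>m\<in>?A. ([lookup q m] \<cdot> \<one>) \<otimes> mon_eval R x m)"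
    using assms by (intro finsum_addf) auto
  also have "(\<Oplus>m\<in>?A. ([lookup p m] \<cdot> \<one>) \<otimes> mon_eval R x m) = meval R x p"
    using assms by (intro meval_superset[symmetric]) auto
  also have "(\<Oplus>m\<in>?A. ([lookup q m] \<cdot> \<one>) \<otimes> mon_eval R x m) = meval R x q"
    using assms by (intro meval_superset[symmetric]) auto
  finally show ?thesis .
qed

lemma meval_mult:
  assumes x: "\<And>k. x k \<in> carrier R"
  shows "meval R x (p * q) = meval R x p \<otimes> meval R x q"
proof (induction p rule: mpoly_induct)
  case (single m a)
  show ?case
  proof (induction q rule: mpoly_induct)
    case (single m' b)
    show ?case using x
      by (simp add: mult_single meval_single mon_eval_add int_scalar_mult m_ac)
  next
    case (add p q)
    then show ?case using x by (simp add: distrib_left meval_add r_distr)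
  qed
next
  case (add p p')
  then show ?case using x by (simp add: distrib_right meval_add l_distr)
qed

lemma meval_one:
  assumes x: "\<And>k. x k \<in> carrier R"
  shows "meval R x 1 = \<one>"
  using meval_single[of x 0 1] x by (simp add: mon_eval_def)

lemma meval_var:
  assumes x: "\<And>k. x k \<in> carrier R"
  shows "meval R x (single (single k 1) 1) = x k"
  using x by (simp add: meval_single mon_eval_def)

lemma meval_hom:
  assumes x: "\<And>k. x k \<in> carrier R"
  shows "meval R x \<in> Ring.ring_hom (ring_of_type_algebra) R"
  using x by (intro ring_hom_memI)
    (auto simp: ring_of_type_algebra_def meval_add meval_mult meval_one)

lemma meval_cong:
  assumes "\<And>m k. m \<in> keys p \<Longrightarrow> k \<in> keys m \<Longrightarrow> x k = y k"
    and "\<And>k. y k \<in> carrier R"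
  shows "meval R x p = meval R y p"
proof -
  have "mon_eval R x m = mon_eval R y m" if "m \<in> keys p" for m
    unfolding mon_eval_def using assms that by (intro finprod_cong') auto
  then show ?thesis
    unfolding meval_def using assms by (intro finsum_cong') auto
qed

end

text \<open>
  Evaluations commute with homomorphisms, so an identity between integer polynomials transfers to every
  commutative ring. This is how statements about an algebraic closure, which is no type, are reduced to
  computations in polynomial types.
\<close>

lemma ring_hom_meval:
  assumes "cring R" "cring S" "h \<in> Ring.ring_hom R S" and x: "\<And>k. x k \<in> carrier R"
  shows "h (meval R x p) = meval S (\<lambda>k. h (x k)) p"
proof -
  interpret R: cring R by fact
  interpret S: cring S by fact
  interpret H: ring_hom_cring R S h
    by (intro ring_hom_cringI) (use assms R.cring_axioms S.cring_axioms in auto)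
  have hx: "\<And>k. h (x k) \<in> carrier S" using x by auto
  have hi: "h ([(a::int)] \<cdot>\<^bsub>R\<^esub> \<one>\<^bsub>R\<^esub>) = [a] \<cdot>\<^bsub>S\<^esub> \<one>\<^bsub>S\<^esub>" for a
    using hom_int_pow[of h "add_monoid R" "add_monoid S" "\<one>\<^bsub>R\<^esub>" a] R.a_group S.a_group
    by (auto simp add: add_pow_def hom_def)
  have hm: "h (mon_eval R x m) = mon_eval S (\<lambda>k. h (x k)) m" for m
    unfolding mon_eval_def using x by (simp add: H.hom_finprod Pi_def comp_def)
  show ?thesis
  proof (induction p rule: mpoly_induct)
    case (single m a)
    show ?case using x hx by (simp add: R.meval_single S.meval_single hi hm)
  next
    case (add p q)
    then show ?case using x hx by (simp add: R.meval_add S.meval_add)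
  qed
qed


lemma type_ring_simps [simp]:
  "carrier ring_of_type_algebra = UNIV"
  "x \<otimes>\<^bsub>ring_of_type_algebra\<^esub> y = x * y"
  "\<one>\<^bsub>ring_of_type_algebra\<^esub> = 1"
  "\<zero>\<^bsub>ring_of_type_algebra\<^esub> = 0"
  "x \<oplus>\<^bsub>ring_of_type_algebra\<^esub> y = x + y"
  by (auto simp: ring_of_type_algebra_def)

lemma type_ring_pow [simp]:
  "(x::'a::comm_ring_1) [^]\<^bsub>ring_of_type_algebra\<^esub> (k::nat) = x ^ k"
proof -
  interpret cring "ring_of_type_algebra :: 'a ring" by (rule cring_from_type_algebra)
  show ?thesis by (induction k) (auto simp: mult.commute)
qed

lemma type_ring_finsum [simp]:
  fixes f :: "'b \<Rightarrow> 'a::comm_ring_1"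
  shows "(\<Oplus>\<^bsub>ring_of_type_algebra\<^esub> i \<in> A. f i) = (\<Sum>i\<in>A. f i)"
proof -
  interpret cring "ring_of_type_algebra :: 'a ring" by (rule cring_from_type_algebra)
  show ?thesis
    by (induction A rule: infinite_finite_induct) (auto simp: finsum_infinite)
qed

lemma type_ring_finprod [simp]:
  fixes f :: "'b \<Rightarrow> 'a::comm_ring_1"
  shows "(\<Otimes>\<^bsub>ring_of_type_algebra\<^esub> i \<in> A. f i) = (\<Prod>i\<in>A. f i)"
proof -
  interpret cring "ring_of_type_algebra :: 'a ring" by (rule cring_from_type_algebra)
  show ?thesis
    by (induction A rule: infinite_finite_induct) (auto)
qed

lemma type_ring_hom_of_int: "(of_int :: int \<Rightarrow> 'a::comm_ring_1) \<in> Ring.ring_hom ring_of_type_algebra ring_of_type_algebra"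
  by (intro ring_hom_memI) auto

lemma type_ring_int_scalar [simp]:
  "[(a::int)] \<cdot>\<^bsub>ring_of_type_algebra\<^esub> (1::'a::comm_ring_1) = of_int a"
proof -
  interpret cring "ring_of_type_algebra :: 'a ring" by (rule cring_from_type_algebra)
  have 1: "[(a + b::int)] \<cdot>\<^bsub>ring_of_type_algebra\<^esub> (1::'a) =
      [a] \<cdot>\<^bsub>ring_of_type_algebra\<^esub> (1::'a) + [b] \<cdot>\<^bsub>ring_of_type_algebra\<^esub> (1::'a)" for a b
    using int_scalar_add[of a b] by simp
  have 2: "[(1::int)] \<cdot>\<^bsub>ring_of_type_algebra\<^esub> (1::'a) = 1"
    using add.int_pow_1[of "1::'a"] by simp
  have 3: "[(0::int)] \<cdot>\<^bsub>ring_of_type_algebra\<^esub> (1::'a) = 0"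
    using int_scalar_zero by simp
  show ?thesis
  proof (induction a rule: int_induct[where k = 0])
    case (step1 i) then show ?case by (simp add: 1 2)
  next
    case (step2 i)
    then show ?case using 1[of "i - 1" 1] by (simp add: 2 algebra_simps)
  qed (simp add: 3)
qed

abbreviation teval :: "(nat \<Rightarrow> 'a::comm_ring_1) \<Rightarrow> int mpoly \<Rightarrow> 'a" where
  "teval \<equiv> meval ring_of_type_algebra"

lemma teval_eq:
  "teval x p = (\<Sum>m\<in>keys p. of_int (lookup p m) *
     (\<Prod>k\<in>keys m. x k ^ lookup m k))"
  by (simp add: meval_def mon_eval_def)

lemma teval_simps [simp]:
  "teval x (p + q) = teval x p + teval x q"
  "teval x (p * q) = teval x p * teval x q"
  "teval x 1 = 1"
  "teval x 0 = 0"
  using cring.meval_add[OF cring_from_type_algebra, of x p q]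
    cring.meval_mult[OF cring_from_type_algebra, of x p q]
    cring.meval_one[OF cring_from_type_algebra, of x]
  by (simp_all add: meval_def[of _ _ 0])

lemma teval_minus [simp]: "teval x (- p) = - teval x p"
  using teval_simps(1)[of x "- p" p] by (simp del: teval_simps(1) add: eq_neg_iff_add_eq_0)

lemma teval_var [simp]:
  "teval x (single (single k (Suc 0)) 1) = x k"
  using cring.meval_var[OF cring_from_type_algebra, of x k] by simp

text \<open>
  \<open>UP R\<close> represents polynomials by their coefficient functions, so \<open>coeff_map h\<close> is the map on
  polynomials induced by \<open>h\<close>. Used twice it passes to the bivariate \<open>UP (UP R)\<close>.
\<close>

definition coeff_map :: "('a::zero \<Rightarrow> 'b) \<Rightarrow> 'a poly \<Rightarrow> nat \<Rightarrow> 'b" where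
  "coeff_map h p = (\<lambda>j. h (coeff p j))"

lemma coeff_map_hom:
  fixes h :: "'a::comm_ring_1 \<Rightarrow> 'b"
  assumes R: "cring R" and h: "h \<in> Ring.ring_hom ring_of_type_algebra R"
  shows "coeff_map h \<in> Ring.ring_hom ring_of_type_algebra (UP R)"
proof -
  interpret R: cring R by fact
  interpret T: cring "ring_of_type_algebra :: 'a ring" by (rule cring_from_type_algebra)
  interpret H: ring_hom_cring "ring_of_type_algebra :: 'a ring" R h
    by (intro ring_hom_cringI) (use h R.cring_axioms T.cring_axioms in auto)
  interpret U: UP_cring R "UP R" by unfold_locales
  have h0: "h 0 = \<zero>\<^bsub>R\<^esub>" and h1: "h 1 = \<one>\<^bsub>R\<^esub>" using H.hom_zero H.hom_one by auto
  have hc: "h a \<in> carrier R" for a using H.hom_closed by auto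
  have hadd: "h (a + b) = h a \<oplus>\<^bsub>R\<^esub> h b" and hmul: "h (a * b) = h a \<otimes>\<^bsub>R\<^esub> h b" for a b
    using H.hom_add[of a b] H.hom_mult[of a b] by auto
  have hsum: "h (\<Sum>i\<in>A. f i) = (\<Oplus>\<^bsub>R\<^esub>i\<in>A. h (f i))" for f and A :: "nat set"
    using H.hom_finsum[of f A] by (simp add: comp_def)
  have cl: "coeff_map h p \<in> carrier (UP R)" for p
  proof -
    have "bound \<zero>\<^bsub>R\<^esub> (degree p) (coeff_map h p)"
      by (auto simp: bound_def coeff_map_def coeff_eq_0 h0)
    then show ?thesis by (auto simp: UP_def up_def coeff_map_def hc)
  qed
  have up: "coeff_map h p \<in> up R" for p
    using cl[of p] by (simp add: UP_def)
  have m: "(coeff_map h p \<otimes>\<^bsub>UP R\<^esub> coeff_map h q) i = coeff_map h (p * q) i" for p q i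
  proof -
    have "(coeff_map h p \<otimes>\<^bsub>UP R\<^esub> coeff_map h q) i
        = (\<Oplus>\<^bsub>R\<^esub>k\<in>{..i}. coeff_map h p k \<otimes>\<^bsub>R\<^esub> coeff_map h q (i - k))"
      using up by (simp add: UP_def)
    also have "\<dots> = (\<Oplus>\<^bsub>R\<^esub>k\<in>{..i}. h (coeff p k * coeff q (i - k)))"
      by (simp only: coeff_map_def hmul)
    also have "\<dots> = coeff_map h (p * q) i"
      by (simp only: coeff_map_def coeff_mult hsum)
    finally show ?thesis .
  qed
  have a: "(coeff_map h p \<oplus>\<^bsub>UP R\<^esub> coeff_map h q) i = coeff_map h (p + q) i" for p q i
  proof -
    have "(coeff_map h p \<oplus>\<^bsub>UP R\<^esub> coeff_map h q) i = coeff_map h p i \<oplus>\<^bsub>R\<^esub> coeff_map h q i"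
      using up by (simp add: UP_def)
    then show ?thesis by (simp only: coeff_map_def hadd coeff_add)
  qed
  show ?thesis
  proof (rule ring_hom_memI)
    show "coeff_map h \<one>\<^bsub>ring_of_type_algebra\<^esub> = \<one>\<^bsub>UP R\<^esub>"
      by (auto simp: UP_def coeff_map_def h0 h1 fun_eq_iff)
    show "coeff_map h p \<in> carrier (UP R)" for p by (rule cl)
    show "coeff_map h (p \<otimes>\<^bsub>ring_of_type_algebra\<^esub> q) = coeff_map h p \<otimes>\<^bsub>UP R\<^esub> coeff_map h q" for p q
      unfolding type_ring_simps by (rule ext) (rule m[symmetric])
    show "coeff_map h (p \<oplus>\<^bsub>ring_of_type_algebra\<^esub> q) = coeff_map h p \<oplus>\<^bsub>UP R\<^esub> coeff_map h q" for p q
      unfolding type_ring_simps by (rule ext) (rule a[symmetric])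
  qed
qed

abbreviation decoded :: "(nat \<Rightarrow> nat \<Rightarrow> 'a) \<Rightarrow> nat \<Rightarrow> 'a" where
  "decoded f \<equiv> (\<lambda>k. case prod_decode k of (i, j) \<Rightarrow> f i j)"

abbreviation mvar :: "nat \<Rightarrow> int mpoly" where "mvar k \<equiv> single (single k (Suc 0)) 1"

section \<open>Derivatives of a root and the splitting relations\<close>

definition derivation :: "('a::comm_ring_1 \<Rightarrow> 'a) \<Rightarrow> bool" where
  "derivation D \<longleftrightarrow> (\<forall>x y. D (x + y) = D x + D y \<and> D (x * y) = D x * y + x * D y)"

lemma derivationD:
  assumes "derivation D"
  shows "D (x + y) = D x + D y" "D (x * y) = D x * y + x * D y" "D 0 = 0" "D 1 = 0"
    "D (- x) = - D x" "D (x - y) = D x - D y"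
proof -
  have a: "D (x + y) = D x + D y" and m: "D (x * y) = D x * y + x * D y" for x y
    using assms by (auto simp: derivation_def)
  show "D (x + y) = D x + D y" "D (x * y) = D x * y + x * D y" by (rule a, rule m)
  show z: "D 0 = 0" using a[of 0 0] by simp
  show "D 1 = 0" using m[of 1 1] by simp
  show n: "D (- x) = - D x" for x using a[of "- x" x] z by (simp add: eq_neg_iff_add_eq_0)
  show "D (x - y) = D x - D y" using a[of x "- y"] n[of y] by simp
qed

lemma derivation_sum:
  assumes "derivation D"
  shows "D (\<Sum>i\<in>A. f i) = (\<Sum>i\<in>A. D (f i))"
  using derivationD[OF assms] by (induction A rule: infinite_finite_induct) auto

lemma derivation_of_nat [simp]:
  assumes "derivation D"
  shows "D (of_nat k) = 0"
  using derivationD[OF assms] by (induction k) auto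

lemma derivation_power:
  assumes "derivation D"
  shows "x * D (x ^ k) = of_nat k * x ^ k * D x"
proof (induction k)
  case (Suc k)
  have "x * D (x ^ Suc k) = x * (D x * x ^ k) + x * (x * D (x ^ k))"
    by (simp add: derivationD[OF assms] algebra_simps)
  also have "\<dots> = x * (D x * x ^ k) + x * (of_nat k * x ^ k * D x)" by (simp add: Suc)
  also have "\<dots> = of_nat (Suc k) * x ^ Suc k * D x" by (simp add: algebra_simps)
  finally show ?case .
qed (use derivationD[OF assms] in auto)

lemma derivation_pderiv: "derivation (pderiv :: 'a::idom poly \<Rightarrow> 'a poly)"
  by (auto simp: derivation_def pderiv_add pderiv_mult algebra_simps)

lemma derivation_map_poly:
  assumes "derivation D"
  shows "derivation (map_poly D)"
proof -
  note D = derivationD[OF assms]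
  have c: "coeff (map_poly D p) i = D (coeff p i)" for p i
    by (simp add: coeff_map_poly D)
  show ?thesis unfolding derivation_def
    by (auto simp: poly_eq_iff c D coeff_mult derivation_sum[OF assms] sum.distrib)
qed

lemma derivation_lincomb:
  assumes "derivation D" "derivation E"
  shows "derivation (\<lambda>x. a * D x - b * E x)"
  unfolding derivation_def by (auto simp: derivationD[OF assms(1)] derivationD[OF assms(2)] algebra_simps)

lemma comm_ring_hom_of_nat:
  assumes "comm_ring_hom h"
  shows "h (of_nat k) = of_nat k"
proof -
  interpret comm_ring_hom h by fact
  show ?thesis by (induction k) (auto simp: hom_add)
qed

text \<open>
  Bivariate polynomials are written with outer variable \<open>Y\<close> and inner variable \<open>Z\<close>. The derivation
  \<open>F\<^sub>Y \<partial>\<^sub>Z - F\<^sub>Z \<partial>\<^sub>Y\<close> kills \<open>F\<close>; along a root \<open>Y = \<alpha>(Z)\<close> of \<open>F\<close> it is \<open>F\<^sub>Y\<close> times \<open>d/dZ\<close>, because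
  \<open>\<alpha>' = - F\<^sub>Z / F\<^sub>Y\<close>.
\<close>

definition tangent :: "'a::idom poly poly \<Rightarrow> 'a poly poly \<Rightarrow> 'a poly poly" where
  "tangent F h = pderiv F * map_poly pderiv h - map_poly pderiv F * pderiv h"

text \<open>
  Numerators of the derivatives of a root: the recursion is the quotient rule for
  \<open>N\<^sub>m / F\<^sub>Y\<^sup>2\<^sup>m\<close>, multiplied by \<open>F\<^sub>Y\<^sup>2\<^sup>m\<^sup>+\<^sup>2\<close>.
\<close>

primrec jet :: "'a::idom poly poly \<Rightarrow> nat \<Rightarrow> 'a poly poly" where
  "jet F 0 = [:0, 1:]"
| "jet F (Suc m) = pderiv F * tangent F (jet F m) - of_nat (2 * m) * jet F m * tangent F (pderiv F)"

text \<open>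
  The formula for the derivatives of a root, in a form with two uses. With \<open>c = 0\<close> and \<open>h\<close> the
  substitution of a polynomial root it is an equation in a polynomial ring. With \<open>c\<close> the defining
  polynomial of an extension it is an equation in the residue ring modulo \<open>c\<close>.
\<close>

lemma jet_cong_iterated_derivative:
  fixes h :: "'a::idom poly poly \<Rightarrow> 'b::comm_ring_1"
  assumes h: "comm_ring_hom h"
    and D: "derivation D" and c: "c dvd D c"
    and tangent: "\<And>g. c dvd h (pderiv F) * D (h g) - h (tangent F g)"
  shows "c dvd h (jet F m) - h (pderiv F) ^ (2 * m) * (D ^^ m) (h [:0, 1:])"
proof (induction m)
  case 0
  show ?case by simp
next
  case (Suc m)
  interpret h: comm_ring_hom h by fact
  note D' = derivationD[OF D]
  define f where "f = h (pderiv F)"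
  define y where "y = (D ^^ m) (h [:0, 1:])"
  define N where "N = h (jet F m)"
  obtain u where u: "N - f ^ (2 * m) * y = c * u" using Suc by (auto simp: f_def y_def N_def)
  obtain w where w: "D c = c * w" using c by auto
  obtain v1 where "f * D N - h (tangent F (jet F m)) = c * v1" using tangent by (auto simp: f_def N_def)
  then have v1: "h (tangent F (jet F m)) = f * D N - c * v1" by (simp add: algebra_simps)
  obtain v2 where "f * D f - h (tangent F (pderiv F)) = c * v2" using tangent by (auto simp: f_def)
  then have v2: "h (tangent F (pderiv F)) = f * D f - c * v2" by (simp add: algebra_simps)
  have N: "N = f ^ (2 * m) * y + c * u" using u by (simp add: algebra_simps)
  have DN: "f * D N = of_nat (2 * m) * f ^ (2 * m) * D f * y + f * f ^ (2 * m) * D y + f * (c * w * u + c * D u)"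
  proof -
    have "f * D N = (f * D (f ^ (2 * m))) * y + f * f ^ (2 * m) * D y + f * (c * w * u + c * D u)"
      unfolding N by (simp add: D' w algebra_simps)
    then show ?thesis by (simp add: derivation_power[OF D])
  qed
  have "h (jet F (Suc m)) = f * (f * D N - c * v1) - of_nat (2 * m) * N * (f * D f - c * v2)"
    by (simp add: h.hom_minus h.hom_mult v1 v2 N_def f_def[symmetric] comm_ring_hom_of_nat[OF h] del: of_nat_mult)
  also have "\<dots> = f ^ (2 * Suc m) * D y + c * (f * f * (w * u + D u) - f * v1
       - of_nat (2 * m) * u * f * D f + of_nat (2 * m) * N * v2)"
    unfolding DN by (simp add: N algebra_simps)
  finally have "h (jet F (Suc m)) - f ^ (2 * Suc m) * D y = c * (f * f * (w * u + D u) - f * v1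
       - of_nat (2 * m) * u * f * D f + of_nat (2 * m) * N * v2)" by (simp add: algebra_simps)
  then have "c dvd h (jet F (Suc m)) - f ^ (2 * Suc m) * D y" by (rule dvdI)
  then show ?case by (simp add: f_def y_def)
qed

lemma pderiv_poly_eval:
  fixes g :: "'a::idom poly poly"
  shows "pderiv (poly g Q) = poly (map_poly pderiv g) Q + poly (pderiv g) Q * pderiv Q"
  by (induction g) (auto simp: map_poly_pCons pderiv_add pderiv_mult pderiv_pCons algebra_simps)

text \<open>
  A polynomial root of degree at most \<open>m\<close> has no derivative of order \<open>m + 1\<close>. There is no division by
  \<open>F\<^sub>Y\<close>, so the root may be a multiple one.
\<close>

lemma poly_jet_root_eq_0:
  fixes F :: "'a::{idom,ring_char_0} poly poly"
  assumes "poly F Q = 0" and "degree Q \<le> m"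
  shows "poly (jet F (Suc m)) Q = 0"
proof -
  have hom: "comm_ring_hom (\<lambda>g. poly g Q)" by unfold_locales auto
  have F: "poly (map_poly pderiv F) Q = - (poly (pderiv F) Q * pderiv Q)"
    using pderiv_poly_eval[of F Q] assms(1) by (simp add: eq_neg_iff_add_eq_0)
  have "0 dvd poly (jet F (Suc m)) Q - poly (pderiv F) Q ^ (2 * Suc m) * (pderiv ^^ Suc m) (poly [:0, 1:] Q)"
  proof (rule jet_cong_iterated_derivative[OF hom derivation_pderiv])
    show "0 dvd poly (pderiv F) Q * pderiv (poly g Q) - poly (tangent F g) Q" for g
      by (simp add: tangent_def pderiv_poly_eval[of g] F algebra_simps)
  qed simp
  moreover have "(pderiv ^^ Suc m) Q = 0"
  proof -
    have "degree ((pderiv ^^ m) Q) = 0" using assms(2) by (simp add: degree_higher_pderiv)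
    then show ?thesis by (simp add: pderiv_eq_0_iff)
  qed
  ultimately show ?thesis by simp
qed

lemma jet_map_poly:
  assumes "idom_hom h"
  shows "map_poly (map_poly h) (jet F m) = jet (map_poly (map_poly h) F) m"
proof -
  interpret h: idom_hom h by fact
  interpret p: map_poly_idom_hom h ..
  interpret pp: map_poly_idom_hom "map_poly h" ..
  have z: "map_poly (map_poly h) (map_poly pderiv g) = map_poly pderiv (map_poly (map_poly h) g)" for g
    by (auto simp: poly_eq_iff coeff_map_poly coeff_pderiv h.hom_mult h.hom_add
        comm_ring_hom_of_nat[OF h.comm_ring_hom_axioms])
  have t: "map_poly (map_poly h) (tangent F g) = tangent (map_poly (map_poly h) F) (map_poly (map_poly h) g)" for F g
    by (simp add: tangent_def pp.hom_minus pp.hom_mult z p.map_poly_pderiv)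
  show ?thesis
    by (induction m) (simp_all add: pp.hom_minus pp.hom_mult t p.map_poly_pderiv
       comm_ring_hom_of_nat[OF pp.comm_ring_hom_axioms] del: of_nat_mult)
qed

text \<open>
  The monic polynomial of degree \<open>d\<close> in \<open>Y\<close> whose other coefficients have degree at most \<open>K\<close> in \<open>Z\<close> and
  are otherwise indeterminate: the variable coded by \<open>(i, j)\<close> is the coefficient of \<open>Y\<^sup>i Z\<^sup>j\<close>.
\<close>

definition generic_poly :: "nat \<Rightarrow> nat \<Rightarrow> int mpoly poly poly" where
  "generic_poly d K = Polynomial.monom 1 d + (\<Sum>i<d. Polynomial.monom
     (\<Sum>j\<le>K. Polynomial.monom (mvar (prod_encode (i, j))) j) i)"

text \<open>
  The coefficient of \<open>Y\<^sup>a Z\<^sup>b\<close> in the remainder of the \<open>d\<close>-th power of the jet. Pseudo-division by a monic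
  polynomial is division with remainder. A product of \<open>d\<close> factors \<open>Y - Q\<^sub>j(Z)\<close> with \<open>Q\<^sub>j\<close> of degree at most
  \<open>D\<close> has coefficients of degree up to \<open>d * D\<close> in \<open>Z\<close>, which is why \<open>K = d * D\<close>.
\<close>

definition splitting_relation :: "nat \<Rightarrow> nat \<Rightarrow> nat \<Rightarrow> nat \<Rightarrow> int mpoly" where
  "splitting_relation d D a b = coeff (coeff
     (snd (pseudo_divmod (jet (generic_poly d (d * D)) (Suc D) ^ d) (generic_poly d (d * D)))) a) b"

lemma coeff_generic_poly:
  "coeff (generic_poly d K) i =
     (if i < d then (\<Sum>j\<le>K. Polynomial.monom (mvar (prod_encode (i, j))) j)
      else if i = d then 1 else 0)"
  unfolding generic_poly_def coeff_add coeff_sum coeff_monom by (subst sum.delta) auto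

lemma generic_poly_monic:
  "degree (generic_poly d K) = d" "coeff (generic_poly d K) d = 1"
proof -
  show "coeff (generic_poly d K) d = 1" by (simp add: coeff_generic_poly)
  then show "degree (generic_poly d K) = d"
    by (intro antisym[OF degree_le le_degree]) (auto simp: coeff_generic_poly)
qed

lemma jet_power_eq_generic:
  obtains B R where "jet (generic_poly d (d * D)) (Suc D) ^ d = generic_poly d (d * D) * B + R"
    "R = 0 \<or> degree R < d"
    "\<And>a b. coeff (coeff R a) b = splitting_relation d D a b"
proof -
  let ?F = "generic_poly d (d * D)" and ?J = "jet (generic_poly d (d * D)) (Suc D) ^ d"
  obtain B R where BR: "pseudo_divmod ?J ?F = (B, R)" by (rule prod.exhaust)
  have nz: "?F \<noteq> 0" using generic_poly_monic(2)[of d "d * D"] by (metis coeff_0 zero_neq_one)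
  show ?thesis
  proof (rule that[of B R])
    show "?J = ?F * B + R"
      using pseudo_divmod(1)[OF nz BR] by (simp only: generic_poly_monic power_one smult_1_left)
    show "R = 0 \<or> degree R < d"
      using pseudo_divmod(2)[OF nz BR] by (simp only: generic_poly_monic)
    show "coeff (coeff R a) b = splitting_relation d D a b" for a b
      by (simp only: splitting_relation_def BR snd_conv)
  qed
qed

lemma idom_hom_teval: "idom_hom (teval (x :: nat \<Rightarrow> 'a::idom))"
  by unfold_locales simp_all

text \<open>
  The product divides the \<open>d\<close>-th power of its jet, because each of its \<open>d\<close> linear factors divides the
  jet. So the remainder, which has degree below \<open>d\<close> in \<open>Y\<close>, is zero. The power makes the argument
  work when some of the roots coincide.
\<close>

lemma splitting_relation_product:
  fixes Q :: "nat \<Rightarrow> int mpoly poly"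
  assumes Q: "\<And>j. j < d \<Longrightarrow> degree (Q j) \<le> D"
  defines "P \<equiv> \<Prod>j<d. [:- Q j, 1:]"
  shows "teval (decoded (\<lambda>i j. coeff (coeff P i) j))
           (splitting_relation d D a b) = 0"
proof -
  define h where "h = teval (decoded (\<lambda>i j. coeff (coeff P i) j))"
  interpret h: idom_hom h unfolding h_def by (rule idom_hom_teval)
  interpret p: map_poly_idom_hom h ..
  interpret pp: map_poly_idom_hom "map_poly h" ..
  obtain B R where BR: "jet (generic_poly d (d * D)) (Suc D) ^ d = generic_poly d (d * D) * B + R"
    "R = 0 \<or> degree R < d"
    "\<And>a b. coeff (coeff R a) b = splitting_relation d D a b"
    using jet_power_eq_generic[of d D] by metis
  have hvar: "h (mvar (prod_encode (i, j)))
      = coeff (coeff P i) j" for i j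
    unfolding h_def teval_var by simp
  have degP: "degree P = d"
    unfolding P_def by (subst degree_prod_eq_sum_degree) auto
  have lcP: "coeff P d = 1"
    using lead_coeff_prod[of "\<lambda>j. [:- Q j, 1:]" "{..<d}"] degP by (simp add: P_def)
  have cP: "degree (coeff P i) \<le> d * D" for i
  proof -
    have "e \<le> d \<Longrightarrow> degree (coeff (\<Prod>j<e. [:- Q j, 1:]) i) \<le> e * D" for e
    proof (induction e arbitrary: i)
      case (Suc e)
      have "degree (Q e * coeff (\<Prod>j<e. [:- Q j, 1:]) i) \<le> D + e * D" for i
        using Q[of e] Suc by (intro order_trans[OF degree_mult_le] add_mono) auto
      moreover have "degree (coeff (\<Prod>j<e. [:- Q j, 1:]) i) \<le> D + e * D" for i
        using Suc.IH[of i] Suc.prems by simp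
      moreover have "(\<Prod>j<Suc e. [:- Q j, 1:]) = pCons 0 (\<Prod>j<e. [:- Q j, 1:])
          - smult (Q e) (\<Prod>j<e. [:- Q j, 1:])" by simp
      ultimately show ?case
        by (simp only: coeff_diff coeff_smult) (cases i; simp add: degree_diff_le)
    qed (simp add: coeff_1)
    then show ?thesis unfolding P_def by simp
  qed
  have F: "map_poly (map_poly h) (generic_poly d (d * D)) = P"
  proof (rule poly_eqI)
    fix i
    show "coeff (map_poly (map_poly h) (generic_poly d (d * D))) i = coeff P i"
    proof (cases "i < d")
      case True
      have "map_poly h (\<Sum>j\<le>d * D. Polynomial.monom
          (mvar (prod_encode (i, j))) j)
          = (\<Sum>j\<le>d * D. Polynomial.monom (coeff (coeff P i) j) j)"
        by (simp add: p.hom_sum map_poly_monom hvar)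
      also have "\<dots> = coeff P i" using cP[of i] by (rule poly_as_sum_of_monoms')
      finally show ?thesis using True by (simp add: coeff_map_poly coeff_generic_poly)
    next
      case False
      then show ?thesis using degP lcP by (auto simp: coeff_map_poly coeff_generic_poly coeff_eq_0)
    qed
  qed
  have J: "map_poly (map_poly h) (jet (generic_poly d (d * D)) (Suc D)) = jet P (Suc D)"
    by (simp only: jet_map_poly[OF h.idom_hom_axioms] F)
  have eq: "jet P (Suc D) ^ d = P * map_poly (map_poly h) B + map_poly (map_poly h) R"
    using arg_cong[OF BR(1), of "map_poly (map_poly h)"]
    by (simp only: pp.hom_add pp.hom_mult pp.hom_power F J)
  have "(\<Prod>j<d. [:- Q j, 1:]) dvd (\<Prod>j<d. jet P (Suc D))"
  proof (rule prod_dvd_prod)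
    fix j assume j: "j \<in> {..<d}"
    have "poly P (Q j) = 0" using j by (auto simp: P_def poly_prod)
    then have "poly (jet P (Suc D)) (Q j) = 0" using Q[of j] j by (intro poly_jet_root_eq_0) auto
    then show "[:- Q j, 1:] dvd jet P (Suc D)" by (simp only: poly_eq_0_iff_dvd)
  qed
  then have "P dvd jet P (Suc D) ^ d" by (simp only: P_def[symmetric] prod_constant card_lessThan)
  then have dvd: "P dvd map_poly (map_poly h) R"
    using eq by (metis dvd_add_right_iff dvd_triv_left)
  have "map_poly (map_poly h) R = 0"
  proof (rule ccontr)
    assume nz: "map_poly (map_poly h) R \<noteq> 0"
    then have "d \<le> degree (map_poly (map_poly h) R)"
      using dvd_imp_degree_le[OF dvd] degP by simp
    moreover have "degree (map_poly (map_poly h) R) \<le> degree R" by (rule degree_map_poly_le)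
    moreover have "R \<noteq> 0" using nz by auto
    ultimately show False using BR(2) by auto
  qed
  then have "coeff (coeff (map_poly (map_poly h) R) a) b = 0" by simp
  then have "h (splitting_relation d D a b) = 0"
    by (simp only: coeff_map_poly[of h, OF h.hom_zero] coeff_map_poly[of "map_poly h", OF p.hom_zero] BR(3))
  then show ?thesis by (simp only: h_def)
qed

section \<open>Extending a derivation to a simple field extension\<close>

lemma derivation_divide_of_nat:
  fixes a :: "'a::field_char_0"
  assumes "derivation D" "n \<noteq> 0"
  shows "D (a / of_nat n) = D a / of_nat n"
  using derivationD(2)[OF assms(1), of "a / of_nat n" "of_nat n"] assms(2)
  by (simp add: derivation_of_nat[OF assms(1)])

text \<open>
  The field of rational functions in \<open>X\<^sub>1, \<dots>, X\<^sub>n\<close> is a subset of the type of fractions in all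
  variables. Polynomials over it are therefore treated as elements of a polynomial type with
  coefficients in a subset \<open>K\<close>, and \<open>pK\<close> below is the set of these polynomials.
\<close>

locale subfield_with_derivation =
  fixes K :: "'e::field_char_0 set" and D :: "'e \<Rightarrow> 'e"
  assumes one_mem: "1 \<in> K"
    and diff_mem: "\<And>a b. a \<in> K \<Longrightarrow> b \<in> K \<Longrightarrow> a - b \<in> K"
    and mult_mem: "\<And>a b. a \<in> K \<Longrightarrow> b \<in> K \<Longrightarrow> a * b \<in> K"
    and inverse_mem: "\<And>a. a \<in> K \<Longrightarrow> inverse a \<in> K"
    and D: "derivation D" and D_mem: "\<And>a. a \<in> K \<Longrightarrow> D a \<in> K"
begin

lemma zero_mem: "0 \<in> K" using diff_mem[OF one_mem one_mem] by simp
lemma uminus_mem: "a \<in> K \<Longrightarrow> - a \<in> K" using diff_mem[OF zero_mem] by simp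
lemma add_mem: "a \<in> K \<Longrightarrow> b \<in> K \<Longrightarrow> a + b \<in> K" using diff_mem[of a "- b"] uminus_mem[of b] by simp
lemma divide_mem: "a \<in> K \<Longrightarrow> b \<in> K \<Longrightarrow> a / b \<in> K" by (simp add: divide_inverse mult_mem inverse_mem)
lemma sum_mem: "(\<And>i. i \<in> A \<Longrightarrow> g i \<in> K) \<Longrightarrow> sum g A \<in> K"
  by (induction A rule: infinite_finite_induct) (auto simp: zero_mem add_mem)
lemma prod_mem: "(\<And>i. i \<in> A \<Longrightarrow> g i \<in> K) \<Longrightarrow> prod g A \<in> K"
  by (induction A rule: infinite_finite_induct) (auto simp: one_mem mult_mem)
lemma power_mem: "a \<in> K \<Longrightarrow> a ^ n \<in> K"
  by (induction n) (auto simp: one_mem mult_mem)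
lemma of_nat_mem: "of_nat n \<in> K" by (induction n) (auto simp: zero_mem one_mem add_mem)
lemmas K_mem = zero_mem one_mem uminus_mem diff_mem add_mem mult_mem divide_mem sum_mem prod_mem
  power_mem of_nat_mem D_mem inverse_mem

lemma det_mem:
  assumes "\<And>i j. i < n \<Longrightarrow> j < n \<Longrightarrow> B $$ (i, j) \<in> K" "B \<in> carrier_mat n n"
  shows "det B \<in> K"
proof -
  have "signof p \<in> K" for p :: "nat \<Rightarrow> nat" by (auto simp: sign_def K_mem)
  moreover have "p i < n" if "p permutes {0..<n}" "i < n" for p i
    using permutes_in_image[OF that(1), of i] that(2) by simp
  ultimately show ?thesis
    using assms(2) by (auto simp: det_def intro!: K_mem assms(1))
qed

definition pK :: "'e poly set" where "pK = {p. \<forall>i. coeff p i \<in> K}"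

lemma pKI: "(\<And>i. coeff p i \<in> K) \<Longrightarrow> p \<in> pK" by (simp add: pK_def)
lemma pKD: "p \<in> pK \<Longrightarrow> coeff p i \<in> K" by (simp add: pK_def)

lemma pK_mem:
  "0 \<in> pK" "1 \<in> pK" "p \<in> pK \<Longrightarrow> q \<in> pK \<Longrightarrow> p + q \<in> pK" "p \<in> pK \<Longrightarrow> - p \<in> pK"
  "p \<in> pK \<Longrightarrow> q \<in> pK \<Longrightarrow> p - q \<in> pK" "p \<in> pK \<Longrightarrow> q \<in> pK \<Longrightarrow> p * q \<in> pK"
  "a \<in> K \<Longrightarrow> p \<in> pK \<Longrightarrow> smult a p \<in> pK" "a \<in> K \<Longrightarrow> Polynomial.monom a n \<in> pK"
  "p \<in> pK \<Longrightarrow> pderiv p \<in> pK" "p \<in> pK \<Longrightarrow> map_poly D p \<in> pK"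
  by (auto simp: pK_def K_mem coeff_mult coeff_pderiv coeff_map_poly derivationD[OF D] coeff_1
      simp del: of_nat_Suc)

lemma pK_sum: "(\<And>i. i \<in> A \<Longrightarrow> g i \<in> pK) \<Longrightarrow> sum g A \<in> pK"
  by (induction A rule: infinite_finite_induct) (auto simp: pK_mem)
lemma pK_power: "p \<in> pK \<Longrightarrow> p ^ n \<in> pK"
  by (induction n) (auto simp: pK_mem)
lemma pK_pcompose: "p \<in> pK \<Longrightarrow> q \<in> pK \<Longrightarrow> pcompose p q \<in> pK"
  unfolding pcompose_altdef poly_altdef
  by (intro pK_sum pK_mem pK_power pKI) (auto simp: coeff_map_poly coeff_pCons K_mem pKD split: nat.splits)

lemma pK_div_mod:
  assumes g: "g \<in> pK" "g \<noteq> 0" and p: "p \<in> pK"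
  shows "p div g \<in> pK" "p mod g \<in> pK"
proof -
  have "\<exists>q\<in>pK. \<exists>r\<in>pK. p = q * g + r \<and> (r = 0 \<or> degree r < degree g)"
    using p
  proof (induction "degree p" arbitrary: p rule: less_induct)
    case less
    show ?case
    proof (cases "p = 0 \<or> degree p < degree g")
      case True
      then show ?thesis using less(2) pK_mem(1) by (intro bexI[of _ 0] bexI[of _ p]) auto
    next
      case False
      define s where "s = Polynomial.monom (lead_coeff p / lead_coeff g)
        (degree p - degree g)"
      have s: "s \<in> pK" using g(1) less(2) by (auto simp: s_def intro!: pK_mem K_mem pKD)
      have a0: "lead_coeff p / lead_coeff g \<noteq> 0" using False g(2) by simp
      have ds0: "degree s = degree p - degree g"
        unfolding s_def using a0 by (rule degree_monom_eq)
      have "s \<noteq> 0" unfolding s_def using a0 by (metis monom_eq_0_iff)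
      then have ds: "degree (s * g) = degree p"
        using False g(2) ds0 degree_mult_eq[of s g] by linarith
      have lc: "lead_coeff (s * g) = lead_coeff p"
      proof -
        have "lead_coeff s = lead_coeff p / lead_coeff g"
          by (subst ds0) (simp add: s_def)
        then show ?thesis using g(2) by (simp only: lead_coeff_mult) simp
      qed
      show ?thesis
      proof (cases "p - s * g = 0")
        case True
        then show ?thesis using s pK_mem(1) by (intro bexI[of _ s] bexI[of _ 0]) auto
      next
        case nz: False
        show ?thesis
        proof (cases "degree p = 0")
          case True
          then have "degree (p - s * g) = 0" using degree_diff_le[of p 0 "s * g"] ds by simp
          moreover have "coeff (p - s * g) 0 = 0" using lc ds True by simp
          ultimately show ?thesis using nz by (metis leading_coeff_0_iff)
        next
          case False
          have "degree (p - s * g) < degree p"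
          proof (rule le_neq_implies_less)
            show "degree (p - s * g) \<le> degree p" using ds by (simp add: degree_diff_le)
            show "degree (p - s * g) \<noteq> degree p"
              using nz lc ds by (metis coeff_diff diff_self leading_coeff_0_iff)
          qed
          from less(1)[OF this] obtain q r where "q \<in> pK" "r \<in> pK" "p - s * g = q * g + r"
            "r = 0 \<or> degree r < degree g"
            using pK_mem s g(1) less(2) by metis
          then show ?thesis using s by (intro bexI[of _ "q + s"] bexI[of _ r]) (auto simp: algebra_simps pK_mem)
        qed
      qed
    qed
  qed
  then obtain q r where qr: "q \<in> pK" "r \<in> pK" "p = q * g + r"
    "r = 0 \<or> degree r < degree g" by blast
  have "r div g = 0" "r mod g = r" using qr(4) by (auto simp: div_poly_less mod_poly_less)
  then have "p div g = q" "p mod g = r" using g(2) by (simp_all add: qr(3) div_mult_self3)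
  then show "p div g \<in> pK" "p mod g \<in> pK" using qr by auto
qed

end

lemma poly_map_poly_linear:
  fixes L :: "'a::comm_ring_1 poly \<Rightarrow> 'a"
  assumes "\<And>p q. L (p + q) = L p + L q" "\<And>c p. L (smult c p) = c * L p"
  shows "poly (map_poly L q) t = L (poly q [:t:])"
proof -
  have "L 0 = 0" using assms(2)[of 0 0] by simp
  then show ?thesis by (induction q) (auto simp: map_poly_pCons assms)
qed

lemma (in subfield_with_derivation) adj_mat_mem:
  assumes B: "B \<in> carrier_mat n n" "\<And>i j. i < n \<Longrightarrow> j < n \<Longrightarrow> B $$ (i, j) \<in> K" and ij: "i < n" "j < n"
  shows "adj_mat B $$ (i, j) \<in> K"
proof -
  have "mat_delete B j i \<in> carrier_mat (n - 1) (n - 1)" using mat_delete_carrier[OF B(1)] .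
  moreover have "mat_delete B j i $$ (a, b) \<in> K" if "a < n - 1" "b < n - 1" for a b
    using that ij B by (auto simp: mat_delete_def intro!: B(2))
  ultimately have "det (mat_delete B j i) \<in> K" by (intro det_mem[of "n - 1"])
  then show ?thesis using B(1) ij by (simp add: adj_mat_def cofactor_def K_mem)
qed

text \<open>
  The extension \<open>K[Y]/(f)\<close> for an irreducible \<open>f\<close>. Irreducibility enters as invertibility modulo \<open>f\<close>
  over \<open>K\<close>: over the ambient field \<open>f\<close> need not be irreducible. All computations in the
  extension are congruences modulo \<open>f\<close>. The element \<open>x\<close> is the variable of differentiation.
\<close>

locale poly_mod_derivation = subfield_with_derivation K D
  for K :: "'e::field_char_0 set" and D :: "'e \<Rightarrow> 'e" +
  fixes f :: "'e poly" and x :: 'e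
  assumes f_mem: "f \<in> pK" and f_monic: "lead_coeff f = 1"
    and f_irr: "\<And>g. g \<in> pK \<Longrightarrow> \<not> f dvd g \<Longrightarrow> \<exists>u\<in>pK. f dvd u * g - 1"
    and f_deg: "degree f > 0"
    and x_mem: "x \<in> K" and D_x: "D x = 1"
begin

lemma f_nz: "f \<noteq> 0" using f_deg by auto

lemma f_dvd_power:
  assumes "g \<in> pK" "f dvd g ^ k"
  shows "f dvd g"
proof (rule ccontr)
  assume "\<not> f dvd g"
  then obtain u where u: "u \<in> pK" "f dvd u * g - 1" using f_irr assms(1) by blast
  have "u * g - 1 dvd (u * g) ^ k - 1 ^ k" unfolding power_diff_sumr2[of "u * g" k 1] by (rule dvd_triv_left)
  then have "f dvd (u * g) ^ k - 1" using u(2) by (metis dvd_trans power_one)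
  moreover have "f dvd (u * g) ^ k" using assms(2) by (simp add: power_mult_distrib)
  ultimately have "f dvd 1" by (metis dvd_diff_right_iff)
  then show False using f_deg by (metis degree_1 dvd_imp_degree_le leD one_neq_zero)
qed

text \<open>
  An inverse of \<open>f'\<close> modulo \<open>f\<close>. It exists because \<open>f\<close> is irreducible and the characteristic is zero.
\<close>

definition U :: "'e poly" where "U = (SOME u. u \<in> pK \<and> f dvd u * pderiv f - 1)"

lemma U: "U \<in> pK" "f dvd U * pderiv f - 1"
proof -
  have "\<not> f dvd pderiv f"
    using f_deg not_dvd_pderiv by blast
  then have "\<exists>u. u \<in> pK \<and> f dvd u * pderiv f - 1" using f_irr[OF pK_mem(9)[OF f_mem]] by blast
  then show "U \<in> pK" "f dvd U * pderiv f - 1" unfolding U_def using someI_ex[of "\<lambda>u. u \<in> pK \<and> f dvd u * pderiv f - 1"] by simp_all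
qed

text \<open>
  The extension of \<open>D\<close> to \<open>K[Y]/(f)\<close>: on the class of \<open>Y\<close> it takes the value \<open>- f\<^sup>D / f'\<close> that is
  forced by differentiating \<open>f(Y) = 0\<close>, where \<open>f\<^sup>D\<close> has the coefficients of \<open>f\<close> differentiated.
\<close>

definition DD :: "'e poly \<Rightarrow> 'e poly" where
  "DD h = map_poly D h - U * map_poly D f * pderiv h"

lemma DD: "derivation DD"
  using derivation_lincomb[OF derivation_map_poly[OF D] derivation_pderiv, of 1 "U * map_poly D f"]
  by (simp add: DD_def[abs_def])

lemma DD_mem: "h \<in> pK \<Longrightarrow> DD h \<in> pK"
  by (simp add: DD_def pK_mem U f_mem)

lemma DD_iter_mem: "h \<in> pK \<Longrightarrow> (DD ^^ k) h \<in> pK"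
  by (induction k) (auto simp: DD_mem)

lemma f_dvd_DD_f: "f dvd DD f"
proof -
  have "DD f = - (map_poly D f * (U * pderiv f - 1))" by (simp add: DD_def algebra_simps)
  then show ?thesis using U(2) by simp
qed

lemma f_dvd_DD: assumes "f dvd h" shows "f dvd DD h"
proof -
  obtain g where g: "h = f * g" using assms by auto
  show ?thesis unfolding g derivationD(2)[OF DD] using f_dvd_DD_f by simp
qed

lemma DD_const: "DD [:c:] = [:D c:]"
  by (intro poly_eqI) (simp add: DD_def coeff_map_poly derivationD[OF D] coeff_pCons split: nat.split)

lemma DD_smult: "DD (smult c p) = smult (D c) p + smult c (DD p)"
  using derivationD(2)[OF DD, of "[:c:]" p] by (simp add: DD_const)

lemma f_dvd_tangent: "f dvd pderiv f * DD h - (pderiv f * map_poly D h - map_poly D f * pderiv h)"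
proof -
  have "pderiv f * DD h - (pderiv f * map_poly D h - map_poly D f * pderiv h)
     = - (map_poly D f * pderiv h * (U * pderiv f - 1))" by (simp add: DD_def algebra_simps)
  then show ?thesis using U(2) by simp
qed

lemma DD_pcompose:
  "DD (pcompose g A) = pcompose (map_poly D g) A + pcompose (pderiv g) A * DD A"
  by (induction g) (auto simp: derivationD[OF DD] derivationD[OF D] map_poly_pCons pcompose_pCons
      DD_const pderiv_pCons pcompose_add algebra_simps)

lemma mod_f_linear:
  "(p + q) mod f = p mod f + q mod f" "(smult c p) mod f = smult c (p mod f)"
  by (rule poly_mod_add_left, rule mod_smult_left)

text \<open>
  If \<open>\<alpha>\<close> is a polynomial in \<open>x\<close> of degree at most \<open>m\<close> with constant coefficients, then this is its value
  at \<open>t\<close> in place of \<open>x\<close>.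
\<close>

definition taylor :: "nat \<Rightarrow> 'e \<Rightarrow> 'e poly" where
  "taylor m t = (\<Sum>k\<le>m. smult ((t - x) ^ k / fact k) ((DD ^^ k) [:0, 1:]))"

lemma taylor_mem: "t \<in> K \<Longrightarrow> taylor m t \<in> pK"
proof -
  have "[:0, 1:] \<in> pK" by (rule pKI) (auto simp: coeff_pCons K_mem split: nat.splits)
  moreover have "fact k \<in> K" for k using of_nat_mem[of "fact k"] by simp
  ultimately show "t \<in> K \<Longrightarrow> taylor m t \<in> pK" unfolding taylor_def
    by (intro pK_sum pK_mem(7) DD_iter_mem K_mem x_mem) auto
qed

text \<open>
  The sum telescopes under differentiation, and only its last term survives. If the derivative of order
  \<open>m + 1\<close> vanishes, then \<open>taylor m t\<close> is a constant of the derivation.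
\<close>

lemma DD_taylor:
  assumes "D t = 0"
  shows "DD (taylor m t) = smult ((t - x) ^ m / fact m) ((DD ^^ Suc m) [:0, 1:])"
proof (induction m)
  case 0
  show ?case by (simp add: taylor_def)
next
  case (Suc m)
  have Dt: "D (t - x) = - 1" using assms D_x derivationD[OF D] by simp
  have Dp: "D ((t - x) ^ Suc k) = - (of_nat (Suc k) * (t - x) ^ k)" for k
  proof (induction k)
    case 0
    show ?case by (simp add: Dt)
  next
    case (Suc k)
    have "D ((t - x) ^ Suc (Suc k)) = D (t - x) * (t - x) ^ Suc k + (t - x) * D ((t - x) ^ Suc k)"
      by (simp only: power_Suc[of _ "Suc k"] derivationD(2)[OF D])
    then show ?case unfolding Dt Suc by (simp add: algebra_simps)
  qed
  have "(fact (Suc m) :: 'e) = of_nat (Suc m) * fact m" by simp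
  moreover have "D ((t - x) ^ Suc m / fact (Suc m)) = D ((t - x) ^ Suc m) / fact (Suc m)"
    using derivation_divide_of_nat[OF D, of "fact (Suc m)" "(t - x) ^ Suc m"]
    by (simp only: of_nat_fact fact_nonzero not_False_eq_True)
  ultimately have Dc: "D ((t - x) ^ Suc m / fact (Suc m)) = - ((t - x) ^ m / fact m)"
    unfolding Dp by (simp del: of_nat_Suc power_Suc fact_Suc)
  have "taylor (Suc m) t = taylor m t + smult ((t - x) ^ Suc m / fact (Suc m)) ((DD ^^ Suc m) [:0, 1:])"
    by (simp add: taylor_def)
  then have "DD (taylor (Suc m) t) = DD (taylor m t) + DD (smult ((t - x) ^ Suc m / fact (Suc m)) ((DD ^^ Suc m) [:0, 1:]))"
    by (simp only: derivationD(1)[OF DD])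
  also have "\<dots> = smult ((t - x) ^ Suc m / fact (Suc m)) (DD ((DD ^^ Suc m) [:0, 1:]))"
    unfolding Suc DD_smult Dc by (simp only: smult_minus_left add.left_inverse add.assoc[symmetric] right_minus_eq add.right_inverse add_0_left)
  finally show ?case by simp
qed

text \<open>
  The matrix \<open>V\<close> has the coordinates of the powers of \<open>A\<close> in the basis of powers of \<open>Y\<close>, so a nonzero
  determinant says that \<open>A\<close> generates the extension. With \<open>t\<close> as an indeterminate, the determinant for
  \<open>taylor m t\<close> is a polynomial in \<open>t\<close>. It is not zero, because at \<open>t = x\<close> the Taylor sum is \<open>Y\<close>
  itself and the matrix is the identity. So some integer \<open>t\<close>, a constant of the derivation, gives
  a nonzero value.
\<close>

lemma exists_generator:
  assumes dvd: "f dvd (DD ^^ Suc m) [:0, 1:]"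
  obtains A V where "A \<in> pK" "f dvd DD A"
    "V = mat (degree f) (degree f) (\<lambda>(i, j). coeff (A ^ i mod f) j)"
    "det V \<noteq> 0"
proof -
  let ?d = "degree f"
  \<comment> \<open>The Taylor sum with an indeterminate in place of t; the outer variable is t.\<close>
  define b :: "'e poly poly" where
    "b = (\<Sum>k\<le>m. [:smult (1 / fact k) ((DD ^^ k) [:0, 1:]):] * [:[:- x:], 1:] ^ k)"
  define L where "L j p = coeff (p mod f) j" for j p
  have L: "L j (p + q) = L j p + L j q" "L j (smult c p) = c * L j p" for j p q c
    by (simp_all add: L_def mod_f_linear)
  have Lp: "poly (map_poly (L j) q) t = L j (poly q [:t:])" for j q t
    by (rule poly_map_poly_linear) (simp_all add: L)
  have b: "poly b [:t:] = taylor m t" for t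
  proof -
    have "poly [:[:- x:], 1:] [:t:] ^ k = [:(t - x) ^ k:]" for k
      by (simp add: poly_const_pow)
    then show ?thesis by (simp add: b_def taylor_def poly_sum poly_power)
  qed
  \<comment> \<open>The matrix for the indeterminate t.\<close>
  define W where "W = mat ?d ?d (\<lambda>(i, j). map_poly (L j) (b ^ i))"
  have W: "map_mat (\<lambda>p. poly p t) W = mat ?d ?d (\<lambda>(i, j). L j (taylor m t ^ i))" for t
    by (rule eq_matI) (simp_all add: W_def Lp b)
  have hom: "comm_ring_hom (\<lambda>p. poly p t)" for t :: 'e by unfold_locales auto
  have det: "det (mat ?d ?d (\<lambda>(i, j). L j (taylor m t ^ i))) = poly (det W) t" for t
    using comm_ring_hom.hom_det[OF hom, of t W] unfolding W .
  have "taylor m x = [:0, 1:]"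
  proof -
    have "taylor m x = (\<Sum>k\<le>m. if k = 0 then [:0, 1:] else 0)"
      unfolding taylor_def by (rule sum.cong) auto
    then show ?thesis by simp
  qed
  moreover have "L j ([:0, 1:] ^ i) = (if i = j then 1 else 0)" if "i < ?d" for i j
  proof -
    have "[:0, 1:] ^ i mod f = [:0, 1:] ^ i" using that by (intro mod_poly_less) (simp add: degree_power_eq)
    moreover have "[:0, 1:] ^ i = Polynomial.monom (1::'e) i" by (simp add: monom_altdef)
    ultimately show ?thesis by (simp add: L_def)
  qed
  ultimately have "mat ?d ?d (\<lambda>(i, j). L j (taylor m x ^ i)) = 1\<^sub>m ?d"
    by (intro eq_matI) auto
  then have "poly (det W) x = 1" using det[of x] by simp
  then have "det W \<noteq> 0" by auto
  then have "finite {t. poly (det W) t = 0}" by (rule poly_roots_finite)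
  moreover have "infinite (range (of_nat :: nat \<Rightarrow> 'e))" by (rule range_inj_infinite) (simp add: inj_def)
  ultimately obtain N where N: "poly (det W) (of_nat N) \<noteq> 0"
    by (metis (mono_tags, lifting) finite_subset image_subsetI mem_Collect_eq)
  show ?thesis
  proof (rule that[OF _ _ refl])
    show "taylor m (of_nat N) \<in> pK" by (rule taylor_mem[OF of_nat_mem])
    show "f dvd DD (taylor m (of_nat N))"
      unfolding DD_taylor[OF derivation_of_nat[OF D]] using dvd by (rule dvd_smult)
    show "det (mat ?d ?d (\<lambda>(i, j). coeff (taylor m (of_nat N) ^ i mod f) j)) \<noteq> 0"
      using N det[of "of_nat N"] by (simp add: L_def)
  qed
qed

end

section \<open>Generators whose relations have constant coefficients\<close>

context poly_mod_derivation
begin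

lemma pcompose_sum_lt:
  assumes "degree h < n"
  shows "pcompose h A = (\<Sum>i<n. smult (coeff h i) (A ^ i))"
proof -
  have "h = (\<Sum>i\<le>n - 1. Polynomial.monom (coeff h i) i)"
    using assms by (intro poly_as_sum_of_monoms'[symmetric]) simp
  moreover have "{..n - 1} = {..<n}" using assms by auto
  ultimately have h: "h = (\<Sum>i<n. Polynomial.monom (coeff h i) i)" by simp
  have "pcompose (Polynomial.monom c i) A = smult c (A ^ i)" for c i
    by (simp add: pcompose_altdef poly_monom map_poly_monom)
  then show ?thesis by (subst h) (simp add: pcompose_sum)
qed

lemma coeff_pcompose_mod:
  assumes "degree h < n"
  shows "coeff (pcompose h A mod f) j = (\<Sum>i<n. coeff h i * coeff (A ^ i mod f) j)"
proof -
  have "(\<Sum>i\<in>I. smult (c i) (A ^ i)) mod f = (\<Sum>i\<in>I. smult (c i) (A ^ i mod f))" for c and I :: "nat set"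
    by (induction I rule: infinite_finite_induct) (simp_all add: mod_f_linear)
  then show ?thesis by (simp add: pcompose_sum_lt[OF assms] coeff_sum)
qed

lemma generator_independent:
  assumes V: "V = mat (degree f) (degree f) (\<lambda>(i, j). coeff (A ^ i mod f) j)"
    and det: "det V \<noteq> 0" and h: "degree h < degree f" and dvd: "f dvd pcompose h A"
  shows "h = 0"
proof (rule poly_eqI)
  fix k
  let ?d = "degree f"
  have Vc: "V \<in> carrier_mat ?d ?d" by (simp add: V)
  show "coeff h k = coeff 0 k"
  proof (cases "k < ?d")
    case True
    have z: "(\<Sum>i<?d. coeff h i * V $$ (i, j)) = 0" if "j < ?d" for j
      using coeff_pcompose_mod[OF h, of A j] dvd that by (simp add: V dvd_imp_mod_0)
    have "(\<Sum>j<?d. V $$ (i, j) * adj_mat V $$ (j, k)) = (if i = k then det V else 0)" if "i < ?d" for i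
    proof -
      have "(V * adj_mat V) $$ (i, k) = (\<Sum>j<?d. V $$ (i, j) * adj_mat V $$ (j, k))"
        using that True Vc adj_mat(1)[OF Vc] by (simp add: scalar_prod_def atLeast0LessThan)
      moreover have "(V * adj_mat V) $$ (i, k) = (if i = k then det V else 0)"
        using that True by (simp add: adj_mat(2)[OF Vc])
      ultimately show ?thesis by simp
    qed
    then have "(\<Sum>i<?d. coeff h i * (\<Sum>j<?d. V $$ (i, j) * adj_mat V $$ (j, k)))
        = (\<Sum>i<?d. coeff h i * (if i = k then det V else 0))" by (intro sum.cong) auto
    also have "\<dots> = coeff h k * det V" using True by (simp add: if_distrib sum.delta cong: if_cong)
    finally have "coeff h k * det V = (\<Sum>i<?d. \<Sum>j<?d. coeff h i * V $$ (i, j) * adj_mat V $$ (j, k))"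
      by (simp add: sum_distrib_left mult.assoc)
    also have "\<dots> = (\<Sum>j<?d. (\<Sum>i<?d. coeff h i * V $$ (i, j)) * adj_mat V $$ (j, k))"
      by (subst sum.swap) (simp add: sum_distrib_right)
    also have "\<dots> = 0" by (simp add: z)
    finally show ?thesis using det by simp
  next
    case False
    then show ?thesis using h by (simp add: coeff_eq_0)
  qed
qed

lemma generator_spans:
  assumes V: "V = mat (degree f) (degree f) (\<lambda>(i, j). coeff (A ^ i mod f) j)"
    and det: "det V \<noteq> 0" and A: "A \<in> pK" and g: "g \<in> pK"
  shows "\<exists>h\<in>pK. degree h < degree f \<and> f dvd pcompose h A - g"
proof -
  let ?d = "degree f"
  have Vc: "V \<in> carrier_mat ?d ?d" by (simp add: V)
  have VK: "V $$ (i, j) \<in> K" if "i < ?d" "j < ?d" for i j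
    using that by (simp add: V pKD pK_div_mod(2)[OF f_mem f_nz] pK_power A)
  define c where "c i = (\<Sum>j<?d. coeff (g mod f) j * adj_mat V $$ (j, i) / det V)" for i
  define h where "h = (\<Sum>i<?d. Polynomial.monom (c i) i)"
  have cK: "c i \<in> K" if "i < ?d" for i
    unfolding c_def
    by (intro K_mem adj_mat_mem[OF Vc VK] det_mem[OF VK Vc] pKD pK_div_mod(2)[OF f_mem f_nz g]) (use that in auto)
  have ch: "coeff h i = c i" if "i < ?d" for i
    using that by (simp add: h_def coeff_sum)
  have dh: "degree h < ?d"
  proof -
    have "degree h \<le> ?d - 1" unfolding h_def
      by (intro degree_sum_le) (auto intro: order_trans[OF degree_monom_le])
    then show ?thesis using f_deg by linarith
  qed
  have "h \<in> pK" unfolding h_def by (intro pK_sum pK_mem cK) auto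
  moreover have "pcompose h A mod f = g mod f"
  proof (rule poly_eqI)
    fix k
    show "coeff (pcompose h A mod f) k = coeff (g mod f) k"
    proof (cases "k < ?d")
      case True
      have adj: "(\<Sum>i<?d. adj_mat V $$ (j, i) * V $$ (i, k)) = (if j = k then det V else 0)" if "j < ?d" for j
      proof -
        have "(adj_mat V * V) $$ (j, k) = (\<Sum>i<?d. adj_mat V $$ (j, i) * V $$ (i, k))"
          using that True Vc adj_mat(1)[OF Vc] by (simp add: scalar_prod_def atLeast0LessThan)
        moreover have "(adj_mat V * V) $$ (j, k) = (if j = k then det V else 0)"
          using that True by (simp add: adj_mat(3)[OF Vc])
        ultimately show ?thesis by simp
      qed
      have "coeff (pcompose h A mod f) k = (\<Sum>i<?d. c i * V $$ (i, k))"
        unfolding coeff_pcompose_mod[OF dh] using True by (intro sum.cong) (auto simp: V ch)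
      also have "\<dots> = (\<Sum>i<?d. \<Sum>j<?d. coeff (g mod f) j / det V * (adj_mat V $$ (j, i) * V $$ (i, k)))"
        by (simp add: c_def sum_distrib_right mult.assoc)
      also have "\<dots> = (\<Sum>j<?d. coeff (g mod f) j / det V * (\<Sum>i<?d. adj_mat V $$ (j, i) * V $$ (i, k)))"
        by (subst sum.swap) (simp add: sum_distrib_left)
      also have "\<dots> = (\<Sum>j<?d. if j = k then coeff (g mod f) j else 0)"
        using det by (intro sum.cong) (auto simp: adj)
      also have "\<dots> = coeff (g mod f) k" using True by simp
      finally show ?thesis .
    next
      case False
      have "degree (p mod f) < ?d" for p
        using degree_mod_less[OF f_nz, of p] f_deg by auto
      then show ?thesis using False by (metis coeff_eq_0 le_less_trans not_less)
    qed
  qed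
  then have "f dvd pcompose h A - g" by (simp add: mod_eq_dvd_iff)
  ultimately show ?thesis using dh by blast
qed

end

text \<open>
  \<open>K\<close> is now generated by a ring \<open>P\<close> of polynomials, on which iterated differentiation ends in zero.
\<close>

locale poly_mod_derivation_fraction = poly_mod_derivation K D f x
  for K :: "'e::field_char_0 set" and D :: "'e \<Rightarrow> 'e" and f x +
  fixes P :: "'e set"
  assumes P_one: "1 \<in> P" and P_mult: "\<And>a b. a \<in> P \<Longrightarrow> b \<in> P \<Longrightarrow> a * b \<in> P"
    and P_sub: "P \<subseteq> K" and P_D: "\<And>a. a \<in> P \<Longrightarrow> D a \<in> P"
    and P_fraction: "\<And>a. a \<in> K \<Longrightarrow> \<exists>b\<in>P. b \<noteq> 0 \<and> b * a \<in> P"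
    and P_nilpotent: "\<And>a. a \<in> P \<Longrightarrow> \<exists>k. (D ^^ k) a = 0"
begin

lemma common_denominator:
  assumes "g \<in> pK"
  shows "\<exists>b\<in>P. b \<noteq> 0 \<and> (\<forall>i. coeff (smult b g) i \<in> P)"
  using assms
proof (induction g)
  case 0
  have "0 \<in> P"
  proof -
    obtain k where "(D ^^ k) 1 = 0" using P_nilpotent[OF P_one] by blast
    moreover have "(D ^^ k) 1 \<in> P" by (induction k) (auto simp: P_one P_D)
    ultimately show ?thesis by simp
  qed
  then show ?case using P_one by (intro bexI[of _ 1]) auto
next
  case (pCons a g)
  have "a \<in> K" "g \<in> pK"
    using pKD[OF pCons.prems, of 0] pKI[of g] pKD[OF pCons.prems, of "Suc i" for i] by auto
  obtain b where b: "b \<in> P" "b \<noteq> 0" "\<forall>i. coeff (smult b g) i \<in> P"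
    using pCons.IH \<open>g \<in> pK\<close> by blast
  obtain c where c: "c \<in> P" "c \<noteq> 0" "c * a \<in> P" using P_fraction[OF \<open>a \<in> K\<close>] by blast
  have "coeff (smult (b * c) (pCons a g)) i \<in> P" for i
    using P_mult[OF b(1) c(3)] P_mult[OF c(1)] b(3)
    by (cases i) (auto simp: mult.assoc mult.left_commute[of b c])
  then show ?case using P_mult[OF b(1) c(1)] b(2) c(2) by (intro bexI[of _ "b * c"]) auto
qed

text \<open>
  Differentiating a relation \<open>g(A) = 0\<close> gives \<open>g\<^sup>D(A) + g'(A) A' = 0\<close>, and \<open>A' = 0\<close>. So the
  coefficients of a relation may be differentiated, and the last nonzero iterate has constant
  coefficients.
\<close>

lemma relation_with_constant_coefficients:
  assumes A: "A \<in> pK" "f dvd DD A"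
    and g: "g \<noteq> 0" "\<And>i. coeff g i \<in> P" "f dvd pcompose g A"
  shows "\<exists>G. G \<noteq> 0 \<and> degree G \<le> degree g \<and> f dvd pcompose G A \<and>
      (\<forall>i. coeff G i \<in> P \<and> D (coeff G i) = 0)"
proof -
  let ?g = "\<lambda>k. ((map_poly D) ^^ k) g"
  have c: "coeff (?g k) i = (D ^^ k) (coeff g i)" for k i
    by (induction k) (auto simp: coeff_map_poly derivationD[OF D])
  have Dz: "(D ^^ k) 0 = 0" for k by (induction k) (auto simp: derivationD[OF D])
  have rel: "f dvd pcompose (?g k) A" for k
  proof (induction k)
    case (Suc k)
    have "f dvd DD (pcompose (?g k) A)" using Suc by (rule f_dvd_DD)
    then show ?case unfolding DD_pcompose using A(2) by (simp add: dvd_add_left_iff)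
  qed (use g in simp)
  have "\<exists>k. ?g k = 0"
  proof -
    obtain N where N: "\<And>i. (D ^^ N i) (coeff g i) = 0" using P_nilpotent[OF g(2)] by metis
    let ?M = "\<Sum>i\<le>degree g. N i"
    have "coeff (?g ?M) i = 0" for i
    proof (cases "i \<le> degree g")
      case True
      then have "N i \<le> ?M" by (intro member_le_sum) auto
      then have "(D ^^ ?M) (coeff g i) = (D ^^ (?M - N i)) ((D ^^ N i) (coeff g i))"
        by (metis comp_apply funpow_add le_add_diff_inverse2)
      then show ?thesis by (simp add: c N Dz)
    next
      case False
      then show ?thesis by (simp add: c coeff_eq_0 Dz)
    qed
    then show ?thesis by (metis leading_coeff_0_iff)
  qed
  define k where "k = (LEAST k. ?g k = 0)"
  have "?g k = 0" unfolding k_def using \<open>\<exists>k. ?g k = 0\<close> by (rule LeastI_ex)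
  moreover then obtain l where l: "k = Suc l" using g(1) by (cases k) auto
  ultimately have z: "?g (Suc l) = 0" and nz: "?g l \<noteq> 0"
    using not_less_Least[of l "\<lambda>k. ?g k = 0"] by (auto simp: k_def)
  have P: "coeff (?g l) i \<in> P" for i
    unfolding c by (induction l) (auto simp: g P_D)
  have "D (coeff (?g l) i) = 0" for i
    using c[of "Suc l" i] z by (simp add: c)
  moreover have "degree (?g l) \<le> degree g"
    by (rule degree_le) (simp add: c coeff_eq_0 Dz)
  ultimately show ?thesis using nz P rel by blast
qed

text \<open>
  In the conclusion the map \<open>h \<mapsto> h(A)\<close> from \<open>K[Y]\<close> to \<open>K[Y]/(f)\<close> is surjective with kernel generated
  by \<open>G\<close>, that is, \<open>K[Y]/(G)\<close> and \<open>K[Y]/(f)\<close> are isomorphic over \<open>K\<close>.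
\<close>

theorem generator_with_constant_minimal_polynomial:
  assumes dvd: "f dvd (DD ^^ Suc m) [:0, 1:]"
  shows "\<exists>A\<in>pK. \<exists>G. (\<forall>i. coeff G i \<in> P \<and> D (coeff G i) = 0) \<and> G \<noteq> 0 \<and>
     (\<forall>h\<in>pK. f dvd pcompose h A \<longleftrightarrow> G dvd h) \<and> (\<forall>g\<in>pK. \<exists>h\<in>pK. f dvd pcompose h A - g)"
proof -
  let ?d = "degree f"
  obtain A V where A: "A \<in> pK" "f dvd DD A"
    and V: "V = mat ?d ?d (\<lambda>(i, j). coeff (A ^ i mod f) j)" "det V \<noteq> 0"
    by (rule exists_generator[OF dvd])
  note indep = generator_independent[OF V] and span = generator_spans[OF V A(1)]
  \<comment> \<open>Express the power of degree d by smaller powers and clear denominators.\<close>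
  obtain h where h: "h \<in> pK" "degree h < ?d" "f dvd pcompose h A - A ^ ?d"
    using span[OF pK_power[OF A(1)]] by blast
  define g0 where "g0 = Polynomial.monom 1 ?d - h"
  have "pcompose (Polynomial.monom 1 ?d) A = A ^ ?d"
    by (simp add: pcompose_altdef poly_monom map_poly_monom)
  then have g0: "f dvd pcompose g0 A"
    using h(3) dvd_diff_commute[of f "A ^ ?d"] by (simp add: g0_def pcompose_diff)
  have g0K: "g0 \<in> pK" unfolding g0_def by (intro pK_mem h K_mem)
  have g0d: "coeff g0 ?d = 1" using h(2) by (simp add: g0_def coeff_eq_0)
  have g0le: "degree g0 \<le> ?d" using h(2)
    unfolding g0_def by (intro degree_diff_le degree_monom_le) auto
  obtain b where b: "b \<in> P" "b \<noteq> 0" "\<forall>i. coeff (smult b g0) i \<in> P"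
    using common_denominator[OF g0K] by blast
  have "smult b g0 \<noteq> 0" using b(2) g0d by auto
  moreover have "f dvd pcompose (smult b g0) A" using g0 by (simp add: pcompose_smult dvd_smult)
  ultimately obtain G where G: "G \<noteq> 0" "degree G \<le> degree (smult b g0)" "f dvd pcompose G A"
      "\<forall>i. coeff G i \<in> P \<and> D (coeff G i) = 0"
    using relation_with_constant_coefficients[OF A, of "smult b g0"] b(3) by blast
  have GK: "G \<in> pK" using G(4) P_sub by (intro pKI) auto
  have "\<not> degree G < ?d" using indep G by blast
  then have Gd: "degree G = ?d" using G(2) g0le b(2) by simp
  have "f dvd pcompose h A \<longleftrightarrow> G dvd h" if "h \<in> pK" for h
  proof
    assume "G dvd h"
    then obtain q where "h = G * q" by auto
    then show "f dvd pcompose h A" using G(3) by (simp add: pcompose_mult)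
  next
    assume a: "f dvd pcompose h A"
    have "h = h div G * G + h mod G" by simp
    then have "pcompose h A = pcompose (h div G) A * pcompose G A + pcompose (h mod G) A"
      by (metis pcompose_add pcompose_mult)
    then have "f dvd pcompose (h mod G) A" using a G(3) by (metis dvd_add_right_iff dvd_mult)
    moreover have "degree (h mod G) < ?d" 
      using degree_mod_less[OF G(1), of h] Gd f_deg by auto
    ultimately have "h mod G = 0" using indep by blast
    then show "G dvd h" by (simp add: mod_eq_0_iff_dvd)
  qed
  moreover have "\<exists>h\<in>pK. f dvd pcompose h A - g" if "g \<in> pK" for g using span[OF that] by blast
  ultimately show ?thesis using A(1) G by blast
qed

end

section \<open>The derivative with respect to one variable on rational functions\<close>

instance fract :: ("{idom, ring_char_0}") field_char_0
proof
  have "of_nat n = (to_fract (of_nat n) :: 'a fract)" for n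
    by (induction n) auto
  then show "inj (of_nat :: nat \<Rightarrow> 'a fract)" by (simp add: inj_def)
qed

text \<open>
  The coefficient of \<open>X\<^sup>m\<close> in the derivative comes from the monomial \<open>X\<^sup>m X\<^sub>k\<close>.
\<close>

definition mderiv :: "nat \<Rightarrow> 'a::comm_ring_1 mpoly \<Rightarrow> 'a mpoly" where
  "mderiv k p = Poly_Mapping.mapp (\<lambda>m a. of_nat (Suc (lookup m k)) * a)
     (Poly_Mapping.map_key (\<lambda>m. m + single k 1) p)"

lemma lookup_mderiv:
  "lookup (mderiv k p) m =
     of_nat (Suc (lookup m k)) * lookup p (m + single k 1)"
proof -
  have inj: "inj (\<lambda>m :: nat \<Rightarrow>\<^sub>0 nat. m + single k 1)" by (simp add: inj_def)
  have "lookup (Poly_Mapping.map_key (\<lambda>m. m + single k 1) p) m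
      = lookup p (m + single k 1)" for m
    unfolding map_key.rep_eq[OF inj] by (rule comp_apply)
  then show ?thesis
    unfolding mderiv_def lookup_mapp when_def in_keys_iff by (metis mult_zero_right)
qed

lemma mderiv_single:
  "mderiv k (single m a) =
     single (m - single k 1) (of_nat (lookup m k) * a)"
proof (rule poly_mapping_eqI)
  fix m'
  show "lookup (mderiv k (single m a)) m' = lookup
     (single (m - single k 1) (of_nat (lookup m k) * a)) m'"
  proof (cases "lookup m k = 0")
    case True
    then have "m \<noteq> m' + single k 1" by (auto simp: lookup_add)
    then show ?thesis using True by (simp add: lookup_mderiv lookup_single when_def)
  next
    case False
    then have "m = m' + single k 1 \<longleftrightarrow> m - single k 1 = m'"
      by (auto simp: poly_mapping_eq_iff fun_eq_iff lookup_add lookup_minus lookup_single when_def)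
    moreover have "Suc (lookup m' k) = lookup m k" if "m = m' + single k 1"
      using that by (simp add: lookup_add)
    ultimately show ?thesis
      by (auto simp: lookup_mderiv lookup_single when_def simp del: of_nat_Suc)
  qed
qed

lemma derivation_mderiv: "derivation (mderiv k)"
proof -
  have add: "mderiv k (p + q) = mderiv k p + mderiv k q" for p q :: "'a mpoly"
    by (rule poly_mapping_eqI) (simp add: lookup_mderiv lookup_add algebra_simps)
  have "mderiv k (p * q) = mderiv k p * q + p * mderiv k q" for p q :: "'a mpoly"
  proof (induction p rule: mpoly_induct)
    case (single m a)
    show ?case
    proof (induction q rule: mpoly_induct)
      case (single m' b)
      let ?e = "single k (1::nat)"
      have l: "lookup m k \<noteq> 0 \<Longrightarrow> m - ?e + m' = m + m' - ?e"
        and r: "lookup m' k \<noteq> 0 \<Longrightarrow> m + (m' - ?e) = m + m' - ?e"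
        by (auto simp: poly_mapping_eq_iff fun_eq_iff lookup_add lookup_minus lookup_single when_def)
      have "mderiv k (single m a) * single m' b
          = single (m + m' - ?e) (of_nat (lookup m k) * a * b)"
        using l by (cases "lookup m k = 0") (simp_all add: mderiv_single mult_single)
      moreover have "single m a * mderiv k (single m' b)
          = single (m + m' - ?e) (of_nat (lookup m' k) * a * b)"
        using r by (cases "lookup m' k = 0") (simp_all add: mderiv_single mult_single mult_ac)
      ultimately show ?case
        by (simp add: mult_single mderiv_single lookup_add algebra_simps flip: single_add)
    next
      case (add p q)
      then show ?case by (simp add: distrib_left \<open>\<And>p q. mderiv k (p + q) = mderiv k p + mderiv k q\<close> algebra_simps)
    qed
  next
    case (add p q)
    then show ?case by (simp add: distrib_right \<open>\<And>p q. mderiv k (p + q) = mderiv k p + mderiv k q\<close> algebra_simps)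
  qed
  with add show ?thesis by (auto simp: derivation_def)
qed

lemma keys_eq_empty_iff_zero: "keys p = {} \<longleftrightarrow> p = 0"
  by (metis empty_iff in_keys_iff lookup_zero poly_mapping_eqI keys_zero)

lemma mderiv_nilpotent: "\<exists>N. (mderiv k ^^ N) p = 0"
proof -
  have "(\<forall>m\<in>keys p. lookup m k < N) \<Longrightarrow> (mderiv k ^^ N) p = 0" for N
  proof (induction N arbitrary: p)
    case 0
    then have "keys p = {}" by blast
    then have "p = 0" by (metis keys_eq_empty_iff_zero)
    then show ?case by simp
  next
    case (Suc N)
    have "\<forall>m\<in>keys (mderiv k p). lookup m k < N"
    proof
      fix m assume "m \<in> keys (mderiv k p)"
      then have "m + single k 1 \<in> keys p" by (auto simp: in_keys_iff lookup_mderiv)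
      then have "lookup (m + single k 1) k < Suc N" using Suc.prems by blast
      then show "lookup m k < N" by (simp add: lookup_add)
    qed
    from Suc.IH[OF this] show ?case by (simp add: funpow_swap1)
  qed
  moreover have "\<exists>N. \<forall>m\<in>keys p. lookup m k < N"
    using finite_nat_set_iff_bounded[of "(\<lambda>m. lookup m k) ` keys p"] by auto
  ultimately show ?thesis by blast
qed

lemma mderiv_eq_0_iff:
  fixes p :: "'a::{idom, ring_char_0} mpoly"
  assumes "mderiv k p = 0" "m \<in> keys p"
  shows "lookup m k = 0"
proof (rule ccontr)
  assume nz: "lookup m k \<noteq> 0"
  then have m: "m - single k 1 + single k 1 = m"
    by (auto simp: poly_mapping_eq_iff fun_eq_iff lookup_add lookup_minus lookup_single when_def)
  have "lookup (mderiv k p) (m - single k 1) \<noteq> 0"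
    using assms(2) by (simp only: lookup_mderiv m in_keys_iff mult_eq_0_iff of_nat_eq_0_iff) simp
  then show False using assms(1) by simp
qed

lemma mpolys_closed:
  "1 \<in> mpolys n" "0 \<in> mpolys n" "p \<in> mpolys n \<Longrightarrow> q \<in> mpolys n \<Longrightarrow> p + q \<in> mpolys n"
  "p \<in> mpolys n \<Longrightarrow> q \<in> mpolys n \<Longrightarrow> p * q \<in> mpolys n"
proof -
  show "1 \<in> mpolys n" "0 \<in> mpolys n" by (simp_all add: mpolys_def)
  show "p + q \<in> mpolys n" if "p \<in> mpolys n" "q \<in> mpolys n"
    using that Poly_Mapping.keys_add[of p q] unfolding mpolys_def by blast
  show "p * q \<in> mpolys n" if pq: "p \<in> mpolys n" "q \<in> mpolys n"
  proof -
    have "keys m \<subseteq> {1..n}" if m: "m \<in> keys (p * q)" for m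
    proof -
      obtain a b where "a \<in> keys p" "b \<in> keys q" "m = a + b"
        using subsetD[OF Poly_Mapping.keys_mult m] by blast
      then show ?thesis using pq Poly_Mapping.keys_add[of a b] unfolding mpolys_def by blast
    qed
    then show ?thesis by (simp add: mpolys_def)
  qed
qed

lemma mpolys_ring_closed:
  fixes p :: "'a::comm_ring_1 mpoly"
  assumes "p \<in> mpolys n"
  shows "- p \<in> mpolys n" "q \<in> mpolys n \<Longrightarrow> p - q \<in> mpolys n" "mderiv k p \<in> mpolys n"
proof -
  have m: "- q \<in> mpolys n" if "q \<in> mpolys n" for q :: "'a mpoly"
    using that by (auto simp: mpolys_def in_keys_iff)
  show "- p \<in> mpolys n" using m assms .
  show "p - q \<in> mpolys n" if "q \<in> mpolys n" using mpolys_closed(3)[OF assms m[OF that]] by simp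
  show "mderiv k p \<in> mpolys n"
    unfolding mpolys_def
  proof safe
    fix m i assume m: "m \<in> keys (mderiv k p)" and i: "i \<in> keys m"
    have "m + single k 1 \<in> keys p"
      using m by (auto simp: in_keys_iff lookup_mderiv)
    moreover have "i \<in> keys (m + single k 1)"
      using i by (auto simp: in_keys_iff lookup_add)
    ultimately show "i \<in> {1..n}" using assms unfolding mpolys_def by blast
  qed
qed

text \<open>
  For \<open>q = a / b\<close> the quotient rule reads \<open>q' = (a' - q b') / b\<close>. In this form the independence of the
  representation of \<open>q\<close> follows by differentiating \<open>a b\<^sub>1 = a\<^sub>1 b\<close>.
\<close>

definition fract_deriv :: "('a::idom \<Rightarrow> 'a) \<Rightarrow> 'a fract \<Rightarrow> 'a fract" where
  "fract_deriv d q = (let (a, b) = (SOME (a, b). b \<noteq> 0 \<and> q = to_fract a / to_fract b)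
     in (to_fract (d a) - q * to_fract (d b)) / to_fract b)"

lemma fract_deriv_eq:
  assumes d: "derivation d" and b: "b \<noteq> 0" and q: "q = to_fract a / to_fract b"
  shows "fract_deriv d q = (to_fract (d a) - q * to_fract (d b)) / to_fract b"
proof -
  define ab where "ab = (SOME (a, b). b \<noteq> 0 \<and> q = to_fract a / to_fract b)"
  obtain a' b' where ab': "ab = (a', b')" by fastforce
  have "b' \<noteq> 0 \<and> q = to_fract a' / to_fract b'"
    using someI[of "\<lambda>(a, b). b \<noteq> 0 \<and> q = to_fract a / to_fract b" "(a, b)"] b q ab'
    by (simp add: ab_def)
  then have b': "b' \<noteq> 0" and q': "q = to_fract a' / to_fract b'" by auto
  have "to_fract (a * b') = to_fract (a' * b)" using b b' q q' by (simp add: field_simps)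
  then have "a * b' = a' * b" by (simp only: to_fract_eq_iff)
  then have "d a * b' + a * d b' = d a' * b + a' * d b" using derivationD(2)[OF d] by metis
  then have "to_fract (d a * b' + a * d b') = to_fract (d a' * b + a' * d b)" by simp
  then have e: "to_fract (d a) * to_fract b' + to_fract a * to_fract (d b')
      = to_fract (d a') * to_fract b + to_fract a' * to_fract (d b)" by simp
  have a: "to_fract a = q * to_fract b" using b by (simp add: q)
  have a': "to_fract a' = q * to_fract b'" using b' by (simp add: q')
  have "(to_fract (d a') - q * to_fract (d b')) / to_fract b' = (to_fract (d a) - q * to_fract (d b)) / to_fract b"
    using e b b' unfolding a a' by (simp add: field_simps)
  then show ?thesis by (simp add: fract_deriv_def ab' ab_def[symmetric])
qed

lemma fract_deriv_to_fract:
  assumes "derivation d"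
  shows "fract_deriv d (to_fract a) = to_fract (d a)"
  using fract_deriv_eq[OF assms, of 1 "to_fract a" a] derivationD(4)[OF assms] by simp

lemma fract_cases: obtains a b where "b \<noteq> 0" "q = to_fract a / to_fract b"
  by (cases q) (metis Fract_conv_to_fract)

lemma derivation_fract_deriv:
  assumes d: "derivation d"
  shows "derivation (fract_deriv d)"
proof -
  have "fract_deriv d (q + r) = fract_deriv d q + fract_deriv d r \<and>
    fract_deriv d (q * r) = fract_deriv d q * r + q * fract_deriv d r" for q r
  proof -
    obtain a b where b: "b \<noteq> 0" and q: "q = to_fract a / to_fract b" by (rule fract_cases)
    obtain c e where e: "e \<noteq> 0" and r: "r = to_fract c / to_fract e" by (rule fract_cases)
    have be: "b * e \<noteq> 0" using b e by simp
    have a: "to_fract a = q * to_fract b" using b by (simp add: q)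
    have c: "to_fract c = r * to_fract e" using e by (simp add: r)
    have s: "q + r = to_fract (a * e + c * b) / to_fract (b * e)" using b e by (simp add: q r field_simps)
    have p: "q * r = to_fract (a * c) / to_fract (b * e)" by (simp add: q r)
    show ?thesis
      unfolding fract_deriv_eq[OF d be s] fract_deriv_eq[OF d be p] fract_deriv_eq[OF d b q] fract_deriv_eq[OF d e r]
      using b e by (simp add: derivationD[OF d] a c field_simps)
  qed
  then show ?thesis by (simp add: derivation_def)
qed

lemma ratfuns_iff: "q \<in> ratfuns n \<longleftrightarrow> (\<exists>a b. a \<in> mpolys n \<and> b \<in> mpolys n \<and> b \<noteq> 0 \<and> q = to_fract a / to_fract b)"
  by (auto simp: ratfuns_def Fract_conv_to_fract)

lemma to_fract_mem_ratfuns: "a \<in> mpolys n \<Longrightarrow> to_fract a \<in> ratfuns n"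
  unfolding ratfuns_iff by (intro exI[of _ a] exI[of _ 1]) (simp add: mpolys_closed)

lemma ratfuns_subfield_with_derivation:
  "subfield_with_derivation (ratfuns n :: 'k::field_char_0 mpoly fract set) (fract_deriv (mderiv k))"
proof
  show "1 \<in> ratfuns n" using to_fract_mem_ratfuns[OF mpolys_closed(1)] by simp
  show "derivation (fract_deriv (mderiv k))" by (rule derivation_fract_deriv[OF derivation_mderiv])
  fix q :: "'k mpoly fract" assume "q \<in> ratfuns n"
  then obtain a b where q: "a \<in> mpolys n" "b \<in> mpolys n" "b \<noteq> 0" "q = to_fract a / to_fract b"
    unfolding ratfuns_iff by blast
  show "inverse q \<in> ratfuns n"
  proof (cases "a = 0")
    case True
    then show ?thesis using q to_fract_mem_ratfuns[OF mpolys_closed(2)] by simp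
  next
    case False
    then show ?thesis using q unfolding ratfuns_iff by (intro exI[of _ b] exI[of _ a]) simp
  qed
  have "fract_deriv (mderiv k) q = to_fract (mderiv k a * b - a * mderiv k b) / to_fract (b * b)"
    unfolding fract_deriv_eq[OF derivation_mderiv q(3,4)] using q(3) by (simp add: q(4) field_simps)
  then show "fract_deriv (mderiv k) q \<in> ratfuns n"
    unfolding ratfuns_iff using q
    by (intro exI[of _ "mderiv k a * b - a * mderiv k b"] exI[of _ "b * b"])
       (auto intro!: mpolys_closed mpolys_ring_closed)
  fix r :: "'k mpoly fract" assume "r \<in> ratfuns n"
  then obtain c e where r: "c \<in> mpolys n" "e \<in> mpolys n" "e \<noteq> 0" "r = to_fract c / to_fract e"
    unfolding ratfuns_iff by blast
  have "q - r = to_fract (a * e - c * b) / to_fract (b * e)"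
    using q(3) r(3) unfolding q(4) r(4) by (simp add: diff_frac_eq)
  then show "q - r \<in> ratfuns n"
    unfolding ratfuns_iff using q r
    by (intro exI[of _ "a * e - c * b"] exI[of _ "b * e"])
       (auto intro!: mpolys_closed mpolys_ring_closed)
  show "q * r \<in> ratfuns n"
    unfolding ratfuns_iff using q r
    by (intro exI[of _ "a * c"] exI[of _ "b * e"]) (auto intro!: mpolys_closed)
qed

section \<open>Rupture rings in terms of typed polynomials\<close>

context subfield_with_derivation
begin

interpretation R: Ring.field "ring_of_type_algebra :: 'e ring"
  by (rule field_from_type_algebra)

lemma type_ring_a_inv: "\<ominus>\<^bsub>ring_of_type_algebra\<^esub> (a::'e) = - a"
  using R.r_neg[of a] by (simp add: eq_neg_iff_add_eq_0 add.commute)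

lemma subfield_K: "subfield K (ring_of_type_algebra :: 'e ring)"
proof (rule R.subfieldI')
  show "subring K (ring_of_type_algebra :: 'e ring)"
    by (rule R.subringI) (auto simp: K_mem type_ring_a_inv)
  fix k assume k: "k \<in> K - {\<zero>\<^bsub>ring_of_type_algebra\<^esub>}"
  then have "inv\<^bsub>ring_of_type_algebra\<^esub> k = inverse k"
    by (intro R.comm_inv_char) auto
  then show "inv\<^bsub>ring_of_type_algebra\<^esub> k \<in> K" using k by (simp add: K_mem)
qed

abbreviation KX where "KX \<equiv> K[X]\<^bsub>ring_of_type_algebra\<^esub>"

text \<open>
  \<open>poly_list\<close> translates typed polynomials with coefficients in \<open>K\<close> into the ring \<open>K[X]\<close> of coefficient
  lists, and \<open>residue F\<close> is the projection to the quotient by \<open>F\<close>. The lemmas below are a dictionary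
  between congruences modulo \<open>F\<close> and the rupture ring.
\<close>

definition poly_list :: "'e poly \<Rightarrow> 'e list" where "poly_list p = rev (coeffs p)"

lemma coeff_poly_list: "R.coeff (poly_list p) i = coeff p i"
proof (cases "i < length (poly_list p)")
  case True
  then have "R.coeff (poly_list p) i = poly_list p ! (length (poly_list p) - 1 - i)" by (rule R.coeff_nth)
  also have "\<dots> = coeffs p ! i" using True by (simp add: poly_list_def rev_nth)
  also have "\<dots> = coeff p i"
    using True by (cases "p = 0") (auto simp: poly_list_def length_coeffs_degree intro: coeffs_nth)
  finally show ?thesis .
next
  case False
  then have "R.coeff (poly_list p) i = 0" using R.coeff_length[of "poly_list p" i] by simp
  moreover have "coeff p i = 0"
    using False by (cases "p = 0") (auto simp: poly_list_def length_coeffs_degree intro: coeff_eq_0)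
  ultimately show ?thesis by simp
qed

lemma poly_list_inject: "poly_list p = poly_list q \<longleftrightarrow> p = q"
  by (simp add: poly_list_def coeffs_eq_iff)

lemma poly_list_carrier: "poly_list p \<in> carrier (KX) \<longleftrightarrow> p \<in> pK"
proof -
  have "set (coeffs p) \<subseteq> K \<longleftrightarrow> p \<in> pK"
  proof
    assume a: "set (coeffs p) \<subseteq> K"
    have "coeff p i \<in> K" for i
      using a zero_mem by (metis coeff_in_coeffs coeff_0 coeff_eq_0 not_less subsetD)
    then show "p \<in> pK" by (rule pKI)
  next
    assume "p \<in> pK"
    then show "set (coeffs p) \<subseteq> K" by (auto simp: coeffs_def pKD)
  qed
  moreover have "coeffs p \<noteq> [] \<Longrightarrow> hd (rev (coeffs p)) \<noteq> 0"
    by (simp add: hd_rev last_coeffs_eq_coeff_degree)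
  ultimately show ?thesis
    by (auto simp: univ_poly_carrier[symmetric] polynomial_def poly_list_def)
qed

lemma poly_list_surj:
  assumes "l \<in> carrier (KX)"
  obtains p where "p \<in> pK" "l = poly_list p"
proof -
  have l: "set l \<subseteq> K" "l \<noteq> [] \<Longrightarrow> hd l \<noteq> 0"
    using assms by (auto simp: univ_poly_carrier[symmetric] polynomial_def)
  have "coeffs (Poly (rev l)) = rev l"
    using l(2) by (cases l) (simp_all add: strip_while_def)
  then have "l = poly_list (Poly (rev l))" by (simp add: poly_list_def)
  then show ?thesis using that poly_list_carrier assms by metis
qed

lemma poly_list_eqI:
  assumes "l \<in> carrier (KX)" "p \<in> pK" "\<And>i. R.coeff l i = coeff p i"
  shows "l = poly_list p"
  using R.coeff_iff_polynomial_cond[of K l "poly_list p"] assms poly_list_carrier[of p]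
  by (auto simp: univ_poly_carrier[symmetric] coeff_poly_list fun_eq_iff)

interpretation UP: domain "KX"
  by (rule R.univ_poly_is_domain[OF subfieldE(1)[OF subfield_K]])

lemma poly_list_add:
  assumes "p \<in> pK" "q \<in> pK"
  shows "poly_list p \<oplus>\<^bsub>KX\<^esub> poly_list q = poly_list (p + q)"
proof (rule poly_list_eqI)
  show "poly_list p \<oplus>\<^bsub>KX\<^esub> poly_list q \<in> carrier (KX)"
    using assms poly_list_carrier by (intro UP.a_closed) auto
  show "p + q \<in> pK" using assms by (rule pK_mem)
  show "R.coeff (poly_list p \<oplus>\<^bsub>KX\<^esub> poly_list q) i = coeff (p + q) i" for i
    unfolding univ_poly_add by (subst R.poly_add_coeff) (auto simp: coeff_poly_list)
qed

lemma poly_list_mult: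
  assumes "p \<in> pK" "q \<in> pK"
  shows "poly_list p \<otimes>\<^bsub>KX\<^esub> poly_list q = poly_list (p * q)"
proof (rule poly_list_eqI)
  show "poly_list p \<otimes>\<^bsub>KX\<^esub> poly_list q \<in> carrier (KX)"
    using assms poly_list_carrier by (intro UP.m_closed) auto
  show "p * q \<in> pK" using assms by (rule pK_mem)
  show "R.coeff (poly_list p \<otimes>\<^bsub>KX\<^esub> poly_list q) i = coeff (p * q) i" for i
    unfolding univ_poly_mult by (subst R.poly_mult_coeff) (auto simp: coeff_poly_list coeff_mult)
qed

lemma poly_list_one: "\<one>\<^bsub>KX\<^esub> = poly_list 1"
  by (simp add: univ_poly_one poly_list_def)

lemma poly_list_const: "R.poly_of_const c = poly_list [:c:]"
  by (simp add: R.poly_of_const_def poly_list_def)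

lemma poly_list_minus:
  assumes "p \<in> pK" "q \<in> pK"
  shows "poly_list p \<ominus>\<^bsub>KX\<^esub> poly_list q = poly_list (p - q)"
proof -
  have c: "poly_list p \<in> carrier (KX)" "poly_list q \<in> carrier (KX)"
    "poly_list (p - q) \<in> carrier (KX)"
    using assms pK_mem poly_list_carrier by auto
  have "poly_list (p - q) \<oplus>\<^bsub>KX\<^esub> poly_list q = poly_list p"
    using assms pK_mem by (simp add: poly_list_add)
  then show ?thesis using c UP.minus_eq UP.a_assoc UP.r_neg UP.r_zero UP.a_inv_closed by metis
qed

abbreviation quotient where "quotient F \<equiv> Rupt\<^bsub>ring_of_type_algebra\<^esub> K (poly_list F)"

definition residue :: "'e poly \<Rightarrow> 'e poly \<Rightarrow> 'e list set" where
  "residue F p = R.rupture_surj K (poly_list F) (poly_list p)"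

lemma residue_eq_iff:
  assumes F: "F \<in> pK" "F \<noteq> 0" and p: "p \<in> pK" "q \<in> pK"
  shows "residue F p = residue F q \<longleftrightarrow> F dvd p - q"
proof -
  have c: "poly_list F \<in> carrier (KX)"
    "poly_list p \<in> carrier (KX)" "poly_list q \<in> carrier (KX)"
    using assms poly_list_carrier by auto
  have "residue F p = residue F q \<longleftrightarrow>
      poly_list (p - q) \<in> PIdl\<^bsub>KX\<^esub> (poly_list F)"
    unfolding residue_def poly_list_minus[OF p, symmetric]
    using UP.quotient_eq_iff_same_a_r_cos[OF UP.cgenideal_ideal[OF c(1)] c(2,3)] by simp
  also have "\<dots> \<longleftrightarrow> (\<exists>u\<in>pK. p - q = u * F)"
  proof
    assume "poly_list (p - q) \<in> PIdl\<^bsub>KX\<^esub> (poly_list F)"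
    then obtain l where l: "l \<in> carrier (KX)"
      "poly_list (p - q) = l \<otimes>\<^bsub>KX\<^esub> poly_list F"
      by (auto simp: cgenideal_def)
    obtain u where u: "u \<in> pK" "l = poly_list u" using poly_list_surj[OF l(1)] by blast
    then have "p - q = u * F" using l(2) F by (simp add: poly_list_mult poly_list_inject)
    then show "\<exists>u\<in>pK. p - q = u * F" using u by blast
  next
    assume "\<exists>u\<in>pK. p - q = u * F"
    then obtain u where u: "u \<in> pK" "p - q = u * F" by blast
    then have "poly_list (p - q) = poly_list u \<otimes>\<^bsub>KX\<^esub> poly_list F"
      using F by (simp add: poly_list_mult)
    then show "poly_list (p - q) \<in> PIdl\<^bsub>KX\<^esub> (poly_list F)"
      using u poly_list_carrier by (auto simp: cgenideal_def)
  qed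
  also have "\<dots> \<longleftrightarrow> F dvd p - q"
  proof
    assume "F dvd p - q"
    then have "p - q = (p - q) div F * F" by simp
    then show "\<exists>u\<in>pK. p - q = u * F" using pK_div_mod(1)[OF F pK_mem(5)[OF p]] by blast
  qed auto
  finally show ?thesis .
qed

lemma residue_hom:
  assumes F: "F \<in> pK" and p: "p \<in> pK" "q \<in> pK"
  shows "residue F p \<in> carrier (quotient F)"
    "residue F p \<oplus>\<^bsub>quotient F\<^esub> residue F q = residue F (p + q)"
    "residue F p \<otimes>\<^bsub>quotient F\<^esub> residue F q = residue F (p * q)"
    "\<one>\<^bsub>quotient F\<^esub> = residue F 1"
proof -
  have c: "poly_list F \<in> carrier (KX)"
    "poly_list p \<in> carrier (KX)" "poly_list q \<in> carrier (KX)"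
    using assms poly_list_carrier by auto
  note h = R.rupture_surj_hom(1)[OF subfieldE(1)[OF subfield_K] c(1)]
  show "residue F p \<in> carrier (quotient F)"
    unfolding residue_def using ring_hom_memE(1)[OF h c(2)] .
  show "residue F p \<oplus>\<^bsub>quotient F\<^esub> residue F q = residue F (p + q)"
    unfolding residue_def poly_list_add[OF p, symmetric] using ring_hom_memE(3)[OF h c(2,3)] by simp
  show "residue F p \<otimes>\<^bsub>quotient F\<^esub> residue F q = residue F (p * q)"
    unfolding residue_def poly_list_mult[OF p, symmetric] using ring_hom_memE(2)[OF h c(2,3)] by simp
  show "\<one>\<^bsub>quotient F\<^esub> = residue F 1"
    unfolding residue_def poly_list_one[symmetric] using ring_hom_memE(4)[OF h] by simp
qed

lemma residue_surj:
  assumes F: "F \<in> pK" and S: "S \<in> carrier (quotient F)"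
  obtains p where "p \<in> pK" "S = residue F p"
proof -
  obtain l where l: "l \<in> carrier (KX)"
    "S = R.rupture_surj K (poly_list F) l"
    using S unfolding rupture_def FactRing_def A_RCOSETS_def' by auto
  obtain p where "p \<in> pK" "l = poly_list p" using poly_list_surj[OF l(1)] by blast
  then show ?thesis using that l(2) by (simp add: residue_def)
qed

text \<open>
  The isomorphism sends the class of \<open>h(A)\<close> modulo \<open>F\<close> to the class of \<open>h\<close> modulo \<open>G\<close>. It is well
  defined and injective because \<open>ker\<close> describes the kernel of \<open>h \<mapsto> h(A)\<close>, and it is total because
  of \<open>surj\<close>.
\<close>

lemma rupture_iso_of_generator:
  assumes F: "F \<in> pK" "F \<noteq> 0" and G: "G \<in> pK" "G \<noteq> 0" and A: "A \<in> pK"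
    and ker: "\<And>h. h \<in> pK \<Longrightarrow> F dvd pcompose h A \<longleftrightarrow> G dvd h"
    and surj: "\<And>g. g \<in> pK \<Longrightarrow> \<exists>h\<in>pK. F dvd pcompose h A - g"
  shows "\<exists>\<phi>\<in>ring_iso (quotient F) (quotient G).
     \<forall>c\<in>K. \<phi> (residue F [:c:]) = residue G [:c:]"
proof -
  let ?M = "quotient F" and ?N = "quotient G"
  define \<phi> where "\<phi> S = residue G (SOME h. h \<in> pK \<and> S = residue F (pcompose h A))" for S
  have eq: "residue F (pcompose h A) = residue F (pcompose h' A) \<longleftrightarrow> residue G h = residue G h'"
    if "h \<in> pK" "h' \<in> pK" for h h'
    using that ker[of "h - h'"] F G A
    by (simp add: residue_eq_iff pK_pcompose pcompose_diff pK_mem)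
  have \<phi>: "\<phi> (residue F (pcompose h A)) = residue G h" if h: "h \<in> pK" for h
  proof -
    let ?h' = "SOME h'. h' \<in> pK \<and> residue F (pcompose h A) = residue F (pcompose h' A)"
    have "?h' \<in> pK \<and> residue F (pcompose h A) = residue F (pcompose ?h' A)"
      by (rule someI[of _ h]) (use h in simp)
    then show ?thesis using eq[OF h, of ?h'] by (simp add: \<phi>_def)
  qed
  have ex: "\<exists>h\<in>pK. S = residue F (pcompose h A)" if S: "S \<in> carrier ?M" for S
  proof -
    obtain g where g: "g \<in> pK" "S = residue F g" using residue_surj[OF F(1) S] by blast
    obtain h where h: "h \<in> pK" "F dvd pcompose h A - g" using surj[OF g(1)] by blast
    then have "S = residue F (pcompose h A)"
      using g residue_eq_iff[OF F pK_pcompose[OF h(1) A] g(1)] by simp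
    then show ?thesis using h by blast
  qed
  have "\<phi> \<in> Ring.ring_hom ?M ?N"
  proof (rule ring_hom_memI)
    fix S T assume "S \<in> carrier ?M" "T \<in> carrier ?M"
    then obtain h k where h: "h \<in> pK" "S = residue F (pcompose h A)" "k \<in> pK" "T = residue F (pcompose k A)"
      using ex by metis
    show "\<phi> S \<in> carrier ?N" using h G by (simp add: \<phi> residue_hom)
    show "\<phi> (S \<otimes>\<^bsub>?M\<^esub> T) = \<phi> S \<otimes>\<^bsub>?N\<^esub> \<phi> T"
      using h F G A by (simp add: \<phi> residue_hom pK_pcompose pK_mem flip: pcompose_mult)
    show "\<phi> (S \<oplus>\<^bsub>?M\<^esub> T) = \<phi> S \<oplus>\<^bsub>?N\<^esub> \<phi> T"
      using h F G A by (simp add: \<phi> residue_hom pK_pcompose pK_mem flip: pcompose_add)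
  next
    show "\<phi> \<one>\<^bsub>?M\<^esub> = \<one>\<^bsub>?N\<^esub>"
      using \<phi>[of 1] F G by (simp add: residue_hom(4)[OF F(1) pK_mem(1) pK_mem(1)]
        residue_hom(4)[OF G(1) pK_mem(1) pK_mem(1)] pK_mem pcompose_1)
  qed
  moreover have "bij_betw \<phi> (carrier ?M) (carrier ?N)"
  proof (rule bij_betw_imageI)
    show "inj_on \<phi> (carrier ?M)"
    proof (rule inj_onI)
      fix S T assume "S \<in> carrier ?M" "T \<in> carrier ?M" and e: "\<phi> S = \<phi> T"
      then obtain h k where h: "h \<in> pK" "S = residue F (pcompose h A)" "k \<in> pK" "T = residue F (pcompose k A)"
        using ex by metis
      then show "S = T" using e eq by (simp add: \<phi>)
    qed
    show "\<phi> ` carrier ?M = carrier ?N"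
    proof
      show "\<phi> ` carrier ?M \<subseteq> carrier ?N"
      proof
        fix T assume "T \<in> \<phi> ` carrier ?M"
        then obtain h where "h \<in> pK" "T = \<phi> (residue F (pcompose h A))" using ex by blast
        then show "T \<in> carrier ?N" using G by (simp add: \<phi> residue_hom)
      qed
      show "carrier ?N \<subseteq> \<phi> ` carrier ?M"
      proof
        fix T assume "T \<in> carrier ?N"
        then obtain h where h: "h \<in> pK" "T = residue G h" using residue_surj[OF G(1)] by blast
        then have "T = \<phi> (residue F (pcompose h A))" by (simp add: \<phi>)
        moreover have "residue F (pcompose h A) \<in> carrier ?M"
          using h F A by (simp add: residue_hom pK_pcompose)
        ultimately show "T \<in> \<phi> ` carrier ?M" by blast
      qed
    qed
  qed
  moreover have "\<phi> (residue F [:c:]) = residue G [:c:]" if "c \<in> K" for c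
    using \<phi>[of "[:c:]"] pK_mem(8)[OF that, of 0] by (simp add: monom_0)
  ultimately show ?thesis by (auto simp: ring_iso_def)
qed

lemma irreducible_residue_inverse:
  assumes F: "F \<in> pK" "F \<noteq> 0"
    and irr: "pirreducible\<^bsub>ring_of_type_algebra\<^esub> K (poly_list F)"
    and g: "g \<in> pK" "\<not> F dvd g"
  shows "\<exists>u\<in>pK. F dvd u * g - 1"
proof -
  let ?M = "quotient F"
  have c: "poly_list F \<in> carrier (KX)" using F poly_list_carrier by auto
  interpret M: Ring.field ?M
    using R.rupture_is_field_iff_pirreducible[OF subfield_K c] irr by simp
  have "residue F 0 \<oplus>\<^bsub>?M\<^esub> residue F 0 = residue F 0"
    using residue_hom(2)[OF F(1) pK_mem(1) pK_mem(1)] by simp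
  then have "residue F 0 = \<zero>\<^bsub>?M\<^esub>"
    using residue_hom(1)[OF F(1) pK_mem(1) pK_mem(1)] by (metis M.add.r_cancel_one')
  then have "residue F g \<noteq> \<zero>\<^bsub>?M\<^esub>"
    using residue_eq_iff[OF F g(1) pK_mem(1)] g(2) by simp
  then have U: "residue F g \<in> Units ?M"
    using residue_hom(1)[OF F(1) g(1) g(1)] by (simp add: M.field_Units)
  obtain u where u: "u \<in> pK" "inv\<^bsub>?M\<^esub> residue F g = residue F u"
    using residue_surj[OF F(1) M.Units_inv_closed[OF U]] by blast
  have "residue F u \<otimes>\<^bsub>?M\<^esub> residue F g = \<one>\<^bsub>?M\<^esub>" using M.Units_l_inv[OF U] u(2) by simp
  then have "residue F (u * g) = residue F 1"
    by (simp only: residue_hom(3)[OF F(1) u(1) g(1)] residue_hom(4)[OF F(1) u(1) g(1)])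
  then have "F dvd u * g - 1" using residue_eq_iff[OF F pK_mem(6)[OF u(1) g(1)] pK_mem(2)] by simp
  then show ?thesis using u(1) by blast
qed

end

section \<open>The coefficients of a specialized polynomial\<close>

text \<open>
  The coefficient of \<open>Y\<^sup>i X\<^sub>1\<^sup>j\<close> in \<open>F\<close>, a polynomial in the other variables: \<open>X\<^sub>1\<close> is removed from each
  monomial.
\<close>

definition coeff_YX :: "int mpoly poly \<Rightarrow> nat \<Rightarrow> nat \<Rightarrow> int mpoly" where
  "coeff_YX F i j = (\<Sum>m \<in> {m \<in> keys (coeff F i). lookup m 1 = j}.
     single (m - single 1 j) (lookup (coeff F i) m))"

definition relation_at :: "int mpoly poly \<Rightarrow> nat \<Rightarrow> nat \<Rightarrow> nat \<Rightarrow> int mpoly" where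
  "relation_at F D a b = teval (decoded (coeff_YX F))
     (splitting_relation (degree F) D a b)"

lemma sum_single_keys: "(\<Sum>m\<in>keys p. single m (lookup p m)) = p"
  by (rule poly_mapping_eqI)
    (simp add: lookup_sum lookup_single when_def in_keys_iff)

lemma minus_single_add_single:
  fixes m :: "nat \<Rightarrow>\<^sub>0 nat"
  shows "m - single k (lookup m k) + single k (lookup m k) = m"
  by (rule poly_mapping_eqI) (simp add: lookup_add lookup_minus lookup_single when_def)

lemma coeff_YX_expansion:
  assumes "\<And>m. m \<in> keys (coeff F i) \<Longrightarrow> lookup m 1 \<le> N"
  shows "(\<Sum>j\<le>N. coeff_YX F i j * single (single 1 j) 1) = coeff F i"
proof -
  let ?p = "coeff F i"
  have "coeff_YX F i j * single (single 1 j) 1 =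
      (\<Sum>m \<in> {m \<in> keys ?p. lookup m 1 = j}. single m (lookup ?p m))" for j
    unfolding coeff_YX_def sum_distrib_right
  proof (rule sum.cong[OF refl])
    fix m assume "m \<in> {m \<in> keys ?p. lookup m 1 = j}"
    then have "m - single 1 j + single 1 j = m"
      using minus_single_add_single[of m 1] by simp
    then show "single (m - single 1 j) (lookup ?p m) *
        single (single 1 j) 1 = single m (lookup ?p m)"
      by (simp only: mult_single mult_1_right)
  qed
  then have "(\<Sum>j\<le>N. coeff_YX F i j * single (single 1 j) 1)
     = (\<Sum>j\<le>N. \<Sum>m \<in> {m \<in> keys ?p. lookup m 1 = j}. single m (lookup ?p m))"
    by simp
  also have "\<dots> = (\<Sum>m\<in>keys ?p. single m (lookup ?p m))"
    using assms by (intro sum.group) auto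
  finally show ?thesis by (simp only: sum_single_keys)
qed

definition rat_mpoly :: "int mpoly \<Rightarrow> rat mpoly" where "rat_mpoly p = Poly_Mapping.map of_int p"

lemma rat_mpoly_lookup: "lookup (rat_mpoly p) m = of_int (lookup p m)"
  by (simp add: rat_mpoly_def map.rep_eq when_def)

lemma rat_mpoly_single: "rat_mpoly (single m a) = single m (of_int a)"
  by (simp add: rat_mpoly_def)

lemma rat_mpoly_add: "rat_mpoly (p + q) = rat_mpoly p + rat_mpoly q"
  by (rule poly_mapping_eqI) (simp add: rat_mpoly_lookup lookup_add)

lemma rat_mpoly_mult: "rat_mpoly (p * q) = rat_mpoly p * rat_mpoly q"
proof (induction p rule: mpoly_induct)
  case (single m a)
  show ?case
    by (induction q rule: mpoly_induct)
      (simp_all add: mult_single rat_mpoly_single distrib_left rat_mpoly_add)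
qed (simp add: distrib_right rat_mpoly_add)

lemma rat_mpoly_1: "rat_mpoly 1 = 1"
  using rat_mpoly_single[of 0 1] by simp

lemma rat_mpoly_0: "rat_mpoly 0 = 0"
  by (rule poly_mapping_eqI) (simp add: rat_mpoly_lookup)

lemma rat_mpoly_sum: "rat_mpoly (\<Sum>i\<in>A. g i) = (\<Sum>i\<in>A. rat_mpoly (g i))"
  by (induction A rule: infinite_finite_induct) (auto simp: rat_mpoly_0 rat_mpoly_add)

lemma rat_mpoly_eq_0_iff: "rat_mpoly p = 0 \<longleftrightarrow> p = 0"
  by (auto simp: poly_mapping_eq_iff fun_eq_iff rat_mpoly_lookup)

lemma keys_rat_mpoly: "keys (rat_mpoly p) = keys p"
  by (auto simp: in_keys_iff rat_mpoly_lookup)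

lemma rat_ypoly_coeff: "coeff (rat_ypoly F) i = rat_mpoly (coeff F i)"
  using rat_mpoly_0 by (simp add: rat_ypoly_def coeff_map_poly rat_mpoly_def)

lemma degree_rat_ypoly: "degree (rat_ypoly F) = degree F"
proof -
  have "rat_ypoly F = map_poly rat_mpoly F" by (simp add: rat_ypoly_def rat_mpoly_def[abs_def])
  then show ?thesis by (simp add: degree_map_poly rat_mpoly_eq_0_iff)
qed

lemma finite_ymonomials: "finite (ymonomials F)"
proof -
  have "ymonomials F \<subseteq> Sigma {..degree F} (\<lambda>l. keys (coeff F l))"
    by (auto simp: ymonomials_def in_keys_iff intro!: le_degree)
  then show ?thesis by (rule finite_subset) auto
qed

lemma le_total_degree:
  assumes "m \<in> keys (coeff F l)"
  shows "l + (\<Sum>i\<in>keys m. lookup m i) \<le> total_degree F"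
  unfolding total_degree_def using assms finite_ymonomials[of F]
  by (intro Max_ge) (auto simp: ymonomials_def in_keys_iff image_iff intro!: bexI[of _ "(l, m)"])

lemma lookup_le_total_degree:
  assumes "m \<in> keys (coeff F l)"
  shows "lookup m i \<le> total_degree F"
proof (cases "i \<in> keys m")
  case True
  then have "lookup m i \<le> (\<Sum>i\<in>keys m. lookup m i)"
    by (intro member_le_sum) auto
  then show ?thesis using le_total_degree[OF assms] by linarith
qed (simp add: in_keys_iff)

lemma degree_le_total_degree: "degree F \<le> total_degree F"
proof (cases "F = 0")
  case False
  then have "coeff F (degree F) \<noteq> 0" by simp
  then obtain m where "m \<in> keys (coeff F (degree F))"
    using keys_eq_empty_iff_zero by blast
  then show ?thesis using le_total_degree[of m F "degree F"] by linarith
qed simp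

lemma keys_coeff_YX:
  assumes "m' \<in> keys (coeff_YX F i j)"
  obtains m where "m \<in> keys (coeff F i)" "lookup m 1 = j"
    "m' = m - single 1 j"
proof -
  have "m' \<in> (\<Union>m\<in>{m \<in> keys (coeff F i). lookup m 1 = j}.
      keys (single (m - single 1 j) (lookup (coeff F i) m)))"
    by (rule subsetD[OF Poly_Mapping.keys_sum assms[unfolded coeff_YX_def]])
  then obtain m where m: "m \<in> keys (coeff F i)" "lookup m 1 = j"
    "m' \<in> keys (single (m - single 1 j) (lookup (coeff F i) m))"
    by blast
  have "m' = m - single 1 j" using m(3) by (metis empty_iff keys_single singletonD)
  with m(1,2) show ?thesis by (rule that)
qed

lemma coeff_YX_no_X1:
  assumes "m' \<in> keys (coeff_YX F i j)"
  shows "lookup m' 1 = 0"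
proof -
  obtain m where "m \<in> keys (coeff F i)" "lookup m 1 = j"
    "m' = m - single 1 j" by (rule keys_coeff_YX[OF assms])
  then show ?thesis by (simp add: lookup_minus)
qed

lemma keys_minus_subset: "keys (m - m') \<subseteq> keys (m :: nat \<Rightarrow>\<^sub>0 nat)"
  by (auto simp: in_keys_iff lookup_minus)

lemma coeff_YX_vars:
  assumes F: "rat_ypoly F \<in> ypolys n" and m: "m \<in> keys (coeff_YX F i j)"
  shows "keys m \<subseteq> {2..n}"
proof -
  obtain m0 where m0: "m0 \<in> keys (coeff F i)" "lookup m0 1 = j"
    "m = m0 - single 1 j"
    by (rule keys_coeff_YX[OF m])
  have "keys m0 \<subseteq> {1..n}"
    using F m0(1) by (auto simp: ypolys_def mpolys_def rat_ypoly_coeff keys_rat_mpoly)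
  then have "keys m \<subseteq> {1..n}" unfolding m0(3) using keys_minus_subset by blast
  moreover have "1 \<notin> keys m" using coeff_YX_no_X1[OF m] by (simp add: in_keys_iff)
  ultimately have "keys m \<subseteq> {1..n} - {1}" by blast
  also have "\<dots> \<subseteq> {2..n}" by auto
  finally show ?thesis .
qed

text \<open>
  The map from polynomials in \<open>Z\<close> over the ring of indeterminate coefficients to rational functions: an
  indeterminate coefficient becomes the corresponding coefficient of \<open>F\<close>, and \<open>Z\<close> becomes \<open>X\<^sub>1\<close>. It maps
  the generic polynomial to \<open>F\<close> (\<open>fract_eval_generic\<close>) and \<open>d/dZ\<close> to \<open>d/dX\<^sub>1\<close> (\<open>fract_eval_pderiv\<close>).
\<close>

definition fract_eval :: "int mpoly poly \<Rightarrow> int mpoly poly \<Rightarrow> rat mpoly fract" where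
  "fract_eval F p = poly (map_poly (\<lambda>c. to_fract (rat_mpoly
     (teval (decoded (coeff_YX F)) c))) p)
     (to_fract (single (single 1 1) 1))"

lemma idom_hom_coeff: "idom_hom (\<lambda>c. to_fract (rat_mpoly (teval x c)))"
  by unfold_locales (simp_all only: teval_simps rat_mpoly_add rat_mpoly_mult rat_mpoly_0 rat_mpoly_1
     to_fract_add to_fract_mult to_fract_0 to_fract_1 teval_minus)

lemma idom_hom_fract_eval: "idom_hom (fract_eval F)"
proof -
  interpret h: map_poly_idom_hom "\<lambda>c. to_fract (rat_mpoly
     (teval (decoded (coeff_YX F)) c))"
    unfolding map_poly_idom_hom_def by (rule idom_hom_coeff)
  show ?thesis
    by unfold_locales (simp_all only: fract_eval_def h.hom_add h.hom_mult h.hom_zero h.hom_one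
      poly_add poly_mult poly_0 poly_1)
qed

lemma fract_eval_generic:
  assumes "lead_coeff (rat_ypoly F) = 1"
    and N: "\<And>i m. m \<in> keys (coeff F i) \<Longrightarrow> lookup m 1 \<le> N"
  shows "map_poly (fract_eval F) (generic_poly (degree F) N) = map_poly to_fract (rat_ypoly F)"
proof (rule poly_eqI)
  fix i
  define h where "h c = to_fract (rat_mpoly (teval (decoded (coeff_YX F)) c))" for c
  interpret h: idom_hom h unfolding h_def by (rule idom_hom_coeff)
  interpret e: idom_hom "fract_eval F" by (rule idom_hom_fract_eval)
  let ?x = "to_fract (single (single 1 1) 1) :: rat mpoly fract"
  have X: "?x ^ j = to_fract (rat_mpoly (single (single 1 j) 1))" for j
  proof (induction j)
    case (Suc j)
    have "rat_mpoly (single (single 1 (Suc j)) 1) =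
        single (single 1 1) 1 * rat_mpoly (single (single 1 j) 1)"
      by (simp add: rat_mpoly_single mult_single flip: single_add)
    then show ?case by (simp only: power_Suc Suc to_fract_mult)
  qed (simp add: rat_mpoly_1)
  have var: "fract_eval F (Polynomial.monom (mvar (prod_encode (i, j))) j)
     = to_fract (rat_mpoly (coeff_YX F i j * single (single 1 j) 1))" for i j
  proof -
    have "teval (decoded (coeff_YX F))
      (mvar (prod_encode (i, j))) = coeff_YX F i j"
      unfolding teval_var by simp
    then have "h (mvar (prod_encode (i, j)))
        = to_fract (rat_mpoly (coeff_YX F i j))" by (simp only: h_def)
    then have "fract_eval F (Polynomial.monom (mvar (prod_encode (i, j))) j)
       = to_fract (rat_mpoly (coeff_YX F i j)) * ?x ^ j"
      unfolding fract_eval_def h_def[symmetric] by (simp only: map_poly_monom[of h, OF h.hom_zero] poly_monom)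
    then show ?thesis by (simp only: X rat_mpoly_mult to_fract_mult)
  qed
  have lc: "coeff F (degree F) = 1"
  proof -
    have "rat_mpoly (coeff F (degree F)) = rat_mpoly 1"
      using assms(1) by (simp only: degree_rat_ypoly rat_ypoly_coeff rat_mpoly_1)
    then show ?thesis
      by (metis (no_types, lifting) of_int_eq_iff poly_mapping_eqI rat_mpoly_lookup)
  qed
  show "coeff (map_poly (fract_eval F) (generic_poly (degree F) N)) i =
      coeff (map_poly to_fract (rat_ypoly F)) i"
    unfolding coeff_map_poly[of "fract_eval F", OF e.hom_zero] coeff_map_poly[of to_fract, OF to_fract_0] rat_ypoly_coeff
  proof (cases "i < degree F")
    case True
    have "fract_eval F (coeff (generic_poly (degree F) N) i)
      = (\<Sum>j\<le>N. fract_eval F (Polynomial.monom (mvar (prod_encode (i, j))) j))"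
      using True by (simp only: coeff_generic_poly if_True e.hom_sum)
    also have "\<dots> = to_fract (rat_mpoly (\<Sum>j\<le>N. coeff_YX F i j * single (single 1 j) 1))"
      by (simp only: var rat_mpoly_sum to_fract_sum)
    also have "\<dots> = to_fract (rat_mpoly (coeff F i))"
      by (subst coeff_YX_expansion[OF N]) auto
    finally show "fract_eval F (coeff (generic_poly (degree F) N) i) =
      to_fract (rat_mpoly (coeff F i))" .
  next
    case False
    then consider "i = degree F" | "i > degree F" by linarith
    then show "fract_eval F (coeff (generic_poly (degree F) N) i) =
      to_fract (rat_mpoly (coeff F i))"
    proof cases
      case 1
      then show ?thesis using lc by (simp add: coeff_generic_poly rat_mpoly_1)
    next
      case 2
      then show ?thesis by (simp add: coeff_generic_poly coeff_eq_0 rat_mpoly_0)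
    qed
  qed
qed

lemma fract_eval_mem:
  assumes F: "rat_ypoly F \<in> ypolys n" and n: "n \<ge> 1"
  shows "fract_eval F p \<in> ratfuns n"
proof -
  interpret R: subfield_with_derivation "ratfuns n :: rat mpoly fract set" "fract_deriv (mderiv 1)"
    by (rule ratfuns_subfield_with_derivation)
  have Fm: "coeff_YX F i j \<in> mpolys n" for i j
    using coeff_YX_vars[OF F] unfolding mpolys_def by fastforce
  have single: "single 0 (a :: int) \<in> mpolys n" for a by (simp add: mpolys_def)
  have c: "to_fract (rat_mpoly q) \<in> ratfuns n" if "q \<in> mpolys n" for q
    using that by (intro to_fract_mem_ratfuns) (simp add: mpolys_def keys_rat_mpoly)
  have t: "teval (decoded (coeff_YX F)) c \<in> mpolys n" for c
  proof -
    let ?y = "decoded (coeff_YX F)"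
    have y: "?y k \<in> mpolys n" for k using Fm by (simp split: prod.split)
    have pw: "?y k ^ e \<in> mpolys n" for k e by (induction e) (use y in \<open>auto intro!: mpolys_closed\<close>)
    have pr: "(\<Prod>k\<in>A. ?y k ^ e k) \<in> mpolys n" for A e
      by (induction A rule: infinite_finite_induct) (use pw in \<open>auto intro!: mpolys_closed\<close>)
    have "(of_int a :: int mpoly) \<in> mpolys n" for a
      using single[of a] by (subst single_of_int[symmetric]) (simp only: of_int_eq_id id_apply)
    then have "(\<Sum>m\<in>A. of_int (g m) * (\<Prod>k\<in>keys m. ?y k ^ lookup m k)) \<in> mpolys n" for A g
      by (induction A rule: infinite_finite_induct) (use pr in \<open>auto intro!: mpolys_closed\<close>)
    then show ?thesis unfolding teval_eq .
  qed
  have x: "to_fract (single (single 1 1) (1::rat)) \<in> ratfuns n"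
    using n by (intro to_fract_mem_ratfuns) (simp add: mpolys_def)
  show ?thesis
    unfolding fract_eval_def poly_altdef
    by (intro R.K_mem x) (auto simp: coeff_map_poly rat_mpoly_0 intro: c t)
qed

lemma fract_eval_pderiv:
  "fract_deriv (mderiv 1) (fract_eval F p) = fract_eval F (pderiv p)"
proof -
  let ?D = "fract_deriv (mderiv 1) :: rat mpoly fract \<Rightarrow> _"
  let ?x = "to_fract (single (single 1 1) 1) :: rat mpoly fract"
  let ?y = "decoded (coeff_YX F)"
  define h where "h c = to_fract (rat_mpoly (teval ?y c))" for c
  have D: "derivation ?D" by (rule derivation_fract_deriv[OF derivation_mderiv])
  note D' = derivationD[OF D]
  interpret h: idom_hom h unfolding h_def by (rule idom_hom_coeff)
  have y: "mderiv 1 (?y k) = 0" for k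
  proof (rule poly_mapping_eqI)
    fix m
    have "m + single 1 1 \<notin> keys (coeff_YX F i j)" for i j
      using coeff_YX_no_X1[of "m + single 1 1" F i j] by (auto simp: lookup_add)
    then show "lookup (mderiv 1 (?y k)) m = lookup 0 m"
      by (simp add: lookup_mderiv in_keys_iff split: prod.split)
  qed
  have Dpow: "mderiv 1 q = 0 \<Longrightarrow> mderiv 1 (q ^ e) = 0" for q :: "int mpoly" and e
    by (induction e) (auto simp: derivationD[OF derivation_mderiv])
  have Dprod: "mderiv 1 (\<Prod>k\<in>A. ?y k ^ e k) = 0" for A and e :: "nat \<Rightarrow> nat"
    by (induction A rule: infinite_finite_induct) (use Dpow y in \<open>auto simp: derivationD[OF derivation_mderiv]\<close>)
  have Dint: "mderiv 1 (of_int a :: int mpoly) = 0" for a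
    by (cases a) (auto simp: derivationD[OF derivation_mderiv] derivation_of_nat[OF derivation_mderiv]
       simp del: of_nat_Suc)
  have "mderiv 1 (teval ?y c) = 0" for c
    unfolding teval_eq derivation_sum[OF derivation_mderiv] derivationD(2)[OF derivation_mderiv] Dint Dprod by simp
  moreover have "mderiv 1 (rat_mpoly q) = rat_mpoly (mderiv 1 q)" for q
    by (rule poly_mapping_eqI) (simp add: lookup_mderiv rat_mpoly_lookup)
  ultimately have hD: "?D (h c) = 0" for c
    unfolding h_def fract_deriv_to_fract[OF derivation_mderiv] by (simp only: rat_mpoly_0 to_fract_0)
  have Dx: "?D ?x = 1"
    unfolding fract_deriv_to_fract[OF derivation_mderiv] by (simp add: mderiv_single)
  define E where "E = ?D"
  define x where "x = ?x"
  have "E (poly (map_poly h p) x) = poly (pderiv (map_poly h p)) x"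
    using D' hD Dx unfolding E_def[symmetric] x_def[symmetric]
    by (induction p) (simp_all add: map_poly_pCons pderiv_pCons algebra_simps)
  then have "?D (poly (map_poly h p) ?x) = poly (pderiv (map_poly h p)) ?x" unfolding E_def x_def .
  then have "?D (poly (map_poly h p) ?x) = poly (map_poly h (pderiv p)) ?x"
    by (simp only: h.map_poly_pderiv)
  then show ?thesis unfolding fract_eval_def h_def .
qed

section \<open>A genuine polynomial violates a splitting relation\<close>

lemma ratfun_poly_eq: 
  "ratfun_poly G = subfield_with_derivation.poly_list (map_poly to_fract (G :: 'k::field_char_0 mpoly poly))"
proof -
  interpret subfield_with_derivation "ratfuns 1 :: 'k mpoly fract set" "fract_deriv (mderiv 1)"
    by (rule ratfuns_subfield_with_derivation)
  have "coeffs (map_poly to_fract G) = map to_fract (coeffs G)"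
    by (rule coeffs_map_poly) simp_all
  then show ?thesis by (simp add: ratfun_poly_def poly_list_def)
qed

text \<open>
  If all relations vanish, then \<open>F\<close> divides a power of its jet of order \<open>D + 1\<close>. By irreducibility it
  divides the jet, so in the extension the derivative of order \<open>D + 1\<close> of the root is zero. Then the
  extension has a generator with a relation free of \<open>X\<^sub>1\<close>, which a genuine extension does not have.
\<close>

theorem genuine_relation_nonzero:
  assumes n: "n \<ge> 1" and genuine: "genuine_poly n (rat_ypoly F)"
    and bound: "\<And>i m. m \<in> keys (coeff F i) \<Longrightarrow> lookup m 1 \<le> D"
  shows "\<exists>a b. relation_at F D a b \<noteq> 0"
proof (rule ccontr)
  assume "\<nexists>a b. relation_at F D a b \<noteq> 0"
  then have zero: "relation_at F D a b = 0" for a b by blast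
  let ?K = "ratfuns n :: rat mpoly fract set"
  define D1 where "D1 = (fract_deriv (mderiv 1) :: rat mpoly fract \<Rightarrow> _)"
  define x where "x = (to_fract (single (single 1 1) 1) :: rat mpoly fract)"
  define f where "f = map_poly to_fract (rat_ypoly F)"
  define d where "d = degree F"
  interpret K: subfield_with_derivation ?K D1
    unfolding D1_def by (rule ratfuns_subfield_with_derivation)
  have Fy: "rat_ypoly F \<in> ypolys n" and Fm: "lead_coeff (rat_ypoly F) = 1"
    and Firr: "pirreducible\<^bsub>fract_ring\<^esub> (ratfuns n) (ratfun_poly (rat_ypoly F))"
    and Fg: "\<And>G. G \<in> ypolys n \<Longrightarrow> extension_eq_quot n (quot_field n (rat_ypoly F)) (quot_embed n (rat_ypoly F)) G
      \<Longrightarrow> degree_X 1 G \<noteq> 0"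
    using genuine n by (auto simp: genuine_poly_def genuine_extension_def)
  have fK: "f \<in> K.pK"
    using Fy by (auto intro!: K.pKI to_fract_mem_ratfuns simp: f_def coeff_map_poly ypolys_def)
  have degree_f: "degree f = degree (rat_ypoly F)"
    unfolding f_def by (rule degree_map_poly) simp
  have fm: "lead_coeff f = 1"
    unfolding degree_f using Fm by (simp add: f_def coeff_map_poly)
  then have f0: "f \<noteq> 0" by auto
  have irr: "pirreducible\<^bsub>fract_ring\<^esub> (ratfuns n) (K.poly_list f)"
    using Firr by (simp add: ratfun_poly_eq f_def)
  interpret R: Ring.field "fract_ring :: rat mpoly fract ring" by (rule field_from_type_algebra)
  have fdeg: "degree f > 0"
  proof -
    have "K.poly_list f \<in> carrier (ratfuns n[X]\<^bsub>fract_ring\<^esub>)" using fK K.poly_list_carrier by simp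
    then have "Polynomials.degree (K.poly_list f) \<ge> 1"
      using R.pirreducible_degree[OF K.subfield_K _ irr] by simp
    then show ?thesis by (simp add: K.poly_list_def length_coeffs_degree[OF f0])
  qed
  have ddeg: "degree f = d"
    by (simp add: degree_f d_def degree_rat_ypoly)
  interpret P: poly_mod_derivation_fraction ?K D1 f x "to_fract ` mpolys n"
  proof
    show "f \<in> K.pK" "lead_coeff f = 1" "degree f > 0" by fact+
    show "\<exists>u\<in>K.pK. f dvd u * g - 1" if "g \<in> K.pK" "\<not> f dvd g" for g
      using K.irreducible_residue_inverse[OF fK f0 irr that] .
    show "x \<in> ?K" unfolding x_def using n by (intro to_fract_mem_ratfuns) (simp add: mpolys_def)
    show "D1 x = 1"
      unfolding D1_def x_def fract_deriv_to_fract[OF derivation_mderiv] by (simp add: mderiv_single)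
    show "1 \<in> to_fract ` (mpolys n :: rat mpoly set)"
      using mpolys_closed(1) by (rule rev_image_eqI) simp
    show "a * b \<in> to_fract ` mpolys n" if "a \<in> to_fract ` mpolys n" "b \<in> to_fract ` mpolys n"
      for a b :: "rat mpoly fract"
      using that by (auto simp flip: to_fract_mult intro: mpolys_closed)
    show "to_fract ` mpolys n \<subseteq> ?K" using to_fract_mem_ratfuns by blast
    show "D1 a \<in> to_fract ` mpolys n" if a: "a \<in> to_fract ` mpolys n" for a
    proof -
      obtain p where "a = to_fract p" "p \<in> mpolys n" using a by blast
      then show ?thesis unfolding D1_def by (metis fract_deriv_to_fract[OF derivation_mderiv] imageI mpolys_ring_closed(3))
    qed
    show "\<exists>b\<in>to_fract ` mpolys n. b \<noteq> 0 \<and> b * a \<in> to_fract ` mpolys n" if a: "a \<in> ?K" for a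
    proof -
      obtain p q where pq: "p \<in> mpolys n" "q \<in> mpolys n" "q \<noteq> 0" "a = to_fract p / to_fract q"
        using a unfolding ratfuns_iff by blast
      then show ?thesis by (intro bexI[of _ "to_fract q"]) auto
    qed
    show "\<exists>k. (D1 ^^ k) a = 0" if a: "a \<in> to_fract ` mpolys n" for a
    proof -
      obtain p where p: "a = to_fract p" using a by blast
      have "(D1 ^^ k) (to_fract p) = to_fract ((mderiv 1 ^^ k) p)" for k
        by (induction k) (simp_all add: D1_def fract_deriv_to_fract[OF derivation_mderiv])
      then show ?thesis using mderiv_nilpotent[of 1 p] p by (metis to_fract_0)
    qed
  qed
  let ?G = "generic_poly d (d * D)"
  define h where "h = fract_eval F"
  interpret h: idom_hom h unfolding h_def by (rule idom_hom_fract_eval)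
  interpret hp: map_poly_idom_hom h ..
  have G: "map_poly h ?G = f"
  proof -
    have "d \<ge> 1" using fdeg ddeg by simp
    then have "D \<le> d * D" by simp
    then have "lookup m 1 \<le> d * D" if "m \<in> keys (coeff F i)" for i m
      using bound[OF that] by (rule order_trans[rotated])
    then show ?thesis unfolding h_def f_def d_def by (rule fract_eval_generic[OF Fm])
  qed
  have hK: "map_poly h p \<in> K.pK" for p
    by (rule K.pKI) (simp only: coeff_map_poly[of h, OF h.hom_zero], simp only: h_def fract_eval_mem[OF Fy n])
  have hD: "map_poly h (map_poly pderiv g) = map_poly D1 (map_poly h g)" for g
  proof -
    have "D1 (h p) = h (pderiv p)" for p by (simp only: h_def D1_def fract_eval_pderiv)
    then show ?thesis
      by (intro poly_eqI) (simp only: coeff_map_poly[of h, OF h.hom_zero]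
        coeff_map_poly[of D1, OF derivationD(3)[OF K.D]] coeff_map_poly[of pderiv, OF pderiv_0])
  qed
  have "f dvd (P.DD ^^ Suc D) [:0, 1:]"
  proof -
    let ?J = "map_poly h (jet ?G (Suc D))"
    obtain B R where BR: "jet ?G (Suc D) ^ d = ?G * B + R" "\<And>a b. coeff (coeff R a) b = splitting_relation d D a b"
      using jet_power_eq_generic[of d D] by metis
    have "map_poly h R = 0"
    proof (rule poly_eqI)
      fix a
      have "teval (decoded (coeff_YX F)) (coeff (coeff R a) b) = 0" for b
        using zero[of a b] by (simp only: BR(2) relation_at_def d_def)
      then have "map_poly (\<lambda>c. to_fract (rat_mpoly
         (teval (decoded (coeff_YX F)) c))) (coeff R a) = 0"
        by (intro poly_eqI) (simp add: coeff_map_poly rat_mpoly_0)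
      then have "h (coeff R a) = 0" by (simp only: h_def fract_eval_def poly_0)
      then show "coeff (map_poly h R) a = coeff 0 a" by (simp add: coeff_map_poly)
    qed
    then have "?J ^ d = f * map_poly h B"
      using arg_cong[OF BR(1), of "map_poly h"] by (simp only: hp.hom_add hp.hom_mult hp.hom_power G add_0_right)
    then have "f dvd ?J" by (intro P.f_dvd_power[OF hK, of _ d]) simp
    moreover have "f dvd ?J - map_poly h (pderiv ?G) ^ (2 * Suc D) * (P.DD ^^ Suc D) (map_poly h [:0, 1:])"
    proof (rule jet_cong_iterated_derivative[OF hp.comm_ring_hom_axioms P.DD P.f_dvd_DD_f])
      show "f dvd map_poly h (pderiv ?G) * P.DD (map_poly h g) - map_poly h (tangent ?G g)" for g
        using P.f_dvd_tangent[of "map_poly h g"]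
        by (simp only: tangent_def hp.hom_minus hp.hom_mult h.map_poly_pderiv hD G)
    qed
    moreover have "map_poly h [:0, 1:] = [:0, 1:]" by (simp add: map_poly_pCons)
    ultimately have "f dvd ?J - pderiv f ^ (2 * Suc D) * (P.DD ^^ Suc D) [:0, 1:]"
      by (simp only: h.map_poly_pderiv G)
    with \<open>f dvd ?J\<close> have dvd: "f dvd pderiv f ^ (2 * Suc D) * (P.DD ^^ Suc D) [:0, 1:]"
      by (simp only: dvd_diff_right_iff)
    have "f dvd (P.U * pderiv f) ^ (2 * Suc D) - 1 ^ (2 * Suc D)"
      unfolding power_diff_sumr2 using P.U(2) by (rule dvd_mult2)
    then have "f dvd ((P.U * pderiv f) ^ (2 * Suc D) - 1) * (P.DD ^^ Suc D) [:0, 1:]" by simp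
    moreover have "f dvd (P.U * pderiv f) ^ (2 * Suc D) * (P.DD ^^ Suc D) [:0, 1:]"
      using dvd_mult[OF dvd, of "P.U ^ (2 * Suc D)"] by (simp only: power_mult_distrib mult.assoc)
    ultimately show ?thesis by (simp only: left_diff_distrib mult_1_left dvd_diff_right_iff)
  qed
  from P.generator_with_constant_minimal_polynomial[OF this]
  obtain A G where A: "A \<in> K.pK"
    and G: "\<And>i. coeff G i \<in> to_fract ` mpolys n" "\<And>i. D1 (coeff G i) = 0" "G \<noteq> 0"
    and ker: "\<And>h. h \<in> K.pK \<Longrightarrow> f dvd pcompose h A \<longleftrightarrow> G dvd h"
    and surj: "\<And>g. g \<in> K.pK \<Longrightarrow> \<exists>h\<in>K.pK. f dvd pcompose h A - g"
    by blast
  have "\<forall>i. \<exists>c. c \<in> mpolys n \<and> coeff G i = to_fract c" using G(1) by blast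
  from choice[OF this] obtain c where "\<forall>i. c i \<in> mpolys n \<and> coeff G i = to_fract (c i)" ..
  then have c: "\<And>i. c i \<in> mpolys n" "\<And>i. coeff G i = to_fract (c i)" by simp_all
  define u where "u = (inv_into UNIV to_fract :: rat mpoly fract \<Rightarrow> _)"
  have u: "u (to_fract a) = a" for a
    unfolding u_def by (rule inv_into_f_f) (simp_all add: inj_def)
  define G' where "G' = map_poly u G"
  have G'c: "coeff G' i = c i" for i
    unfolding G'_def using u[of 0] by (subst coeff_map_poly) (simp_all add: c(2) u)
  have GG': "map_poly to_fract G' = G"
    by (rule poly_eqI) (simp add: coeff_map_poly G'c c(2))
  have G'y: "G' \<in> ypolys n" using c(1) by (simp add: ypolys_def G'c)
  have "degree_X 1 G' = 0"
  proof -
    have "lookup m 1 = 0" if "(l, m) \<in> ymonomials G'" for l m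
    proof -
      have "m \<in> keys (c l)" using that by (simp add: ymonomials_def G'c in_keys_iff)
      moreover have "mderiv 1 (c l) = 0"
        using G(2)[of l] by (simp only: c(2) D1_def fract_deriv_to_fract[OF derivation_mderiv] to_fract_eq_0_iff)
      ultimately show ?thesis by (rule mderiv_eq_0_iff[rotated])
    qed
    then have "insert 0 ((\<lambda>(l, m). lookup m 1) ` ymonomials G') = {0}" by auto
    then show ?thesis unfolding degree_X_def by (simp only: Max_singleton)
  qed
  moreover have "extension_eq_quot n (quot_field n (rat_ypoly F)) (quot_embed n (rat_ypoly F)) G'"
  proof -
    have GK: "G \<in> K.pK" using c by (intro K.pKI) (simp add: to_fract_mem_ratfuns)
    have q: "quot_field n H = Rupt\<^bsub>fract_ring\<^esub> (ratfuns n) (K.poly_list (map_poly to_fract H))"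
      "quot_embed n H a = K.residue (map_poly to_fract H) [:a:]" for H a
      by (simp_all add: quot_field_def quot_embed_def K.residue_def ratfun_poly_eq K.poly_list_const)
    show ?thesis
      unfolding extension_eq_quot_def q GG' f_def[symmetric]
      by (rule K.rupture_iso_of_generator[OF fK f0 GK G(3) A ker surj])
  qed
  ultimately show False using Fg[OF G'y] by blast
qed

section \<open>Complete splitting forces the splitting relations\<close>

lemma coeff_map_pCons_monom:
  fixes \<psi> :: "'a::comm_ring_1 \<Rightarrow> 'b"
  assumes U: "cring U" and \<psi>: "\<psi> \<in> Ring.ring_hom ring_of_type_algebra U"
  shows "coeff_map \<psi> [:- q, 1:] = up_ring.monom (UP U) \<one>\<^bsub>U\<^esub> 1 \<ominus>\<^bsub>UP U\<^esub> up_ring.monom (UP U) (\<psi> q) 0"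
proof -
  interpret U: cring U by fact
  interpret P: UP_cring U "UP U" by unfold_locales
  interpret T: ring_hom_cring "ring_of_type_algebra :: 'a ring" U \<psi>
    by (rule ring_hom_cringI[OF cring_from_type_algebra U \<psi>])
  interpret C: ring_hom_cring "ring_of_type_algebra :: 'a poly ring" "UP U" "coeff_map \<psi>"
    by (rule ring_hom_cringI[OF cring_from_type_algebra P.UP_cring coeff_map_hom[OF U \<psi>]])
  have z: "\<psi> 0 = \<zero>\<^bsub>U\<^esub>" and o: "\<psi> 1 = \<one>\<^bsub>U\<^esub>" using T.hom_zero T.hom_one by auto
  have c: "\<psi> a \<in> carrier U" for a using T.hom_closed by auto
  have 1: "coeff_map \<psi> [:0, 1:] = up_ring.monom (UP U) \<one>\<^bsub>U\<^esub> 1"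
    by (rule ext) (auto simp: coeff_map_def UP_def z o coeff_pCons split: nat.split)
  have 2: "coeff_map \<psi> [:q:] = up_ring.monom (UP U) (\<psi> q) 0"
    by (rule ext) (auto simp: coeff_map_def UP_def z c coeff_pCons split: nat.split)
  have cl: "coeff_map \<psi> p \<in> carrier (UP U)" for p using C.hom_closed by auto
  have "coeff_map \<psi> [:- q, 1:] \<oplus>\<^bsub>UP U\<^esub> coeff_map \<psi> [:q:] = coeff_map \<psi> [:0, 1:]"
    using C.hom_add[of "[:- q, 1:]" "[:q:]"] by simp
  then have "coeff_map \<psi> [:- q, 1:] = coeff_map \<psi> [:0, 1:] \<ominus>\<^bsub>UP U\<^esub> coeff_map \<psi> [:q:]"
    using cl P.P.minus_eq P.P.a_assoc P.P.r_neg P.P.r_zero P.P.a_inv_closed by metis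
  then show ?thesis by (simp only: 1 2)
qed

lemma coeff_mult_degree_bounds:
  fixes p q :: "'a::comm_semiring_1 poly"
  assumes "degree p \<le> a" "degree q \<le> b"
  shows "coeff (p * q) (a + b) = coeff p a * coeff q b"
proof -
  have "coeff (p * q) (a + b) = (\<Sum>k\<le>a + b. coeff p k * coeff q (a + b - k))"
    by (rule coeff_mult)
  also have "\<dots> = (\<Sum>k\<le>a + b. if k = a then coeff p a * coeff q b else 0)"
  proof (rule sum.cong[OF refl])
    fix k
    consider "k < a" | "k = a" | "k > a" by linarith
    then show "coeff p k * coeff q (a + b - k)
        = (if k = a then coeff p a * coeff q b else 0)"
    proof cases
      case 1
      then have "coeff q (a + b - k) = 0" using assms by (intro coeff_eq_0) linarith
      then show ?thesis using 1 by simp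
    next
      case 3
      then have "coeff p k = 0" using assms by (intro coeff_eq_0) linarith
      then show ?thesis using 3 by simp
    qed simp
  qed
  finally show ?thesis by simp
qed

text \<open>
  The roots \<open>Q\<^sub>j\<close> over the algebraic closure \<open>L\<close> are the image, under an evaluation \<open>\<theta>\<close>, of polynomials
  with indeterminate coefficients, cut off at the degrees of the \<open>Q\<^sub>j\<close>. Hence the coefficients of the
  product of the factors \<open>Y - Q\<^sub>j\<close> are images of the coefficients of the generic product \<open>P\<close>, for which the
  relations hold by \<open>splitting_relation_product\<close>. That lemma needs the degrees of the \<open>Q\<^sub>j\<close> to be at most
  \<open>D\<close>: a root of larger degree \<open>N\<close> has a leading term \<open>Z\<^sup>d\<^sup>N\<close> in \<open>Q\<^sub>j\<^sup>d\<close> that no other term of the equation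
  \<open>P(Q\<^sub>j) = 0\<close> can cancel.
\<close>

lemma relation_vanishes_if_splits:
  fixes R :: "'a ring"
  assumes R: "Ring.field R" and fR: "\<And>i j. f i j \<in> carrier R"
    and monic: "f d 0 = \<one>\<^bsub>R\<^esub>" and above: "\<And>i j. i > d \<Longrightarrow> f i j = \<zero>\<^bsub>R\<^esub>"
    and bound: "\<And>i j. j > D \<Longrightarrow> f i j = \<zero>\<^bsub>R\<^esub>"
    and splits: "splits_completely R f"
  shows "meval R (decoded f) (splitting_relation d D a b) = \<zero>\<^bsub>R\<^esub>"
proof -
  interpret R: Ring.field R by fact
  define L where "L = R.alg_closure"
  define \<iota> where "\<iota> = (R.indexed_const :: 'a \<Rightarrow> ('a list \<times> nat) multiset \<Rightarrow> 'a)"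
  interpret L: algebraic_closure L "\<iota> ` carrier R"
    unfolding L_def \<iota>_def by (rule R.alg_closureE(1))
  have hom: "\<iota> \<in> Ring.ring_hom R L" unfolding L_def \<iota>_def by (rule R.alg_closureE(2))
  interpret I: ring_hom_cring R L \<iota>
    by (rule ring_hom_cringI[OF R.is_cring L.is_cring hom])
  interpret U: UP_cring L "UP L" by unfold_locales
  have UPL: "cring (UP L)" by (rule U.UP_cring)
  interpret S: UP_cring "UP L" "UP (UP L)" using UPL by (simp add: UP_cring_def)
  obtain e :: nat and Q where Q: "\<And>j. j < e \<Longrightarrow> Q j \<in> carrier (UP L)"
    and prod: "(\<lambda>i j. \<iota> (f i j)) = (\<Otimes>\<^bsub>UP (UP L)\<^esub> j \<in> {..<e}.
        up_ring.monom (UP (UP L)) \<one>\<^bsub>UP L\<^esub> 1 \<ominus>\<^bsub>UP (UP L)\<^esub> up_ring.monom (UP (UP L)) (Q j) 0)"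
  proof -
    have "\<exists>e Q. (\<forall>j<e. Q j \<in> carrier (UP L)) \<and> (\<lambda>i j. \<iota> (f i j)) = (\<Otimes>\<^bsub>UP (UP L)\<^esub> j \<in> {..<e::nat}.
        up_ring.monom (UP (UP L)) \<one>\<^bsub>UP L\<^esub> 1 \<ominus>\<^bsub>UP (UP L)\<^esub> up_ring.monom (UP (UP L)) (Q j) 0)"
      using splits unfolding splits_completely_def Let_def L_def \<iota>_def .
    then show ?thesis using that by metis
  qed
  have QL: "Q j k \<in> carrier L" if "j < e" for j k
    using Q[OF that] by (auto simp: UP_def up_def)
  have "\<exists>N. (\<forall>k>N. Q j k = \<zero>\<^bsub>L\<^esub>) \<and> (N > 0 \<longrightarrow> Q j N \<noteq> \<zero>\<^bsub>L\<^esub>)" if j: "j < e" for j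
  proof -
    obtain N where "bound \<zero>\<^bsub>L\<^esub> N (Q j)" using Q[OF j] by (auto simp: UP_def up_def)
    then have ex: "\<exists>N. \<forall>k>N. Q j k = \<zero>\<^bsub>L\<^esub>" by (auto simp: bound_def)
    \<comment> \<open>The least bound is the degree, and the coefficient there is nonzero unless the degree is 0.\<close>
    define M where "M = (LEAST N. \<forall>k>N. Q j k = \<zero>\<^bsub>L\<^esub>)"
    have M: "\<forall>k>M. Q j k = \<zero>\<^bsub>L\<^esub>" unfolding M_def by (rule LeastI_ex[OF ex])
    have "Q j M \<noteq> \<zero>\<^bsub>L\<^esub>" if "M > 0"
    proof
      assume z: "Q j M = \<zero>\<^bsub>L\<^esub>"
      have "\<forall>k>M - 1. Q j k = \<zero>\<^bsub>L\<^esub>"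
      proof (intro allI impI)
        fix k assume "k > M - 1"
        then have "k = M \<or> k > M" using that by linarith
        then show "Q j k = \<zero>\<^bsub>L\<^esub>" using z M by blast
      qed
      then have "M \<le> M - 1" unfolding M_def by (rule Least_le)
      then show False using that by linarith
    qed
    then show ?thesis using M by blast
  qed
  then obtain N where N: "\<And>j k. j < e \<Longrightarrow> k > N j \<Longrightarrow> Q j k = \<zero>\<^bsub>L\<^esub>"
    and N0: "\<And>j. j < e \<Longrightarrow> N j > 0 \<Longrightarrow> Q j (N j) \<noteq> \<zero>\<^bsub>L\<^esub>"
    by metis
  \<comment> \<open>The indeterminate coded by (j, l) becomes the coefficient of Z^l in Q_j.\<close>
  define y where "y k = (case prod_decode k of (j, l) \<Rightarrow> if j < e then Q j l else \<zero>\<^bsub>L\<^esub>)" for k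
  have yL: "y k \<in> carrier L" for k using QL by (auto simp: y_def split: prod.split)
  define \<theta> where "\<theta> = meval L y"
  have \<theta>: "\<theta> \<in> Ring.ring_hom ring_of_type_algebra L"
    unfolding \<theta>_def by (rule L.meval_hom[OF yL])
  interpret H: ring_hom_cring "ring_of_type_algebra :: int mpoly ring" L \<theta>
    by (rule ring_hom_cringI[OF cring_from_type_algebra L.is_cring \<theta>])
  have \<theta>0: "\<theta> 0 = \<zero>\<^bsub>L\<^esub>" and \<theta>1: "\<theta> 1 = \<one>\<^bsub>L\<^esub>" using H.hom_zero H.hom_one by auto
  have \<theta>mult: "\<theta> (p * q) = \<theta> p \<otimes>\<^bsub>L\<^esub> \<theta> q" and \<theta>add: "\<theta> (p + q) = \<theta> p \<oplus>\<^bsub>L\<^esub> \<theta> q"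
    and \<theta>c: "\<theta> p \<in> carrier L" for p q
    using H.hom_mult[of p q] H.hom_add[of p q] H.hom_closed[of p] by auto
  have \<theta>sum: "\<theta> (\<Sum>i\<in>A. g i) = \<zero>\<^bsub>L\<^esub>" if "\<And>i. i \<in> A \<Longrightarrow> \<theta> (g i) = \<zero>\<^bsub>L\<^esub>" for g and A :: "nat set"
    using that by (induction A rule: infinite_finite_induct) (auto simp: \<theta>0 \<theta>add)
  define v where "v j l = (single (single (prod_encode (j, l)) 1) 1 :: int mpoly)" for j l
  have \<theta>v: "\<theta> (v j l) = Q j l" if "j < e" for j l
    unfolding \<theta>_def v_def using L.meval_var[of y "prod_encode (j, l)"] yL that by (simp add: y_def)
  define Qh where "Qh j = (\<Sum>l\<le>N j. Polynomial.monom (v j l) l)" for j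
  have cQh: "coeff (Qh j) l = (if l \<le> N j then v j l else 0)" for j l
    by (simp add: Qh_def coeff_sum)
  have \<psi>Qh: "coeff_map \<theta> (Qh j) = Q j" if "j < e" for j
    by (rule ext) (use that N in \<open>auto simp: coeff_map_def cQh \<theta>v \<theta>0\<close>)
  define P where "P = (\<Prod>j<e. [:- Qh j, 1:])"
  have \<psi>: "coeff_map \<theta> \<in> Ring.ring_hom ring_of_type_algebra (UP L)"
    by (rule coeff_map_hom[OF L.is_cring \<theta>])
  interpret T: ring_hom_cring "ring_of_type_algebra :: int mpoly poly poly ring" "UP (UP L)" "coeff_map (coeff_map \<theta>)"
    by (rule ring_hom_cringI[OF cring_from_type_algebra S.UP_cring coeff_map_hom[OF UPL \<psi>]])
  have fac: "coeff_map (coeff_map \<theta>) [:- Qh j, 1:] =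
      up_ring.monom (UP (UP L)) \<one>\<^bsub>UP L\<^esub> 1 \<ominus>\<^bsub>UP (UP L)\<^esub> up_ring.monom (UP (UP L)) (Q j) 0" if "j < e" for j
    using coeff_map_pCons_monom[OF UPL \<psi>, of "Qh j"] by (simp only: \<psi>Qh[OF that])
  have Tcl: "coeff_map (coeff_map \<theta>) p \<in> carrier (UP (UP L))" for p using T.hom_closed[of p] by simp
  have "coeff_map (coeff_map \<theta>) P = (\<Otimes>\<^bsub>UP (UP L)\<^esub> j \<in> {..<e}. coeff_map (coeff_map \<theta>) [:- Qh j, 1:])"
    unfolding P_def using T.hom_finprod[of "\<lambda>j. [:- Qh j, 1:]" "{..<e}"] by (simp add: comp_def)
  also have "\<dots> = (\<lambda>i j. \<iota> (f i j))"
    unfolding prod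
  proof (rule S.P.finprod_cong'[OF refl])
    show "(\<lambda>j. up_ring.monom (UP (UP L)) \<one>\<^bsub>UP L\<^esub> 1 \<ominus>\<^bsub>UP (UP L)\<^esub> up_ring.monom (UP (UP L)) (Q j) 0)
        \<in> {..<e} \<rightarrow> carrier (UP (UP L))"
    proof (rule Pi_I)
      fix j assume "j \<in> {..<e}"
      then have "j < e" by simp
      show "up_ring.monom (UP (UP L)) \<one>\<^bsub>UP L\<^esub> 1 \<ominus>\<^bsub>UP (UP L)\<^esub> up_ring.monom (UP (UP L)) (Q j) 0 \<in> carrier (UP (UP L))"
        unfolding fac[OF \<open>j < e\<close>, symmetric] by (rule Tcl)
    qed
    show "coeff_map (coeff_map \<theta>) [:- Qh j, 1:] =
      up_ring.monom (UP (UP L)) \<one>\<^bsub>UP L\<^esub> 1 \<ominus>\<^bsub>UP (UP L)\<^esub> up_ring.monom (UP (UP L)) (Q j) 0" if "j \<in> {..<e}" for j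
      using that fac by blast
  qed
  finally have Pf: "\<theta> (coeff (coeff P i) j) = \<iota> (f i j)" for i j
    by (simp add: coeff_map_def fun_eq_iff)
  have degP: "degree P = e"
    unfolding P_def by (subst degree_prod_eq_sum_degree) auto
  have lcP: "coeff P e = 1"
    using lead_coeff_prod[of "\<lambda>j. [:- Qh j, 1:]" "{..<e}"] degP by (simp add: P_def)
  have \<iota>z: "\<iota> \<zero>\<^bsub>R\<^esub> = \<zero>\<^bsub>L\<^esub>" and \<iota>o: "\<iota> \<one>\<^bsub>R\<^esub> = \<one>\<^bsub>L\<^esub>" by auto
  have ed: "e = d"
  proof (rule antisym)
    have "\<iota> (f e 0) = \<one>\<^bsub>L\<^esub>" using Pf[of e 0] lcP \<theta>1 by simp
    then show "e \<le> d" using above[of e 0] \<iota>z L.one_not_zero by (metis not_le)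
    show "d \<le> e"
    proof (rule ccontr)
      assume "\<not> d \<le> e"
      then have "coeff P d = 0" using degP by (simp add: coeff_eq_0)
      then show False using Pf[of d 0] monic \<iota>o \<theta>0 L.one_not_zero by simp
    qed
  qed
  have ND: "N j \<le> D" if j: "j < d" for j
  proof (rule ccontr)
    assume "\<not> N j \<le> D"
    then have DN: "D < N j" by simp
    have je: "j < e" using j ed by simp
    have dQ: "degree (Qh j) \<le> N j" by (rule degree_le) (simp add: cQh)
    have dQp: "degree (Qh j ^ i) \<le> i * N j" for i
      using degree_power_le[of "Qh j" i] dQ by (metis mult.commute mult_le_mono1 order_trans)
    have lcQ: "coeff (Qh j ^ i) (i * N j) = v j (N j) ^ i" for i
    proof (induction i)
      case (Suc i)
      have "coeff (Qh j * Qh j ^ i) (N j + i * N j) = coeff (Qh j) (N j) * coeff (Qh j ^ i) (i * N j)"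
        by (rule coeff_mult_degree_bounds[OF dQ dQp])
      then show ?case using Suc by (simp add: cQh)
    qed simp
    \<comment> \<open>Compare the coefficients of Z^(d N_j) in P(Q_j) = 0.\<close>
    have "poly P (Qh j) = 0" using je by (auto simp: P_def poly_prod)
    then have "(\<Sum>i\<le>d. coeff P i * Qh j ^ i) = 0"
      using degP ed by (simp add: poly_altdef)
    then have "(\<Sum>i<d. coeff P i * Qh j ^ i) + Qh j ^ d = 0"
      using lcP ed by (simp add: lessThan_Suc_atMost[symmetric])
    then have "coeff ((\<Sum>i<d. coeff P i * Qh j ^ i) + Qh j ^ d) (d * N j) = 0" by simp
    then have "(\<Sum>i<d. \<Sum>a\<le>d * N j. coeff (coeff P i) a * coeff (Qh j ^ i) (d * N j - a))
        + v j (N j) ^ d = 0"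
      by (simp add: coeff_sum coeff_mult lcQ)
    then have eq: "\<theta> (\<Sum>i<d. \<Sum>a\<le>d * N j. coeff (coeff P i) a * coeff (Qh j ^ i) (d * N j - a))
        \<oplus>\<^bsub>L\<^esub> \<theta> (v j (N j) ^ d) = \<zero>\<^bsub>L\<^esub>"
      by (simp only: \<theta>add[symmetric] \<theta>0)
    have "\<theta> (\<Sum>i<d. \<Sum>a\<le>d * N j. coeff (coeff P i) a * coeff (Qh j ^ i) (d * N j - a)) = \<zero>\<^bsub>L\<^esub>"
    proof (intro \<theta>sum)
      fix i a assume i: "i \<in> {..<d}" and a: "a \<in> {..d * N j}"
      show "\<theta> (coeff (coeff P i) a * coeff (Qh j ^ i) (d * N j - a)) = \<zero>\<^bsub>L\<^esub>"
      proof (cases "a > D")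
        case True
        then show ?thesis using bound[OF True, of i] by (simp add: \<theta>mult Pf \<iota>z \<theta>c)
      next
        case False
        have "Suc i * N j \<le> d * N j" using i by (intro mult_le_mono1) auto
        then have "i * N j < d * N j - a" using False DN by simp
        then have "coeff (Qh j ^ i) (d * N j - a) = 0"
          using dQp[of i] by (intro coeff_eq_0) linarith
        then show ?thesis by (simp add: \<theta>0)
      qed
    qed
    with eq have "\<theta> (v j (N j) ^ d) = \<zero>\<^bsub>L\<^esub>" by (simp add: \<theta>c)
    moreover have "\<theta> (v j (N j) ^ i) \<noteq> \<zero>\<^bsub>L\<^esub>" for i
    proof (induction i)
      case (Suc i)
      have "\<theta> (v j (N j)) \<noteq> \<zero>\<^bsub>L\<^esub>" using \<theta>v[OF je] N0[OF je] DN by simp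
      then show ?case using Suc L.integral[of "\<theta> (v j (N j))" "\<theta> (v j (N j) ^ i)"] by (auto simp: \<theta>mult \<theta>c)
    qed (simp add: \<theta>1)
    ultimately show False by blast
  qed
  have "teval (decoded (\<lambda>i j. coeff (coeff P i) j))
      (splitting_relation d D a b) = 0"
    unfolding P_def ed
  proof (rule splitting_relation_product)
    show "degree (Qh j) \<le> D" if "j < d" for j
      using ND[OF that] by (intro degree_le) (simp add: cQh)
  qed
  then have "\<zero>\<^bsub>L\<^esub> = \<theta> (teval (decoded (\<lambda>i j. coeff (coeff P i) j))
      (splitting_relation d D a b))" by (simp only: \<theta>0)
  also have "\<dots> = meval L (\<lambda>k. \<theta> (case prod_decode k of (i, j) \<Rightarrow> coeff (coeff P i) j))
      (splitting_relation d D a b)"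
    by (rule ring_hom_meval[OF cring_from_type_algebra L.is_cring \<theta>]) simp
  also have "(\<lambda>k. \<theta> (case prod_decode k of (i, j) \<Rightarrow> coeff (coeff P i) j))
      = (\<lambda>k. \<iota> (case prod_decode k of (i, j) \<Rightarrow> f i j))"
    by (rule ext) (simp add: Pf split: prod.split)
  also have "meval L \<dots> (splitting_relation d D a b)
      = \<iota> (meval R (decoded f) (splitting_relation d D a b))"
    using fR by (intro ring_hom_meval[OF R.is_cring L.is_cring hom, symmetric]) (simp split: prod.split)
  finally have "\<iota> (meval R (decoded f) (splitting_relation d D a b)) = \<iota> \<zero>\<^bsub>R\<^esub>"
    by (simp only: \<iota>z)
  moreover have "inj \<iota>" unfolding \<iota>_def by (rule R.indexed_const_is_inj)
  ultimately show ?thesis by (rule injD[rotated])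
qed

section \<open>Counting zeros and prime divisors\<close>

text \<open>
  The integer \<open>p\<close> is either \<open>0\<close> or a prime here and below, so that zeros over the integers and zeros modulo
  a prime are counted at the same time. The elements of \<open>S\<close> are pairwise incongruent.
\<close>

lemma card_roots_mod_le:
  fixes p :: int and f :: "int poly"
  assumes pr: "\<And>a b. p dvd a * b \<Longrightarrow> p dvd a \<or> p dvd b"
    and S: "finite S" "\<And>a b. a \<in> S \<Longrightarrow> b \<in> S \<Longrightarrow> p dvd a - b \<Longrightarrow> a = b"
    and nz: "\<exists>k. \<not> p dvd coeff f k"
  shows "card {s \<in> S. p dvd poly f s} \<le> degree f"
  using nz
proof (induction "degree f" arbitrary: f)
  case 0
  then obtain c where c: "f = [:c:]" by (metis degree_eq_zeroE)
  with 0 have "\<not> p dvd c" by (metis coeff_0 coeff_pCons_0 coeff_pCons_Suc dvd_0_right not0_implies_Suc)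
  then show ?case by (simp add: c)
next
  case (Suc d)
  show ?case
  proof (cases "\<exists>a\<in>S. p dvd poly f a")
    case True
    then obtain a where a: "a \<in> S" "p dvd poly f a" by blast
    define g where "g = synthetic_div f a"
    have fg: "f + smult a g = pCons (poly f a) g"
      using synthetic_div_correct[of f a] by (simp add: g_def)
    have pf: "poly f s = (s - a) * poly g s + poly f a" for s
      using arg_cong[OF fg, of "\<lambda>q. poly q s"] by (simp add: algebra_simps)
    have dg: "d = degree g" using Suc(2) by (simp add: g_def degree_synthetic_div)
    have "\<exists>k. \<not> p dvd coeff g k"
    proof (rule ccontr)
      assume n: "\<nexists>k. \<not> p dvd coeff g k"
      have "p dvd coeff f k" for k
      proof -
        have "coeff f k = coeff (pCons (poly f a) g) k - a * coeff g k"
          using arg_cong[OF fg, of "\<lambda>q. coeff q k"] by simp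
        also have "p dvd \<dots>" using n a by (auto simp: coeff_pCons split: nat.splits)
        finally show ?thesis .
      qed
      then show False using Suc.prems by blast
    qed
    then have le: "card {s \<in> S. p dvd poly g s} \<le> d" using Suc.hyps(1)[OF dg] dg by simp
    have "{s \<in> S. p dvd poly f s} \<subseteq> insert a {s \<in> S. p dvd poly g s}"
    proof
      fix s assume s: "s \<in> {s \<in> S. p dvd poly f s}"
      then have "p dvd (s - a) * poly g s"
        using a(2) pf[of s] by (metis dvd_add_left_iff mem_Collect_eq)
      then show "s \<in> insert a {s \<in> S. p dvd poly g s}" using pr S(2) s a by blast
    qed
    then have "card {s \<in> S. p dvd poly f s} \<le> card (insert a {s \<in> S. p dvd poly g s})"
      using S(1) by (intro card_mono) auto
    also have "\<dots> \<le> Suc (card {s \<in> S. p dvd poly g s})" using S(1) by (simp add: card_insert_if)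
    finally show ?thesis using le Suc(2) by simp
  next
    case False
    then have "{s \<in> S. p dvd poly f s} = {}" by blast
    then show ?thesis by (simp only: card.empty)
  qed
qed

text \<open>
  A form of the Schwartz-Zippel bound, by induction on the number of variables. For a fixed variable
  \<open>X\<^sub>j\<close> let \<open>k\<close> be its exponent in a monomial whose coefficient is not divisible by \<open>p\<close>. The coefficient of
  \<open>X\<^sub>j\<^sup>k\<close> is a polynomial in the other variables that is nonzero modulo \<open>p\<close>. At each of its zeros all
  values of \<open>X\<^sub>j\<close> may occur, elsewhere at most \<open>e\<close> of them.
\<close>

lemma card_zeros_mod_le:
  fixes p :: int and a :: "(nat \<Rightarrow> nat) \<Rightarrow> int"
  assumes pr: "\<And>a b. p dvd a * b \<Longrightarrow> p dvd a \<or> p dvd b"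
    and S: "finite S" "\<And>a b. a \<in> S \<Longrightarrow> b \<in> S \<Longrightarrow> p dvd a - b \<Longrightarrow> a = b"
    and "finite I" "finite M" "\<And>m i. m \<in> M \<Longrightarrow> i \<notin> I \<Longrightarrow> m i = 0"
      "\<And>m i. m \<in> M \<Longrightarrow> m i \<le> e" "m0 \<in> M" "\<not> p dvd a m0"
  shows "card {x \<in> I \<rightarrow>\<^sub>E S. p dvd (\<Sum>m\<in>M. a m * (\<Prod>i\<in>I. x i ^ m i))} * card S
           \<le> card I * e * card S ^ card I"
  using assms(4-)
proof (induction I arbitrary: M a m0 rule: finite_induct)
  case empty
  then have "M = {m0}" by (metis (no_types) all_not_in_conv empty_iff ext is_singletonI' is_singleton_the_elem singletonD)
  then show ?case using empty by simp
next
  case (insert j I)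
  let ?k = "m0 j"
  define M' where "M' = (\<lambda>m. m(j := 0)) ` {m \<in> M. m j = ?k}"
  define a' where "a' m = a (m(j := ?k))" for m
  define Z where "Z = {x \<in> I \<rightarrow>\<^sub>E S. p dvd (\<Sum>m\<in>M'. a' m * (\<Prod>i\<in>I. x i ^ m i))}"
  let ?B = "{x \<in> insert j I \<rightarrow>\<^sub>E S. p dvd (\<Sum>m\<in>M. a m * (\<Prod>i\<in>insert j I. x i ^ m i))}"
  define g where "g x = (\<Sum>m\<in>M. Polynomial.monom (a m * (\<Prod>i\<in>I. x i ^ m i)) (m j))" for x
  have inj: "inj_on (\<lambda>m. m(j := (0::nat))) {m \<in> M. m j = ?k}"
    by (rule inj_onI) (metis (mono_tags, lifting) fun_upd_triv fun_upd_upd mem_Collect_eq)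
  have Zle: "card Z * card S \<le> card I * e * card S ^ card I"
    unfolding Z_def
  proof (rule insert.IH)
    show "finite M'" using insert.prems(1) by (simp add: M'_def)
    show "m i = 0" if "m \<in> M'" "i \<notin> I" for m i
      using that insert.prems(2) by (auto simp: M'_def)
    show "m i \<le> e" if "m \<in> M'" for m i
      using that insert.prems(3) by (auto simp: M'_def)
    show "m0(j := 0) \<in> M'" using insert.prems(4) by (auto simp: M'_def)
    show "\<not> p dvd a' (m0(j := 0))" using insert.prems(5) by (simp add: a'_def)
  qed
  have ck: "coeff (g x) ?k = (\<Sum>m\<in>M'. a' m * (\<Prod>i\<in>I. x i ^ m i))" for x
  proof -
    have "coeff (g x) ?k = (\<Sum>m\<in>M. if m j = ?k then a m * (\<Prod>i\<in>I. x i ^ m i) else 0)"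
      by (simp add: g_def coeff_sum)
    also have "\<dots> = (\<Sum>m\<in>{m \<in> M. m j = ?k}. a m * (\<Prod>i\<in>I. x i ^ m i))"
      using insert.prems(1) by (simp add: sum.inter_filter)
    also have "\<dots> = (\<Sum>m\<in>{m \<in> M. m j = ?k}. a' (m(j := 0)) * (\<Prod>i\<in>I. x i ^ (m(j := 0)) i))"
      using insert.hyps(2) by (intro sum.cong refl arg_cong2[of _ _ _ _ "(*)"] prod.cong)
        (auto simp: a'_def fun_upd_idem)
    also have "\<dots> = (\<Sum>m\<in>M'. a' m * (\<Prod>i\<in>I. x i ^ m i))"
      unfolding M'_def by (simp add: sum.reindex[OF inj])
    finally show ?thesis .
  qed
  have dg: "degree (g x) \<le> e" for x
    unfolding g_def using insert.prems(1,3)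
    by (intro degree_sum_le) (auto intro: order_trans[OF degree_monom_le])
  have roots: "card {s \<in> S. p dvd poly (g x) s} \<le> e" if "x \<in> (I \<rightarrow>\<^sub>E S) - Z" for x
  proof -
    have "\<not> p dvd coeff (g x) ?k" using that by (auto simp: Z_def ck)
    then show ?thesis using card_roots_mod_le[OF pr S] dg order_trans by blast
  qed
  have pg: "poly (g x) s = (\<Sum>m\<in>M. a m * (\<Prod>i\<in>insert j I. (x(j := s)) i ^ m i))" for x s
  proof -
    have "(\<Prod>i\<in>insert j I. (x(j := s)) i ^ m i) = s ^ m j * (\<Prod>i\<in>I. x i ^ m i)" for m
    proof -
      have "(\<Prod>i\<in>I. (x(j := s)) i ^ m i) = (\<Prod>i\<in>I. x i ^ m i)"
        using insert.hyps(2) by (intro prod.cong) auto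
      then show ?thesis using insert.hyps by simp
    qed
    then show ?thesis by (simp add: g_def poly_sum poly_monom mult_ac)
  qed
  have fin: "finite (I \<rightarrow>\<^sub>E S)" using insert.hyps S(1) by (intro finite_PiE) auto
  have "?B \<subseteq> (\<lambda>(x, s). x(j := s)) ` ((Z \<times> S) \<union> Sigma ((I \<rightarrow>\<^sub>E S) - Z) (\<lambda>x. {s \<in> S. p dvd poly (g x) s}))"
  proof
    fix y assume y: "y \<in> ?B"
    define x where "x = y(j := undefined)"
    have xy: "y = x(j := y j)" by (simp add: x_def)
    have x: "x \<in> I \<rightarrow>\<^sub>E S" using y insert.hyps(2) by (auto simp: x_def PiE_def extensional_def)
    have s: "y j \<in> S" using y by auto
    have "p dvd poly (g x) (y j)" using y pg[of x "y j"] xy by simp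
    then have "(x, y j) \<in> (Z \<times> S) \<union> Sigma ((I \<rightarrow>\<^sub>E S) - Z) (\<lambda>x. {s \<in> S. p dvd poly (g x) s})"
      using x s by blast
    then show "y \<in> (\<lambda>(x, s). x(j := s)) ` ((Z \<times> S) \<union> Sigma ((I \<rightarrow>\<^sub>E S) - Z) (\<lambda>x. {s \<in> S. p dvd poly (g x) s}))"
      using xy by (metis (no_types, lifting) case_prod_conv image_eqI)
  qed
  then have "card ?B \<le> card ((Z \<times> S) \<union> Sigma ((I \<rightarrow>\<^sub>E S) - Z) (\<lambda>x. {s \<in> S. p dvd poly (g x) s}))"
    using fin S(1) by (intro surj_card_le) (auto simp: Z_def)
  also have "\<dots> \<le> card (Z \<times> S) + card (Sigma ((I \<rightarrow>\<^sub>E S) - Z) (\<lambda>x. {s \<in> S. p dvd poly (g x) s}))"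
    by (rule card_Un_le)
  also have "card (Sigma ((I \<rightarrow>\<^sub>E S) - Z) (\<lambda>x. {s \<in> S. p dvd poly (g x) s}))
      = (\<Sum>x\<in>(I \<rightarrow>\<^sub>E S) - Z. card {s \<in> S. p dvd poly (g x) s})"
    using fin S(1) by (intro card_SigmaI) auto
  also have "\<dots> \<le> (\<Sum>x\<in>(I \<rightarrow>\<^sub>E S) - Z. e)" by (intro sum_mono roots)
  also have "\<dots> \<le> card (I \<rightarrow>\<^sub>E S) * e" using fin by (simp add: card_mono)
  also have "card (I \<rightarrow>\<^sub>E S) = card S ^ card I" using insert.hyps by (simp add: card_PiE)
  finally have "card ?B \<le> card Z * card S + card S ^ card I * e"
    using S(1) by (simp add: card_cartesian_product)
  then have "card ?B * card S \<le> (card Z * card S + card S ^ card I * e) * card S"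
    by (rule mult_le_mono1)
  also have "\<dots> \<le> (card I * e * card S ^ card I + card S ^ card I * e) * card S"
    using Zle by (intro mult_le_mono1 add_le_mono1)
  also have "\<dots> = card (insert j I) * e * card S ^ card (insert j I)"
    using insert.hyps by (simp add: algebra_simps)
  finally show ?case .
qed

lemma fact_card_le_prod:
  fixes A :: "nat set"
  assumes "finite A" "0 \<notin> A"
  shows "fact (card A) \<le> \<Prod>A"
  using assms
proof (induction A rule: finite_linorder_max_induct)
  case (insert b A)
  have "A \<subseteq> {1..<b}" using insert by (auto simp: Suc_le_eq intro: gr0I)
  then have "card A \<le> b - 1" using card_mono[of "{1..<b}" A] by simp
  moreover have "b \<noteq> 0" "b \<notin> A" using insert by auto
  ultimately have "Suc (card A) \<le> b" by simp
  then show ?case using insert \<open>b \<notin> A\<close> mult_le_mono[of "Suc (card A)" b "fact (card A)" "\<Prod>A"]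
    by simp
qed simp

lemma coprime_prod_dvd:
  fixes n :: nat
  assumes "finite A" "\<And>p. p \<in> A \<Longrightarrow> p dvd n" "\<And>p q. p \<in> A \<Longrightarrow> q \<in> A \<Longrightarrow> p \<noteq> q \<Longrightarrow> coprime p q"
  shows "\<Prod>A dvd n"
  using assms
proof (induction A rule: finite_induct)
  case (insert p A)
  have "coprime p (\<Prod>A)" using insert by (intro prod_coprime_right) auto
  then show ?case using insert by (simp add: divides_mult)
qed simp

text \<open>
  A product of \<open>r\<close> distinct positive integers is at least \<open>r!\<close>, and the product of the prime divisors of
  \<open>a\<close> divides \<open>a\<close>.
\<close>

lemma fact_card_prime_divisors_le:
  fixes a :: int
  assumes "a \<noteq> 0"
  shows "finite {p::nat. prime p \<and> int p dvd a}"
    and "fact (card {p::nat. prime p \<and> int p dvd a}) \<le> \<bar>a\<bar>"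
proof -
  let ?E = "{p::nat. prime p \<and> int p dvd a}"
  have "?E \<subseteq> {..nat \<bar>a\<bar>}"
    using assms by (auto dest!: dvd_imp_le_int simp: nat_le_eq_zle le_nat_iff)
  then show fin: "finite ?E" by (rule finite_subset) simp
  have "\<Prod>?E dvd nat \<bar>a\<bar>"
    using fin
  proof (rule coprime_prod_dvd)
    show "p dvd nat \<bar>a\<bar>" if "p \<in> ?E" for p using that by (simp add: nat_dvd_iff flip: int_dvd_int_iff)
    show "coprime p q" if "p \<in> ?E" "q \<in> ?E" "p \<noteq> q" for p q
      using that by (auto intro: primes_coprime)
  qed
  then have "\<Prod>?E \<le> nat \<bar>a\<bar>" using assms by (intro dvd_imp_le) auto
  moreover have "fact (card ?E) \<le> \<Prod>?E" using fin by (intro fact_card_le_prod) auto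
  ultimately have "fact (card ?E) \<le> nat \<bar>a\<bar>" by linarith
  then have "int (fact (card ?E)) \<le> int (nat \<bar>a\<bar>)" by (rule iffD2[OF of_nat_le_iff])
  then show "fact (card ?E) \<le> \<bar>a\<bar>" by simp
qed

lemma ln_fact_ge: "real k * ln (real k) - real k \<le> ln (fact k)"
proof (cases "k = 0")
  case False
  have "real k ^ k / fact k \<le> suminf (\<lambda>n. real k ^ n / fact n)"
    using sum_le_suminf[OF summable_exp_generic[of "real k"], of "{k}"]
    by (auto simp: field_simps)
  also have "suminf (\<lambda>n. real k ^ n / fact n) = exp (real k)" by (simp add: exp_def field_simps)
  finally have "real k ^ k \<le> exp (real k) * fact k" by (simp add: field_simps)
  then have "ln (real k ^ k) \<le> ln (exp (real k) * fact k)" using False by simp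
  then show ?thesis using False by (simp add: ln_mult ln_realpow)
qed simp

text \<open>
  This inverts \<open>k ln k = O(L)\<close>. If \<open>k\<close> exceeds \<open>\<surd>L\<close>, then \<open>ln k\<close> is at least half of \<open>ln L\<close>; smaller \<open>k\<close>
  satisfy the bound anyway. The condition \<open>ln k \<ge> 2\<close> makes \<open>k ln k - k\<close> at least half of \<open>k ln k\<close>, and
  leaves out only \<open>k < 9\<close>.
\<close>

lemma le_div_ln_of_ln_fact_le:
  fixes L C :: real
  assumes L: "L > 1" and C: "C \<ge> 0" and k: "ln (fact k) \<le> C * L"
  shows "real k \<le> (4 * C + 9) * (L / ln L)"
proof -
  have lnL: "ln L > 0" using L by simp
  have "real k * ln L \<le> (4 * C + 9) * L"
  proof -
    consider "real k \<le> sqrt L" | "real k > sqrt L" "ln (real k) < 2" | "real k > sqrt L" "ln (real k) \<ge> 2"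
      by linarith
    then show ?thesis
    proof cases
      case 1
      have "ln L = 2 * ln (sqrt L)" using L by (simp add: ln_sqrt)
      also have "\<dots> \<le> 2 * sqrt L" using ln_less_self[of "sqrt L"] L by (simp add: less_imp_le)
      finally have "real k * ln L \<le> sqrt L * (2 * sqrt L)" using 1 lnL L by (intro mult_mono) auto
      also have "\<dots> = 2 * L" using L by simp
      also have "\<dots> \<le> (4 * C + 9) * L" using L C by (intro mult_right_mono) auto
      finally show ?thesis .
    next
      case 2
      then have k0: "real k > 0" using L by (smt (verit) real_sqrt_gt_0_iff)
      have "real k < exp 2" using 2 k0 by (metis exp_less_cancel_iff exp_ln)
      also have "exp (2::real) = exp 1 * exp 1" by (simp flip: exp_add)
      also have "\<dots> \<le> 3 * 3" using exp_le by (intro mult_mono) auto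
      finally have "real k * ln L \<le> 9 * L" using ln_less_self[of L] L lnL by (intro mult_mono) (auto simp: less_imp_le)
      also have "\<dots> \<le> (4 * C + 9) * L" using L C by (intro mult_right_mono) auto
      finally show ?thesis .
    next
      case 3
      then have k0: "real k > 0" using L by (smt (verit) real_sqrt_gt_0_iff)
      have "ln (sqrt L) \<le> ln (real k)" using 3 L k0 by simp
      then have "ln L \<le> 2 * ln (real k)" using L by (simp add: ln_sqrt)
      then have "real k * ln L \<le> 2 * (real k * ln (real k))" using k0 by simp
      also have "real k * 2 \<le> real k * ln (real k)" using 3 k0 by simp
      then have "2 * (real k * ln (real k)) \<le> 4 * (real k * ln (real k) - real k)" by simp
      also have "\<dots> \<le> 4 * (C * L)" using order_trans[OF ln_fact_ge k] by simp
      also have "\<dots> \<le> (4 * C + 9) * L" using L by (simp add: algebra_simps)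
      finally show ?thesis by simp
    qed
  qed
  then show ?thesis using lnL by (simp add: field_simps)
qed

lemma ln_three_gt_1: "ln (3::real) > 1"
proof -
  have "exp (1::real) = exp (1/4) ^ 4" by (simp flip: exp_of_nat_mult)
  also have "\<dots> \<le> (1 + 1/4 + (1/4)^2) ^ 4" by (intro power_mono exp_bound) auto
  also have "\<dots> < 3" by (simp add: power2_eq_square eval_nat_numeral)
  finally show ?thesis by (metis exp_gt_zero exp_less_cancel_iff exp_ln less_trans)
qed

section \<open>Size of the splitting relations\<close>

lemma specialize_cong:
  fixes R :: "('a, 'b) ring_scheme"
  assumes "cring R" "\<And>k. k \<in> {2..n} \<Longrightarrow> x k = x' k" "\<And>k. x' k \<in> carrier R"
  shows "specialize R n F x = specialize R n F x'"
proof -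
  interpret R: cring R by fact
  have "(\<Otimes>\<^bsub>R\<^esub> k \<in> {2..n}. x k [^]\<^bsub>R\<^esub> lookup m k) =
      (\<Otimes>\<^bsub>R\<^esub> k \<in> {2..n}. x' k [^]\<^bsub>R\<^esub> lookup m k)" for m :: "nat \<Rightarrow>\<^sub>0 nat"
    using assms by (intro R.finprod_cong' refl Pi_I R.nat_pow_closed) auto
  then show ?thesis by (intro ext) (simp only: specialize_def)
qed

lemma specialize_eq_meval:
  fixes R :: "'a ring"
  assumes R: "cring R" and x: "\<And>k. x k \<in> carrier R" and F: "rat_ypoly F \<in> ypolys n"
  shows "specialize R n F x i j = meval R x (coeff_YX F i j)"
proof -
  interpret R: cring R by fact
  interpret H: ring_hom_cring "ring_of_type_algebra :: int mpoly ring" R "meval R x"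
    by (rule ring_hom_cringI[OF cring_from_type_algebra R R.meval_hom[OF x]])
  let ?M = "{m \<in> keys (coeff F i). lookup m 1 = j}"
  have mon: "mon_eval R x (m - single 1 j) = (\<Otimes>\<^bsub>R\<^esub> k \<in> {2..n}. x k [^]\<^bsub>R\<^esub> lookup m k)"
    if m: "m \<in> ?M" for m
  proof -
    have "keys m \<subseteq> {1..n}"
      using F m by (auto simp: ypolys_def mpolys_def rat_ypoly_coeff keys_rat_mpoly)
    moreover have "1 \<notin> keys (m - single 1 j)"
      using m by (simp add: in_keys_iff lookup_minus)
    ultimately have "keys (m - single 1 j) \<subseteq> {1..n} - {1}"
      using keys_minus_subset by blast
    also have "\<dots> \<subseteq> {2..n}" by auto
    finally have "mon_eval R x (m - single 1 j)
        = (\<Otimes>\<^bsub>R\<^esub> k \<in> {2..n}. x k [^]\<^bsub>R\<^esub> lookup (m - single 1 j) k)"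
      using x by (intro R.mon_eval_superset) auto
    also have "\<dots> = (\<Otimes>\<^bsub>R\<^esub> k \<in> {2..n}. x k [^]\<^bsub>R\<^esub> lookup m k)"
      using x by (intro R.finprod_cong') (auto simp: lookup_minus lookup_single when_def)
    finally show ?thesis .
  qed
  have "meval R x (coeff_YX F i j) = (\<Oplus>\<^bsub>R\<^esub> m \<in> ?M. meval R x (single (m - single 1 j)
      (lookup (coeff F i) m)))"
    unfolding coeff_YX_def
    using H.hom_finsum[of "\<lambda>m. single (m - single 1 j) (lookup (coeff F i) m)" ?M]
    by (simp add: comp_def)
  also have "\<dots> = specialize R n F x i j"
    unfolding specialize_def using x mon by (intro R.finsum_cong') (auto simp: R.meval_single)
  finally show ?thesis ..
qed

text \<open>
  Evaluating the coefficients of \<open>F\<close> at \<open>x\<close> and then the relation is the same as evaluating the polynomial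
  \<open>relation_at F D a b\<close> at \<open>x\<close>.
\<close>

lemma relation_at_vanishes:
  fixes R :: "'a ring"
  assumes R: "Ring.field R" and x: "\<And>k. x k \<in> carrier R" and F: "rat_ypoly F \<in> ypolys n"
    and monic: "lead_coeff F = 1" and deg: "total_degree F \<le> D"
    and splits: "splits_completely R (specialize R n F x)"
  shows "meval R x (relation_at F D a b) = \<zero>\<^bsub>R\<^esub>"
proof -
  interpret R: Ring.field R by fact
  have hom: "meval R x \<in> Ring.ring_hom ring_of_type_algebra R" by (rule R.meval_hom[OF x])
  have eq: "specialize R n F x i j = meval R x (coeff_YX F i j)" for i j
    by (rule specialize_eq_meval[OF R.is_cring x F])
  have z: "meval R x 0 = \<zero>\<^bsub>R\<^esub>" by (simp add: meval_def)
  have "meval R x (relation_at F D a b) =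
      meval R (\<lambda>k. meval R x (case prod_decode k of (i, j) \<Rightarrow> coeff_YX F i j))
        (splitting_relation (degree F) D a b)"
    unfolding relation_at_def
    by (rule ring_hom_meval[OF cring_from_type_algebra R.is_cring hom]) simp
  also have "(\<lambda>k. meval R x (case prod_decode k of (i, j) \<Rightarrow> coeff_YX F i j))
      = (\<lambda>k. case prod_decode k of (i, j) \<Rightarrow> specialize R n F x i j)"
    by (rule ext) (simp add: eq split: prod.split)
  also have "meval R \<dots> (splitting_relation (degree F) D a b) = \<zero>\<^bsub>R\<^esub>"
  proof (rule relation_vanishes_if_splits[OF R _ _ _ _ splits])
    show "specialize R n F x i j \<in> carrier R" for i j using x by (simp add: eq)
    have "{m. (m = 0 \<or> m = (0 :: nat \<Rightarrow>\<^sub>0 nat)) \<and> lookup m 1 = 0} = {0}" by auto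
    then have "coeff_YX F (degree F) 0 = 1"
      using monic by (simp add: coeff_YX_def)
    then show "specialize R n F x (degree F) 0 = \<one>\<^bsub>R\<^esub>" by (simp add: eq R.meval_one[OF x])
    show "specialize R n F x i j = \<zero>\<^bsub>R\<^esub>" if "i > degree F" for i j
      using that by (simp add: specialize_def coeff_eq_0)
    show "specialize R n F x i j = \<zero>\<^bsub>R\<^esub>" if "j > D" for i j
    proof -
      have "{m \<in> keys (coeff F i). lookup m 1 = j} = {}"
        using lookup_le_total_degree[of _ F i 1] deg that by fastforce
      then show ?thesis unfolding specialize_def by (simp only: R.finsum_empty)
    qed
  qed
  finally show ?thesis .
qed

text \<open>
  The sum of absolute values is submultiplicative, unlike the largest absolute value.
\<close>

definition lnorm :: "int mpoly \<Rightarrow> int" where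
  "lnorm p = (\<Sum>m\<in>keys p. \<bar>lookup p m\<bar>)"

lemma lnorm_superset:
  assumes "finite A" "keys p \<subseteq> A"
  shows "lnorm p = (\<Sum>m\<in>A. \<bar>lookup p m\<bar>)"
  unfolding lnorm_def using assms by (intro sum.mono_neutral_left) (auto simp: in_keys_iff)

lemma lnorm_nonneg [simp]: "lnorm p \<ge> 0"
  by (simp add: lnorm_def sum_nonneg)

lemma lnorm_add: "lnorm (p + q) \<le> lnorm p + lnorm q"
proof -
  let ?A = "keys p \<union> keys q"
  have "lnorm (p + q) = (\<Sum>m\<in>?A. \<bar>lookup (p + q) m\<bar>)"
    by (rule lnorm_superset) (simp, rule Poly_Mapping.keys_add)
  also have "\<dots> \<le> (\<Sum>m\<in>?A. \<bar>lookup p m\<bar> + \<bar>lookup q m\<bar>)"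
    by (intro sum_mono) (simp add: lookup_add)
  also have "\<dots> = lnorm p + lnorm q"
    by (simp add: sum.distrib lnorm_superset[of ?A p] lnorm_superset[of ?A q])
  finally show ?thesis .
qed

lemma lnorm_single [simp]: "lnorm (single m a) = \<bar>a\<bar>"
  by (simp add: lnorm_def)

lemma lnorm_0 [simp]: "lnorm 0 = 0"
  by (simp add: lnorm_def)

lemma lnorm_sum: "lnorm (\<Sum>i\<in>A. g i) \<le> (\<Sum>i\<in>A. lnorm (g i))"
proof (induction A rule: infinite_finite_induct)
  case (insert i A)
  then show ?case using lnorm_add[of "g i" "\<Sum>i\<in>A. g i"] by simp
qed simp_all

lemma lnorm_mult: "lnorm (p * q) \<le> lnorm p * lnorm q"
proof -
  have "p * q = (\<Sum>m\<in>keys p. single m (lookup p m)) *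
      (\<Sum>m\<in>keys q. single m (lookup q m))"
    by (simp only: sum_single_keys)
  also have "\<dots> = (\<Sum>m\<in>keys p. \<Sum>m'\<in>keys q.
      single (m + m') (lookup p m * lookup q m'))"
    by (simp only: sum_product mult_single)
  finally have "lnorm (p * q) \<le> (\<Sum>m\<in>keys p. \<Sum>m'\<in>keys q.
      lnorm (single (m + m') (lookup p m * lookup q m')))"
    by (simp only:) (intro order_trans[OF lnorm_sum] sum_mono order_refl)
  also have "\<dots> = lnorm p * lnorm q"
    by (simp only: lnorm_single abs_mult) (simp only: lnorm_def sum_product)
  finally show ?thesis .
qed

definition supported :: "nat set \<Rightarrow> nat \<Rightarrow> int mpoly \<Rightarrow> bool" where
  "supported I e p \<longleftrightarrow>
     (\<forall>m\<in>keys p. keys m \<subseteq> I \<and> (\<forall>k. lookup m k \<le> e))"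

lemma supported_single_0: "supported I e (single 0 a)"
  by (simp add: supported_def)

lemma supported_sum:
  assumes "\<And>i. i \<in> A \<Longrightarrow> supported I e (g i)"
  shows "supported I e (\<Sum>i\<in>A. g i)"
  unfolding supported_def
proof
  fix m assume m: "m \<in> keys (\<Sum>i\<in>A. g i)"
  obtain i where "i \<in> A" "m \<in> keys (g i)"
    using subsetD[OF Poly_Mapping.keys_sum m] by blast
  then show "keys m \<subseteq> I \<and> (\<forall>k. lookup m k \<le> e)"
    using assms unfolding supported_def by blast
qed

lemma supported_mult:
  assumes "supported I e p" "supported I e' q"
  shows "supported I (e + e') (p * q)"
  unfolding supported_def
proof
  fix m assume m: "m \<in> keys (p * q)"
  obtain a b where ab: "a \<in> keys p" "b \<in> keys q" "m = a + b"
    using subsetD[OF Poly_Mapping.keys_mult m] by blast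
  have "keys m \<subseteq> I"
    using ab assms Poly_Mapping.keys_add[of a b] unfolding supported_def by blast
  moreover have "lookup m k \<le> e + e'" for k
    using ab assms unfolding supported_def by (simp add: lookup_add add_mono)
  ultimately show "keys m \<subseteq> I \<and> (\<forall>k. lookup m k \<le> e + e')" by blast
qed

lemma supported_mono: "supported I e p \<Longrightarrow> e \<le> e' \<Longrightarrow> supported I e' p"
  unfolding supported_def using order_trans by blast

lemma supported_power:
  assumes "supported I e p"
  shows "supported I (k * e) (p ^ k)"
proof (induction k)
  case 0
  show ?case using supported_single_0[of I 0 1] by simp
next
  case (Suc k)
  then show ?case using supported_mult[OF assms Suc] by simp
qed

lemma supported_prod:
  assumes "\<And>i. i \<in> A \<Longrightarrow> supported I (e i) (g i)"
  shows "supported I (\<Sum>i\<in>A. e i) (\<Prod>i\<in>A. g i)"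
  using assms
proof (induction A rule: infinite_finite_induct)
  case (insert i A)
  then show ?case using supported_mult[of I "e i" "g i" "\<Sum>i\<in>A. e i" "\<Prod>i\<in>A. g i"] by simp
qed (use supported_single_0[of I 0 1] in simp_all)

lemma lnorm_power:
  assumes "lnorm p \<le> T" "1 \<le> T"
  shows "lnorm (p ^ k) \<le> T ^ k"
proof (induction k)
  case 0
  show ?case using lnorm_single[of 0 1] by simp
next
  case (Suc k)
  have "lnorm (p * p ^ k) \<le> lnorm p * lnorm (p ^ k)" by (rule lnorm_mult)
  also have "\<dots> \<le> T * T ^ k" using Suc assms by (intro mult_mono) auto
  finally show ?case by simp
qed

lemma lnorm_prod:
  assumes "\<And>i. i \<in> A \<Longrightarrow> lnorm (g i) \<le> T ^ e i" "1 \<le> T"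
  shows "lnorm (\<Prod>i\<in>A. g i) \<le> T ^ (\<Sum>i\<in>A. e i)"
  using assms(1)
proof (induction A rule: infinite_finite_induct)
  case (insert i A)
  have "lnorm (g i * (\<Prod>i\<in>A. g i)) \<le> lnorm (g i) * lnorm (\<Prod>i\<in>A. g i)" by (rule lnorm_mult)
  also have "\<dots> \<le> T ^ e i * T ^ (\<Sum>i\<in>A. e i)" using insert assms(2) by (intro mult_mono) auto
  finally show ?case using insert by (simp add: power_add)
qed (use lnorm_single[of 0 1] in simp_all)

text \<open>
  An upper bound for the total degree that is convenient in estimates of \<open>teval c r\<close>.
\<close>

definition mweight :: "int mpoly \<Rightarrow> nat" where
  "mweight r = (\<Sum>m\<in>keys r. \<Sum>k\<in>keys m. lookup m k)"

lemma le_mweight: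
  assumes "m \<in> keys r"
  shows "(\<Sum>k\<in>keys m. lookup m k) \<le> mweight r"
  unfolding mweight_def
  by (rule member_le_sum[where f = "\<lambda>m. \<Sum>k\<in>keys m. lookup m k"]) (use assms in auto)

lemma supported_teval:
  assumes "\<And>k. supported I e (c k)"
  shows "supported I (mweight r * e) (teval c r)"
  unfolding teval_eq
proof (rule supported_sum)
  fix m assume m: "m \<in> keys r"
  have "supported I (\<Sum>k\<in>keys m. lookup m k * e)
      (\<Prod>k\<in>keys m. c k ^ lookup m k)"
    by (intro supported_prod supported_power assms)
  moreover have "(\<Sum>k\<in>keys m. lookup m k * e) \<le> mweight r * e"
    using le_mweight[OF m] by (simp flip: sum_distrib_right)
  ultimately have 1: "supported I (mweight r * e) (\<Prod>k\<in>keys m. c k ^ lookup m k)"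
    by (rule supported_mono)
  have 2: "supported I 0 (of_int (lookup r m))"
    using supported_single_0[of I 0 "of_int (lookup r m)"] by (simp only: single_of_int)
  show "supported I (mweight r * e) (of_int (lookup r m) *
      (\<Prod>k\<in>keys m. c k ^ lookup m k))"
    using supported_mult[OF 2 1] by (simp only: add_0)
qed

lemma lnorm_teval:
  assumes c: "\<And>k. lnorm (c k) \<le> T" and T: "1 \<le> T"
  shows "lnorm (teval c r) \<le> lnorm r * T ^ mweight r"
proof -
  have "lnorm (teval c r) \<le> (\<Sum>m\<in>keys r. lnorm (of_int (lookup r m) *
      (\<Prod>k\<in>keys m. c k ^ lookup m k)))"
    unfolding teval_eq by (rule lnorm_sum)
  also have "\<dots> \<le> (\<Sum>m\<in>keys r. \<bar>lookup r m\<bar> * T ^ mweight r)"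
  proof (rule sum_mono)
    fix m assume m: "m \<in> keys r"
    have "lnorm (\<Prod>k\<in>keys m. c k ^ lookup m k) \<le>
        T ^ (\<Sum>k\<in>keys m. lookup m k)"
      by (intro lnorm_prod lnorm_power c T)
    also have "\<dots> \<le> T ^ mweight r" using T le_mweight[OF m] by (intro power_increasing)
    finally have 1: "lnorm (\<Prod>k\<in>keys m. c k ^ lookup m k) \<le> T ^ mweight r" .
    have 2: "lnorm (of_int (lookup r m)) = \<bar>lookup r m\<bar>"
      using lnorm_single[of 0 "of_int (lookup r m)"] by (simp only: single_of_int) simp
    show "lnorm (of_int (lookup r m) * (\<Prod>k\<in>keys m. c k ^ lookup m k))
        \<le> \<bar>lookup r m\<bar> * T ^ mweight r"
      by (rule order_trans[OF lnorm_mult]) (use 1 in \<open>simp add: 2 mult_left_mono\<close>)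
  qed
  also have "\<dots> = lnorm r * T ^ mweight r" by (simp add: lnorm_def sum_distrib_right)
  finally show ?thesis .
qed

lemma coeff_le_lnorm: "\<bar>lookup p m\<bar> \<le> lnorm p"
proof (cases "m \<in> keys p")
  case True
  then show ?thesis unfolding lnorm_def
    by (intro member_le_sum[where f = "\<lambda>m. \<bar>lookup p m\<bar>"]) auto
qed (simp add: in_keys_iff)

lemma supported_coeff_YX:
  assumes "rat_ypoly F \<in> ypolys n"
  shows "supported {2..n} (total_degree F) (coeff_YX F i j)"
  unfolding supported_def
proof
  fix m assume m: "m \<in> keys (coeff_YX F i j)"
  obtain m0 where m0: "m0 \<in> keys (coeff F i)" "lookup m0 1 = j"
    "m = m0 - single 1 j"
    by (rule keys_coeff_YX[OF m])
  have "lookup m k \<le> total_degree F" for k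
    using lookup_le_total_degree[OF m0(1), of k] by (simp add: m0(3) lookup_minus)
  then show "keys m \<subseteq> {2..n} \<and> (\<forall>k. lookup m k \<le> total_degree F)"
    using coeff_YX_vars[OF assms m] by blast
qed

lemma lnorm_coeff_YX:
  assumes F: "rat_ypoly F \<in> ypolys n"
  shows "lnorm (coeff_YX F i j) \<le> int ((total_degree F + 1) ^ n) * height F"
proof -
  let ?p = "coeff F i" and ?D = "total_degree F"
  have h: "\<bar>lookup ?p m\<bar> \<le> height F" for m
  proof (cases "m \<in> keys ?p")
    case True
    then have "(i, m) \<in> ymonomials F" by (simp add: ymonomials_def in_keys_iff)
    then show ?thesis unfolding height_def using finite_ymonomials[of F]
      by (intro Max_ge) (auto intro!: image_eqI[of _ _ "(i, m)"])
  next
    case False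
    have "0 \<le> height F" unfolding height_def using finite_ymonomials[of F] by (intro Max_ge) auto
    then show ?thesis using False by (simp add: in_keys_iff)
  qed
  have "card (keys ?p) \<le> card ({1..n} \<rightarrow>\<^sub>E {..?D})"
  proof (rule card_inj_on_le)
    have k: "keys m \<subseteq> {1..n}" if "m \<in> keys ?p" for m
      using F that by (auto simp: ypolys_def mpolys_def rat_ypoly_coeff keys_rat_mpoly)
    show "inj_on (\<lambda>m. restrict (lookup m) {1..n}) (keys ?p)"
    proof (rule inj_onI)
      fix m m' assume m: "m \<in> keys ?p" "m' \<in> keys ?p"
        and e: "restrict (lookup m) {1..n} = restrict (lookup m') {1..n}"
      show "m = m'"
      proof (rule poly_mapping_eqI)
        fix a
        show "lookup m a = lookup m' a"
        proof (cases "a \<in> {1..n}")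
          case True
          then show ?thesis using fun_cong[OF e, of a] by simp
        next
          case False
          then have "a \<notin> keys m" "a \<notin> keys m'" using k m by blast+
          then show ?thesis by (simp add: in_keys_iff)
        qed
      qed
    qed
    show "(\<lambda>m. restrict (lookup m) {1..n}) ` keys ?p \<subseteq> {1..n} \<rightarrow>\<^sub>E {..?D}"
      using lookup_le_total_degree[of _ F i] by auto
    show "finite ({1..n} \<rightarrow>\<^sub>E {..?D})" by (intro finite_PiE) auto
  qed
  then have c: "card (keys ?p) \<le> (?D + 1) ^ n" by (simp add: card_PiE)
  let ?M = "{m \<in> keys ?p. lookup m 1 = j}"
  have "lnorm (coeff_YX F i j) \<le> (\<Sum>m\<in>?M. lnorm (single (m - single 1 j) (lookup ?p m)))"
    unfolding coeff_YX_def by (rule lnorm_sum)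
  also have "\<dots> \<le> (\<Sum>m\<in>?M. height F)" using h by (intro sum_mono) simp
  also have "\<dots> = int (card ?M) * height F" by simp
  also have "\<dots> \<le> int ((?D + 1) ^ n) * height F"
  proof (rule mult_right_mono)
    have "card ?M \<le> card (keys ?p)" by (rule card_mono) auto
    then show "int (card ?M) \<le> int ((?D + 1) ^ n)" using c by linarith
    show "0 \<le> height F" using h[of 0] by linarith
  qed
  finally show ?thesis .
qed

lemma finite_splitting_relations: "finite {splitting_relation d D a b | d a b. d \<le> D}"
proof -
  have "finite (range (\<lambda>(a, b). coeff (coeff R a) b))" for R :: "int mpoly poly poly"
  proof -
    have "range (\<lambda>(a, b). coeff (coeff R a) b) \<subseteq>
        insert 0 (\<Union>a\<le>degree R. range (coeff (coeff R a)))"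
    proof (rule image_subsetI)
      fix ab :: "nat \<times> nat"
      obtain a b where ab: "ab = (a, b)" by (rule prod.exhaust)
      show "(case ab of (a, b) \<Rightarrow> coeff (coeff R a) b) \<in>
        insert 0 (\<Union>a\<le>degree R. range (coeff (coeff R a)))"
        unfolding ab by (cases "a \<le> degree R") (auto simp: coeff_eq_0)
    qed
    moreover have "finite (range (coeff q))" for q :: "int mpoly poly"
      by (simp add: range_coeff)
    ultimately show ?thesis by (meson finite.insertI finite_UN_I finite_atMost finite_subset)
  qed
  then have "finite (\<Union>d\<le>D. range (\<lambda>(a, b). splitting_relation d D a b))"
    unfolding splitting_relation_def by blast
  moreover have "{splitting_relation d D a b | d a b. d \<le> D} \<subseteq> (\<Union>d\<le>D. range (\<lambda>(a, b). splitting_relation d D a b))"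
    by fastforce
  ultimately show ?thesis by (rule finite_subset[rotated])
qed

lemma card_zeros_mpoly_le:
  fixes p :: int and P :: "int mpoly"
  assumes pr: "\<And>a b. p dvd a * b \<Longrightarrow> p dvd a \<or> p dvd b"
    and S: "finite S" "\<And>a b. a \<in> S \<Longrightarrow> b \<in> S \<Longrightarrow> p dvd a - b \<Longrightarrow> a = b"
    and I: "finite I" and P: "supported I e P" and m0: "\<not> p dvd lookup P m0"
  shows "card {x \<in> I \<rightarrow>\<^sub>E S. p dvd teval x P} * card S \<le> card I * e * card S ^ card I"
proof -
  define M where "M = lookup ` keys P"
  define a where "a g = lookup P (Abs_poly_mapping g)" for g
  have aM: "a (lookup m) = lookup P m" for m
    by (simp add: a_def lookup_inverse)
  have sM: "(\<Sum>g\<in>M. a g * (\<Prod>i\<in>I. x i ^ g i)) = teval x P" for x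
  proof -
    have "inj_on lookup (keys P)" by (rule inj_onI) (simp add: poly_mapping_eqI)
    then have "(\<Sum>g\<in>M. a g * (\<Prod>i\<in>I. x i ^ g i)) = (\<Sum>m\<in>keys P. lookup P m * (\<Prod>i\<in>I. x i ^ lookup m i))"
      unfolding M_def by (simp add: sum.reindex aM)
    also have "\<dots> = teval x P"
      unfolding teval_eq
    proof (rule sum.cong[OF refl])
      fix m assume "m \<in> keys P"
      then have "keys m \<subseteq> I" using P by (simp add: supported_def)
      then have "(\<Prod>i\<in>I. x i ^ lookup m i) = (\<Prod>i\<in>keys m. x i ^ lookup m i)"
        using I by (intro prod.mono_neutral_right) (auto simp: in_keys_iff)
      then show "lookup P m * (\<Prod>i\<in>I. x i ^ lookup m i)
        = of_int (lookup P m) * (\<Prod>i\<in>keys m. x i ^ lookup m i)" by simp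
    qed
    finally show ?thesis .
  qed
  have "card {x \<in> I \<rightarrow>\<^sub>E S. p dvd (\<Sum>g\<in>M. a g * (\<Prod>i\<in>I. x i ^ g i))} * card S \<le> card I * e * card S ^ card I"
  proof (rule card_zeros_mod_le[OF pr S I, where ?m0.0 = "lookup m0"])
    show "finite M" by (simp add: M_def)
    show "g i = 0" if "g \<in> M" "i \<notin> I" for g i
      using that P unfolding M_def supported_def by (metis imageE in_keys_iff subsetD)
    show "g i \<le> e" if "g \<in> M" for g i using that P unfolding M_def supported_def by blast
    show "lookup m0 \<in> M"
      unfolding M_def by (rule imageI) (use m0 in \<open>metis dvd_0_right in_keys_iff\<close>)
    show "\<not> p dvd a (lookup m0)" using m0 by (simp add: aM)
  qed
  then show ?thesis by (simp only: sM)
qed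

section \<open>Counting splitting specializations\<close>

lemma card_le_of_card_mult_le:
  fixes s :: nat
  assumes "c * s \<le> N * e * s ^ N" "s \<ge> 1" "N \<ge> 1"
  shows "c \<le> N * e * s ^ (N - 1)"
proof -
  obtain N' where N': "N = Suc N'" using assms(3) by (cases N) auto
  have "c * s \<le> (N * e * s ^ N') * s" using assms(1) by (simp add: N' mult_ac)
  then show ?thesis using assms(2) by (simp add: N')
qed

lemma rat_splitting_count:
  assumes n: "n \<ge> 2" and F: "rat_ypoly F \<in> ypolys n" "lead_coeff F = 1"
    and P: "relation_at F (total_degree F) a b \<noteq> 0" "supported {2..n} e (relation_at F (total_degree F) a b)"
    and B: "B \<ge> (1::real)"
  shows "real (card {x \<in> {2..n} \<rightarrow>\<^sub>E {k::int. real_of_int \<bar>k\<bar> \<le> B}.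
           splits_completely (ring_of_type_algebra :: rat ring)
             (specialize ring_of_type_algebra n F (\<lambda>k. rat_of_int (x k)))})
         \<le> real (n * e * 3 ^ (n - 2)) * B ^ (n - 2)"
proof -
  define P where "P = relation_at F (total_degree F) a b"
  define S where "S = {k::int. real_of_int \<bar>k\<bar> \<le> B}"
  have S: "S = {- \<lfloor>B\<rfloor>..\<lfloor>B\<rfloor>}" by (auto simp: S_def abs_le_iff le_floor_iff floor_le_iff) linarith+
  then have fS: "finite S" by simp
  have "card S = nat (2 * \<lfloor>B\<rfloor> + 1)" unfolding S by simp
  then have cS: "real (card S) \<le> 3 * B" "card S \<ge> 1"
    using B by (auto simp: le_floor_iff le_nat_iff) linarith+
  obtain m0 where m0: "lookup P m0 \<noteq> 0"
    using P(1) unfolding P_def by (metis lookup_zero poly_mapping_eqI)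
  have z: "card {x \<in> {2..n} \<rightarrow>\<^sub>E S. 0 dvd teval x P} * card S \<le> card {2..n} * e * card S ^ card {2..n}"
  proof (rule card_zeros_mpoly_le[where ?m0.0 = m0])
    show "supported {2..n} e P" using P(2) by (simp add: P_def)
  qed (use m0 fS in auto)
  have "{x \<in> {2..n} \<rightarrow>\<^sub>E S. splits_completely (ring_of_type_algebra :: rat ring)
             (specialize ring_of_type_algebra n F (\<lambda>k. rat_of_int (x k)))} \<subseteq> {x \<in> {2..n} \<rightarrow>\<^sub>E S. 0 dvd teval x P}"
  proof safe
    fix x :: "nat \<Rightarrow> int"
    assume s: "splits_completely (ring_of_type_algebra :: rat ring) (specialize ring_of_type_algebra n F (\<lambda>k. rat_of_int (x k)))"
    have "teval (\<lambda>k. rat_of_int (x k)) P = \<zero>\<^bsub>ring_of_type_algebra\<^esub>"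
      unfolding P_def using F s by (intro relation_at_vanishes[OF field_from_type_algebra, where n = n]) auto
    moreover have "rat_of_int (teval x P) = teval (\<lambda>k. rat_of_int (x k)) P"
      by (rule ring_hom_meval[OF cring_from_type_algebra cring_from_type_algebra type_ring_hom_of_int]) simp
    ultimately show "0 dvd teval x P" by simp
  qed
  then have "card {x \<in> {2..n} \<rightarrow>\<^sub>E S. splits_completely (ring_of_type_algebra :: rat ring)
             (specialize ring_of_type_algebra n F (\<lambda>k. rat_of_int (x k)))} \<le> card {x \<in> {2..n} \<rightarrow>\<^sub>E S. 0 dvd teval x P}"
    by (rule card_mono[rotated]) (simp add: finite_PiE fS)
  also have "\<dots> \<le> card {2..n} * e * card S ^ (card {2..n} - 1)"
    using z cS(2) n by (intro card_le_of_card_mult_le) auto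
  also have "\<dots> \<le> n * e * card S ^ (n - 2)"
    by (intro mult_le_mono) (auto simp: numeral_2_eq_2)
  finally have "real (card {x \<in> {2..n} \<rightarrow>\<^sub>E S. splits_completely (ring_of_type_algebra :: rat ring)
             (specialize ring_of_type_algebra n F (\<lambda>k. rat_of_int (x k)))}) \<le> real (n * e * card S ^ (n - 2))"
    by (rule of_nat_mono)
  also have "\<dots> = real (n * e) * real (card S) ^ (n - 2)" by simp
  also have "\<dots> \<le> real (n * e) * (3 * B) ^ (n - 2)"
    using cS by (intro mult_left_mono power_mono) auto
  also have "\<dots> = real (n * e * 3 ^ (n - 2)) * B ^ (n - 2)" by (simp add: power_mult_distrib)
  finally show ?thesis unfolding S_def .
qed

lemma mod_splitting_count:
  assumes n: "n \<ge> 2" and F: "rat_ypoly F \<in> ypolys n" "lead_coeff F = 1"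
    and P: "supported {2..n} e (relation_at F (total_degree F) a b)"
    and p: "prime p" "\<not> int p dvd lookup (relation_at F (total_degree F) a b) m0"
  shows "real (card {x \<in> {2..n} \<rightarrow>\<^sub>E carrier (residue_ring (int p)).
              splits_completely (residue_ring (int p)) (specialize (residue_ring (int p)) n F x)})
            \<le> real (n * e) * real p ^ (n - 2)"
proof -
  define P where "P = relation_at F (total_degree F) a b"
  define R where "R = residue_ring (int p)"
  have p1: "p > 1" using p(1) by (rule prime_gt_1_nat)
  interpret r: residues_prime p R
    by unfold_locales (use p(1) in \<open>simp_all add: R_def\<close>)
  have Rf: "Ring.field R" by (rule r.is_field)
  have cR: "carrier R = {0..int p - 1}" by (simp add: R_def residue_ring_def)
  have hom: "(\<lambda>k. k mod int p) \<in> Ring.ring_hom ring_of_type_algebra R"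
    using p1 by (intro ring_hom_memI) (simp_all add: R_def residue_ring_def mod_mult_eq mod_add_eq)
  have pr: "int p dvd c * d \<Longrightarrow> int p dvd c \<or> int p dvd d" for c d
    using p(1) by (simp add: prime_dvd_mult_iff)
  have z: "card {x \<in> {2..n} \<rightarrow>\<^sub>E carrier R. int p dvd teval x P} * card (carrier R)
      \<le> card {2..n} * e * card (carrier R) ^ card {2..n}"
  proof (rule card_zeros_mpoly_le[OF pr, where ?m0.0 = m0])
    show "supported {2..n} e P" using P by (simp add: P_def)
    show "\<not> int p dvd lookup P m0" using p(2) by (simp add: P_def)
    show "c = d" if "c \<in> carrier R" "d \<in> carrier R" "int p dvd c - d" for c d
    proof (rule ccontr)
      assume "c \<noteq> d"
      then have "int p \<le> \<bar>c - d\<bar>" using that(3) dvd_imp_le_int[of "c - d" "int p"] by simp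
      then show False using that(1,2) unfolding cR by auto
    qed
  qed (simp_all add: cR)
  have "{x \<in> {2..n} \<rightarrow>\<^sub>E carrier R. splits_completely R (specialize R n F x)} \<subseteq>
      {x \<in> {2..n} \<rightarrow>\<^sub>E carrier R. int p dvd teval x P}"
  proof safe
    fix x assume x: "x \<in> {2..n} \<rightarrow>\<^sub>E carrier R" and s: "splits_completely R (specialize R n F x)"
    \<comment> \<open>Outside of 2..n the values of x are arbitrary integers, which need not lie in the ring.\<close>
    define x' where "x' k = (if k \<in> {2..n} then x k else 0)" for k
    have x'R: "x' k \<in> carrier R" for k using x p1 by (auto simp: x'_def cR)
    have "specialize R n F x = specialize R n F x'"
      by (rule specialize_cong[OF r.cring _ x'R]) (simp add: x'_def)
    then have "splits_completely R (specialize R n F x')" using s by simp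
    then have "meval R x' P = \<zero>\<^bsub>R\<^esub>"
      unfolding P_def by (intro relation_at_vanishes[OF Rf x'R F(1,2)]) auto
    moreover have "x' = (\<lambda>k. x' k mod int p)"
      using x'R unfolding cR by (auto simp: fun_eq_iff)
    then have "meval R x' P = teval x' P mod int p"
      using ring_hom_meval[OF cring_from_type_algebra r.cring hom, of x' P] by simp
    ultimately have "int p dvd teval x' P" by (simp add: R_def residue_ring_def dvd_eq_mod_eq_0)
    moreover have "teval x' P = teval x P"
    proof (rule cring.meval_cong[OF cring_from_type_algebra])
      fix m k assume "m \<in> keys P" "k \<in> keys m"
      then have "k \<in> {2..n}" using P unfolding P_def supported_def by blast
      then show "x' k = x k" by (simp add: x'_def)
    qed simp
    ultimately show "int p dvd teval x P" by simp
  qed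
  then have "card {x \<in> {2..n} \<rightarrow>\<^sub>E carrier R. splits_completely R (specialize R n F x)} \<le>
      card {x \<in> {2..n} \<rightarrow>\<^sub>E carrier R. int p dvd teval x P}"
    by (rule card_mono[rotated]) (simp add: cR finite_PiE)
  also have "\<dots> \<le> card {2..n} * e * card (carrier R) ^ (card {2..n} - 1)"
    using z n p1 by (intro card_le_of_card_mult_le) (auto simp: cR)
  also have "\<dots> \<le> n * e * p ^ (n - 2)"
    by (intro mult_le_mono) (auto simp: numeral_2_eq_2 cR)
  finally have "real (card {x \<in> {2..n} \<rightarrow>\<^sub>E carrier R. splits_completely R (specialize R n F x)})
      \<le> real (n * e * p ^ (n - 2))" by (rule of_nat_mono)
  then show ?thesis by (simp add: R_def)
qed

text \<open>
  The constants are absorbed into the factor of \<open>ln h\<close>, which exceeds \<open>1\<close> because \<open>h \<ge> 3\<close>.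
\<close>

lemma card_prime_divisors_le:
  fixes h :: int and c :: int
  assumes c: "c \<noteq> 0" "\<bar>c\<bar> \<le> A * (T * h) ^ w" and A: "A \<ge> 1" and T: "T \<ge> 1" and h: "h \<ge> 3"
  shows "real (card {p::nat. prime p \<and> int p dvd c}) \<le>
     (4 * (ln (real_of_int A) + real w * ln (real_of_int T) + real w) + 9) * (ln (real_of_int h) / ln (ln (real_of_int h)))"
proof (rule le_div_ln_of_ln_fact_le)
  let ?k = "card {p::nat. prime p \<and> int p dvd c}"
  have L: "ln (real_of_int h) > 1"
    using ln_three_gt_1 h by (metis less_le_trans ln_le_cancel_iff of_int_le_iff of_int_numeral zero_less_numeral less_le_trans)
  then show "1 < ln (real_of_int h)" .
  have pos: "ln (real_of_int A) \<ge> 0" "ln (real_of_int T) \<ge> 0" using A T by auto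
  then show "0 \<le> ln (real_of_int A) + real w * ln (real_of_int T) + real w" by simp
  have "fact ?k \<le> \<bar>c\<bar>" by (rule fact_card_prime_divisors_le(2)[OF c(1)])
  then have "fact ?k \<le> A * (T * h) ^ w" using c(2) by linarith
  then have "real_of_int (fact ?k) \<le> real_of_int (A * (T * h) ^ w)" by (simp only: of_int_le_iff)
  then have "fact ?k \<le> real_of_int A * (real_of_int T * real_of_int h) ^ w" by simp
  moreover have "real_of_int A > 0" "real_of_int T > 0" "real_of_int h > 0" using A T h by auto
  ultimately have "ln (fact ?k) \<le> ln (real_of_int A * (real_of_int T * real_of_int h) ^ w)"
    by (subst ln_le_cancel_iff) auto
  also have "\<dots> = ln (real_of_int A) + real w * (ln (real_of_int T) + ln (real_of_int h))"
    using \<open>real_of_int A > 0\<close> \<open>real_of_int T > 0\<close> \<open>real_of_int h > 0\<close> by (simp add: ln_mult ln_realpow)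
  also have "\<dots> \<le> (ln (real_of_int A) + real w * ln (real_of_int T) + real w) * ln (real_of_int h)"
  proof -
    have "ln (real_of_int A) \<le> ln (real_of_int A) * ln (real_of_int h)"
      using pos L mult_left_mono[of 1 "ln (real_of_int h)" "ln (real_of_int A)"] by simp
    moreover have "real w * ln (real_of_int T) \<le> real w * ln (real_of_int T) * ln (real_of_int h)"
      using pos L mult_left_mono[of 1 "ln (real_of_int h)" "real w * ln (real_of_int T)"] by simp
    ultimately show ?thesis by (simp add: algebra_simps)
  qed
  finally show "ln (fact ?k) \<le> (ln (real_of_int A) + real w * ln (real_of_int T) + real w) * ln (real_of_int h)" .
qed

theorem theorem1p5:
  fixes n D :: nat
  assumes "n \<ge> 2"
  shows "\<exists>C1 C2 C3 :: real. \<forall>F :: int mpoly poly.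
    genuine_poly n (rat_ypoly F) \<and> total_degree F = D \<longrightarrow>
      (\<forall>B::real. B \<ge> 1 \<longrightarrow>
         real (card {x \<in> {2..n} \<rightarrow>\<^sub>E {k::int. real_of_int \<bar>k\<bar> \<le> B}.
           splits_completely (ring_of_type_algebra :: rat ring)
             (specialize ring_of_type_algebra n F (\<lambda>k. rat_of_int (x k)))})
         \<le> C1 * B ^ (n - 2)) \<and>
      (\<exists>E :: nat set. finite E \<and> (\<forall>p\<in>E. prime p) \<and>
         (let h = max (real_of_int (height F)) 3 in real (card E) \<le> C2 * (ln h / ln (ln h))) \<and>
         (\<forall>p. prime p \<and> p \<notin> E \<longrightarrow>
            real (card {x \<in> {2..n} \<rightarrow>\<^sub>E carrier (residue_ring (int p)).
              splits_completely (residue_ring (int p)) (specialize (residue_ring (int p)) n F x)})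
            \<le> C3 * real p ^ (n - 2)))"
proof -
  \<comment> \<open>Only finitely many relations occur for all F of total degree D, so the constants may be sums over them.\<close>
  define \<R> where "\<R> = {splitting_relation d D a b | d a b. d \<le> D}"
  have fin: "finite \<R>" unfolding \<R>_def by (rule finite_splitting_relations)
  define w where "w = (\<Sum>r\<in>\<R>. mweight r)"
  define A where "A = 1 + (\<Sum>r\<in>\<R>. lnorm r)"
  define T where "T = int ((D + 1) ^ n)"
  define e where "e = w * D"
  define C2 where "C2 = 4 * (ln (real_of_int A) + real w * ln (real_of_int T) + real w) + 9"
  have A1: "A \<ge> 1" by (simp add: A_def sum_nonneg)
  have T1: "T \<ge> 1" by (simp add: T_def)
  show ?thesis
  proof (intro exI allI impI, elim conjE)
    fix F :: "int mpoly poly"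
    assume gen: "genuine_poly n (rat_ypoly F)" and D: "total_degree F = D"
    have Fy: "rat_ypoly F \<in> ypolys n" and Fm': "lead_coeff (rat_ypoly F) = 1"
      using gen by (simp_all add: genuine_poly_def)
    have Fm: "lead_coeff F = 1"
    proof -
      have "rat_mpoly (lead_coeff F) = rat_mpoly 1"
        using Fm' by (simp only: degree_rat_ypoly rat_ypoly_coeff rat_mpoly_1)
      then show ?thesis by (metis (no_types, lifting) of_int_eq_iff poly_mapping_eqI rat_mpoly_lookup)
    qed
    define h where "h = max (height F) 3"
    have rh: "max (real_of_int (height F)) 3 = real_of_int h" by (simp add: h_def max_def)
    obtain a b where ab: "relation_at F D a b \<noteq> 0"
      using genuine_relation_nonzero[OF _ gen, of D] lookup_le_total_degree[of _ F _ 1] assms D by auto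
    obtain m0 where m0: "lookup (relation_at F D a b) m0 \<noteq> 0"
      using ab by (metis lookup_zero poly_mapping_eqI)
    let ?r = "splitting_relation (degree F) D a b"
    have r: "?r \<in> \<R>" unfolding \<R>_def using degree_le_total_degree[of F] D by blast
    have rw: "mweight ?r \<le> w" unfolding w_def by (rule member_le_sum[OF r _ fin]) simp
    have rA: "lnorm ?r \<le> A" unfolding A_def using member_le_sum[OF r _ fin, of lnorm] by simp
    have sup: "supported {2..n} e (relation_at F D a b)"
      unfolding relation_at_def e_def
    proof (rule supported_mono[OF supported_teval])
      show "supported {2..n} D (case prod_decode k of (i, j) \<Rightarrow> coeff_YX F i j)" for k
        using supported_coeff_YX[OF Fy] D by (simp split: prod.split)
      show "mweight ?r * D \<le> w * D" using rw by simp
    qed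
    have Th: "1 \<le> T * h"
    proof -
      have "1 * 1 \<le> T * h" using T1 by (intro mult_mono) (auto simp: h_def)
      then show ?thesis by simp
    qed
    have "lnorm (relation_at F D a b) \<le> lnorm ?r * (T * h) ^ mweight ?r"
      unfolding relation_at_def
    proof (rule lnorm_teval[OF _ Th])
      fix k
      obtain i j where k: "prod_decode k = (i, j)" by (rule prod.exhaust)
      have "lnorm (coeff_YX F i j) \<le> T * height F" using lnorm_coeff_YX[OF Fy, of i j] D by (simp add: T_def)
      also have "\<dots> \<le> T * h" using T1 by (intro mult_left_mono) (auto simp: h_def)
      finally show "lnorm (case prod_decode k of (i, j) \<Rightarrow> coeff_YX F i j) \<le> T * h" by (simp add: k)
    qed
    also have "\<dots> \<le> A * (T * h) ^ w"
      using rA rw Th A1 by (intro mult_mono power_increasing) auto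
    finally have c: "\<bar>lookup (relation_at F D a b) m0\<bar> \<le> A * (T * h) ^ w"
      using coeff_le_lnorm order_trans by blast
    let ?E = "{p::nat. prime p \<and> int p dvd lookup (relation_at F D a b) m0}"
    show "(\<forall>B::real. B \<ge> 1 \<longrightarrow>
         real (card {x \<in> {2..n} \<rightarrow>\<^sub>E {k::int. real_of_int \<bar>k\<bar> \<le> B}.
           splits_completely (ring_of_type_algebra :: rat ring)
             (specialize ring_of_type_algebra n F (\<lambda>k. rat_of_int (x k)))})
         \<le> real (n * e * 3 ^ (n - 2)) * B ^ (n - 2)) \<and>
      (\<exists>E :: nat set. finite E \<and> (\<forall>p\<in>E. prime p) \<and>
         (let h = max (real_of_int (height F)) 3 in real (card E) \<le> C2 * (ln h / ln (ln h))) \<and>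
         (\<forall>p. prime p \<and> p \<notin> E \<longrightarrow>
            real (card {x \<in> {2..n} \<rightarrow>\<^sub>E carrier (residue_ring (int p)).
              splits_completely (residue_ring (int p)) (specialize (residue_ring (int p)) n F x)})
            \<le> real (n * e) * real p ^ (n - 2)))"
    proof (intro conjI allI impI exI[of _ ?E] ballI)
      fix B :: real assume "1 \<le> B"
      with ab sup show "real (card {x \<in> {2..n} \<rightarrow>\<^sub>E {k::int. real_of_int \<bar>k\<bar> \<le> B}.
           splits_completely (ring_of_type_algebra :: rat ring)
             (specialize ring_of_type_algebra n F (\<lambda>k. rat_of_int (x k)))})
         \<le> real (n * e * 3 ^ (n - 2)) * B ^ (n - 2)"
        unfolding D[symmetric] by (rule rat_splitting_count[OF assms Fy Fm])
    next
      show "finite ?E" by (rule fact_card_prime_divisors_le(1)[OF m0])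
      show "prime p" if "p \<in> ?E" for p using that by simp
      show "let h = max (real_of_int (height F)) 3 in real (card ?E) \<le> C2 * (ln h / ln (ln h))"
        unfolding Let_def rh C2_def by (rule card_prime_divisors_le[OF m0 c A1 T1]) (simp add: h_def)
    next
      fix p assume p: "prime p \<and> p \<notin> ?E"
      show "real (card {x \<in> {2..n} \<rightarrow>\<^sub>E carrier (residue_ring (int p)).
              splits_completely (residue_ring (int p)) (specialize (residue_ring (int p)) n F x)})
            \<le> real (n * e) * real p ^ (n - 2)"
        using p sup unfolding D[symmetric] by (intro mod_splitting_count[OF assms Fy Fm]) auto
    qed
  qed
qed

end
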